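(* Let $1\leq p\leq\infty$, $\alpha>-1$, and let $\varphi$ be a measurable function on $(0,\infty)$. Then: (i) If $\int_0^\infty t^{\frac{1+\alpha}{p}-1}|\varphi(t)|\,dt<\infty$, then $\mathscr H_\varphi$ is bounded on $\mathcal H^p_{|\cdot|^\alpha}(\mathbb C_+)$. Moreover, $$\left|\int_0^\infty t^{\frac{1+\alpha}{p}-1}\varphi(t)\,dt\right|\leq\|\mathscr H_\varphi\|_{\mathcal H^p_{|\cdot|^\alpha}(\mathbb C_+)\to\mathcal H^p_{|\cdot|^\alpha}(\mathbb C_+)}\leq\int_0^\infty t^{\frac{1+\alpha}{p}-1}|\varphi(t)|\,dt.$$ (ii) Conversely, if $\varphi\geq0$ and $\mathscr H_\varphi$ is bounded on $\mathcal H^p_{|\cdot|^\alpha}(\mathbb C_+)$, then $\int_0^\infty t^{\frac{1+\alpha}{p}-1}|\varphi(t)|\,dt<\infty$.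
   Context: $\mathbb C_+=\{x+iy\in\mathbb C: y>0\}$ is the upper half-plane. Functions on $(0,\infty)$ are complex-valued unless said to be nonnegative. When $p=\infty$, $\frac{1+\alpha}{p}$ is read as $0$. For a measurable function $\varphi$ on $(0,\infty)$, the Hausdorff operator is defined for suitable holomorphic functions $f$ on $\mathbb C_+$ by $\mathscr H_\varphi f(z)=\int_0^\infty f\left(\frac zt\right)\frac{\varphi(t)}{t}\,dt$, $z\in\mathbb C_+$. For $0<p\leq\infty$ and $\alpha>-1$, the power weighted Hardy space $\mathcal H^p_{|\cdot|^\alpha}(\mathbb C_+)$ is the set of all holomorphic functions $f$ on $\mathbb C_+$ with $\|f\|_{\mathcal H^p_{|\cdot|^\alpha}(\mathbb C_+)}<\infty$, where $\|f\|_{\mathcal H^p_{|\cdot|^\alpha}(\mathbb C_+)}:=\sup_{y>0}\left(\int_{-\infty}^\infty|f(x+iy)|^p|x|^\alpha\,dx\right)^{1/p}$ if $0<p<\infty$, and $\|f\|_{\mathcal H^\infty_{|\cdot|^\alpha}(\mathbb C_+)}:=\sup_{z\in\mathbb C_+}|f(z)|$. An operator is bounded on a normed space $X$ if it is well-defined on every $f\in X$ (here: the defining integral makes sense as a Lebesgue integral), maps $X$ into $X$, and has finite operator norm $\|\cdot\|_{X\to X}$. *)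

theory Defs
  imports "HOL-Complex_Analysis.Complex_Analysis"
begin

definition upper_half_plane :: "complex set" where
  "upper_half_plane = {z. Im z > 0}"

text \<open>Powers of extended nonnegative reals, meant for exponents \<open>r > 0\<close> only (so that
  infinity is sent to infinity).\<close>

definition ennreal_powr :: "ennreal \<Rightarrow> real \<Rightarrow> ennreal" where
  "ennreal_powr a r = (if a = \<infinity> then \<infinity> else ennreal (enn2real a powr r))"

text \<open>The norm takes the value infinity off the space. In Isabelle \<open>0 powr \<alpha> = 0\<close> for every
  \<open>\<alpha>\<close>; this affects the weight only at the single point \<open>x = 0\<close>.\<close>

definition hardy_norm :: "ennreal \<Rightarrow> real \<Rightarrow> (complex \<Rightarrow> complex) \<Rightarrow> ennreal" where
  "hardy_norm p \<alpha> f =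
     (if p = \<infinity> then (SUP z\<in>upper_half_plane. ennreal (cmod (f z)))
      else (SUP y\<in>{0<..}.
        ennreal_powr
          (\<integral>\<^sup>+x. ennreal (cmod (f (Complex x y)) powr enn2real p * \<bar>x\<bar> powr \<alpha>) \<partial>lborel)
          (1 / enn2real p)))"

text \<open>Elements are total functions whose values off the half-plane are irrelevant: neither
  the norm nor the Hausdorff operator evaluated on the half-plane depends on them.\<close>

definition hardy_space :: "ennreal \<Rightarrow> real \<Rightarrow> (complex \<Rightarrow> complex) set" where
  "hardy_space p \<alpha> = {f. f holomorphic_on upper_half_plane \<and> hardy_norm p \<alpha> f < \<infinity>}"

definition hausdorff_op :: "(real \<Rightarrow> complex) \<Rightarrow> (complex \<Rightarrow> complex) \<Rightarrow> complex \<Rightarrow> complex" where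
  "hausdorff_op \<phi> f z =
     (LINT t|lebesgue_on {0<..}. f (z / complex_of_real t) * (\<phi> t / complex_of_real t))"

text \<open>Needed separately because the Bochner integral is \<open>0\<close> for non-integrable functions.\<close>

definition hausdorff_well_defined :: "(real \<Rightarrow> complex) \<Rightarrow> (complex \<Rightarrow> complex) \<Rightarrow> bool" where
  "hausdorff_well_defined \<phi> f \<longleftrightarrow>
     (\<forall>z\<in>upper_half_plane.
        integrable (lebesgue_on {0<..})
          (\<lambda>t. f (z / complex_of_real t) * (\<phi> t / complex_of_real t)))"

definition hardy_op_norm ::
    "ennreal \<Rightarrow> real \<Rightarrow> ((complex \<Rightarrow> complex) \<Rightarrow> complex \<Rightarrow> complex) \<Rightarrow> ennreal" where
  "hardy_op_norm p \<alpha> T =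
     (SUP f\<in>{f \<in> hardy_space p \<alpha>. hardy_norm p \<alpha> f \<le> 1}. hardy_norm p \<alpha> (T f))"

definition hausdorff_bounded :: "(real \<Rightarrow> complex) \<Rightarrow> ennreal \<Rightarrow> real \<Rightarrow> bool" where
  "hausdorff_bounded \<phi> p \<alpha> \<longleftrightarrow>
     (\<forall>f\<in>hardy_space p \<alpha>.
        hausdorff_well_defined \<phi> f \<and> hausdorff_op \<phi> f \<in> hardy_space p \<alpha>) \<and>
     hardy_op_norm p \<alpha> (hausdorff_op \<phi>) < \<infinity>"

text \<open>The number \<open>(1 + \<alpha>) / p\<close>, read as \<open>0\<close> for infinite \<open>p\<close>.\<close>

definition hardy_exponent :: "ennreal \<Rightarrow> real \<Rightarrow> real" where
  "hardy_exponent p \<alpha> = (if p = \<infinity> then 0 else (1 + \<alpha>) / enn2real p)"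

end

theory Submission
  imports Defs
begin

text \<open>Let \<open>\<beta> = (1 + \<alpha>) / p\<close>. Dilation by \<open>t\<close> multiplies the norm by \<open>t powr \<beta>\<close>, so the upper bound
  is Minkowski's integral inequality, once point evaluations are known to be locally bounded; the
  latter makes the defining integral converge and depend holomorphically on the point.

  For the lower bound, the functions \<open>(1 - \<i> z) powr - (\<beta> + \<epsilon>)\<close> are approximate eigenfunctions with
  eigenvalue the integral of \<open>t powr (\<beta> - 1) * \<phi> t\<close>.

  For nonnegative \<open>\<phi>\<close> the same functions are positive on the imaginary axis, and so are their images
  under all iterates of the operator. If the integral over \<open>[1/L, L]\<close> exceeds \<open>I\<close>, the \<open>k\<close>-th iterate
  is at least of order \<open>I ^ k\<close> at a suitable point, whereas the operator norm \<open>A\<close> and the boundedness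
  of point evaluations bound it by \<open>A ^ k\<close> times a power of \<open>k\<close>. Letting \<open>k\<close> tend to infinity gives
  \<open>I \<le> A\<close>.\<close>

subsection \<open>Line integrals and the Hardy norm\<close>

text \<open>The formal eigenfunctions are the powers of \<open>- \<i> * z\<close> with exponent
  \<open>- \<beta>\<close>: replacing \<open>z\<close> by \<open>z / t\<close> multiplies them by
  \<open>t powr \<beta>\<close>. They miss the space, because on the boundary line their q-th powers
  times the weight give \<open>1 / \<bar>x\<bar>\<close>, whose integral diverges logarithmically at
  0 and at infinity. Adding 1 to the base cures the divergence at 0, the extra exponent
  \<open>\<epsilon>\<close> that at infinity, and the q-th power of the norm is then of order
  \<open>1 / \<epsilon>\<close>. For infinite \<open>p\<close> the exponent \<open>\<beta>\<close>
  is 0 and the constant 1 is an exact eigenfunction.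

  In the converse, norms of truncated operators cannot simply be compared: positivity is available
  on the imaginary axis only and gives no domination on horizontal lines. Comparison of values on
  the axis survives, but passing between values and norms loses a constant factor. The iterates are
  there to make that factor harmless, since it does not grow exponentially in their number.\<close>

definition line_integral :: "real \<Rightarrow> real \<Rightarrow> (complex \<Rightarrow> complex) \<Rightarrow> real \<Rightarrow> ennreal" where
  "line_integral q \<alpha> f y =
     (\<integral>\<^sup>+x. ennreal (cmod (f (Complex x y)) powr q * \<bar>x\<bar> powr \<alpha>) \<partial>lborel)"

lemma ennreal_powr_inverse_le_iff:
  assumes "q > 0" "N \<ge> 0"
  shows "ennreal_powr a (1 / q) \<le> ennreal N \<longleftrightarrow> a \<le> ennreal (N powr q)"
proof (cases a)
  case (real r)
  have "r powr (1 / q) \<le> N \<longleftrightarrow> r \<le> N powr q"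
  proof
    assume "r powr (1 / q) \<le> N"
    from powr_mono2[OF _ _ this, of q] show "r \<le> N powr q"
      using assms real by (simp add: powr_powr)
  next
    assume "r \<le> N powr q"
    from powr_mono2[OF _ _ this, of "1 / q"] show "r powr (1 / q) \<le> N"
      using assms real by (simp add: powr_powr)
  qed
  then show ?thesis using real assms by (simp add: ennreal_powr_def)
next
  case top
  then show ?thesis by (simp add: ennreal_powr_def top_unique)
qed

text \<open>Norm estimates for finite exponents pass through this equivalence: it trades the
  supremum and the root for bounds on q-th powers, one height at a time, where sums and Fubini's
  theorem are available.\<close>

lemma hardy_norm_le_iff:
  assumes "q > 0" "N \<ge> 0"
  shows "hardy_norm (ennreal q) \<alpha> f \<le> ennreal N \<longleftrightarrow>
    (\<forall>y>0. line_integral q \<alpha> f y \<le> ennreal (N powr q))"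
  using assms by (simp add: hardy_norm_def SUP_le_iff ennreal_powr_inverse_le_iff line_integral_def Ball_def)

lemma hardy_norm_infinity_le_iff:
  assumes "N \<ge> 0"
  shows "hardy_norm \<infinity> \<alpha> f \<le> ennreal N \<longleftrightarrow> (\<forall>z\<in>upper_half_plane. cmod (f z) \<le> N)"
  using assms by (simp add: hardy_norm_def SUP_le_iff)

section \<open>Convexity of powers and Jensen's inequality\<close>

text \<open>Convexity of the q-th power at
  \<open>u + v = (1 - l) * (u / (1 - l)) + l * (v / l)\<close>. The weight \<open>l\<close> stays
  free because its limit 0 matters: the factor of \<open>u powr q\<close> then tends to 1, so that a
  relatively negligible \<open>v\<close> costs nothing in the limit.\<close>

lemma powr_weighted_add_le:
  fixes u v l q :: real
  assumes "1 \<le> q" "0 < l" "l < 1" "0 \<le> u" "0 \<le> v"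
  shows "(u + v) powr q \<le> (1 - l) powr (1 - q) * u powr q + l powr (1 - q) * v powr q"
proof (cases "u = 0 \<or> v = 0")
  case True
  have "1 \<le> (1 - l) powr (1 - q)" "1 \<le> l powr (1 - q)"
    using assms powr_mono2'[of "1 - q" "1 - l" 1] powr_mono2'[of "1 - q" l 1] by auto
  then have "u powr q \<le> (1 - l) powr (1 - q) * u powr q" "v powr q \<le> l powr (1 - q) * v powr q"
    by (simp_all add: mult_le_cancel_right1 mult_right_mono)
  then show ?thesis using True by auto
next
  case False
  have "((1 - l) * (u / (1 - l)) + l * (v / l)) powr q
      \<le> (1 - l) * (u / (1 - l)) powr q + l * (v / l) powr q"
    using convex_onD[OF powr_convex[OF assms(1)], of l "u / (1 - l)" "v / l"] assms False by simp
  moreover have "(1 - l) * (u / (1 - l)) + l * (v / l) = u + v" using assms by simp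
  ultimately have "(u + v) powr q \<le> (1 - l) * (u / (1 - l)) powr q + l * (v / l) powr q" by simp
  moreover have "(1 - l) * (u / (1 - l)) powr q = (1 - l) powr (1 - q) * u powr q"
    "l * (v / l) powr q = l powr (1 - q) * v powr q"
    using assms by (simp_all add: powr_divide powr_diff)
  ultimately show ?thesis by simp
qed

text \<open>The tangent of the q-th power at \<open>u\<close> lies below the graph; the terms are
  arranged so that both sides are nonnegative and can be integrated in \<open>ennreal\<close>. It is
  Young's inequality for the exponents \<open>q\<close> and \<open>q / (q - 1)\<close>.\<close>

lemma powr_ge_tangent:
  fixes u v q :: real
  assumes "1 \<le> q" "0 < u" "0 \<le> v"
  shows "q * u powr (q - 1) * v \<le> v powr q + (q - 1) * u powr q"
proof (cases "q = 1")
  case False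
  then have q: "q > 1" using assms by simp
  have "v * u powr (q - 1) \<le> v powr q / q + (u powr (q - 1)) powr (q / (q - 1)) / (q / (q - 1))"
    by (rule Youngs_inequality) (use q assms in \<open>auto simp: field_simps\<close>)
  then have "v * u powr (q - 1) \<le> v powr q / q + u powr q / (q / (q - 1))"
    using q by (simp add: powr_powr)
  then show ?thesis using q by (simp add: field_simps)
qed (use assms in auto)

text \<open>Integrates the tangent of \<open>v powr q\<close> at the mean value \<open>a / K\<close>.\<close>

lemma nn_integral_powr_jensen:
  fixes g :: "'a \<Rightarrow> real"
  assumes q: "1 \<le> q" and K: "0 < K" "emeasure M (space M) \<le> ennreal K"
    and g: "g \<in> borel_measurable M" "\<And>t. t \<in> space M \<Longrightarrow> 0 \<le> g t"
    and a: "0 \<le> a" "ennreal a \<le> (\<integral>\<^sup>+t. ennreal (g t) \<partial>M)"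
  shows "ennreal (a powr q) \<le> ennreal (K powr (q - 1)) * (\<integral>\<^sup>+t. ennreal (g t powr q) \<partial>M)"
proof (cases "a = 0")
  case False
  with a have a0: "a > 0" by simp
  define u where "u = a / K"
  have u: "u > 0" using a0 K by (simp add: u_def)
  show ?thesis
  proof (cases "\<integral>\<^sup>+t. ennreal (g t powr q) \<partial>M")
    case top
    then show ?thesis using K by (simp add: ennreal_mult_top)
  next
    case (real S)
    have "ennreal (q * u powr (q - 1) * a) \<le> ennreal (q * u powr (q - 1)) * (\<integral>\<^sup>+t. ennreal (g t) \<partial>M)"
      using a q by (simp add: ennreal_mult mult_left_mono)
    also have "\<dots> = (\<integral>\<^sup>+t. ennreal (q * u powr (q - 1)) * ennreal (g t) \<partial>M)"
      using g by (simp add: nn_integral_cmult)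
    also have "\<dots> \<le> (\<integral>\<^sup>+t. ennreal (g t powr q) + ennreal ((q - 1) * u powr q) \<partial>M)"
    proof (rule nn_integral_mono)
      fix t assume t: "t \<in> space M"
      have "ennreal (q * u powr (q - 1)) * ennreal (g t) = ennreal (q * u powr (q - 1) * g t)"
        using g(2)[OF t] q by (simp add: ennreal_mult)
      also have "\<dots> \<le> ennreal (g t powr q + (q - 1) * u powr q)"
        by (intro ennreal_leI powr_ge_tangent q u g(2) t)
      also have "\<dots> = ennreal (g t powr q) + ennreal ((q - 1) * u powr q)"
        using q by (simp add: ennreal_plus)
      finally show "ennreal (q * u powr (q - 1)) * ennreal (g t)
        \<le> ennreal (g t powr q) + ennreal ((q - 1) * u powr q)" .
    qed
    also have "\<dots> = ennreal S + ennreal ((q - 1) * u powr q) * emeasure M (space M)"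
      using g(1) real by (subst nn_integral_add) auto
    also have "\<dots> \<le> ennreal S + ennreal ((q - 1) * u powr q) * ennreal K"
      using K by (intro add_left_mono mult_left_mono) auto
    also have "\<dots> = ennreal (S + (q - 1) * u powr q * K)"
      using real K q by (simp add: ennreal_mult ennreal_plus)
    finally have "q * u powr (q - 1) * a \<le> S + (q - 1) * u powr q * K"
      using real q K by (subst (asm) ennreal_le_iff) auto
    \<comment> \<open>Because \<open>u\<close> is the mean \<open>a / K\<close>, the linear term is
      \<open>q\<close> copies of \<open>u powr q * K\<close>, of which the constant term of the
      tangent absorbs \<open>q - 1\<close>.\<close>
    moreover have "u powr (q - 1) * a = u powr q * K"
      using u K a0 by (simp add: u_def powr_diff field_simps)
    then have "q * u powr (q - 1) * a = q * (u powr q * K)" by (simp only: mult.assoc)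
    moreover have "(q - 1) * u powr q * K = q * (u powr q * K) - u powr q * K"
      by (simp add: algebra_simps)
    ultimately have "u powr q * K \<le> S" by linarith
    moreover have "u powr q * K = a powr q / K powr (q - 1)"
      using K a0 by (simp add: u_def powr_diff powr_divide field_simps)
    ultimately have "a powr q \<le> K powr (q - 1) * S"
      using mult_right_mono[OF \<open>u powr q * K \<le> S\<close>, of "K powr (q - 1)"] K by (simp add: field_simps)
    then show ?thesis using real by (simp add: ennreal_mult[symmetric] ennreal_leI)
  qed
qed simp

section \<open>Functions on the half-plane: measurability, scaling and dilation\<close>

lemma open_upper_half_plane: "open upper_half_plane"
  unfolding upper_half_plane_def by (simp add: open_halfspace_Im_gt)

lemma convex_upper_half_plane: "convex upper_half_plane"
  unfolding upper_half_plane_def by (simp add: convex_halfspace_Im_gt)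

lemma Complex_in_upper_half_plane [simp]: "Complex x y \<in> upper_half_plane \<longleftrightarrow> y > 0"
  by (simp add: upper_half_plane_def)

lemma upper_half_plane_divide_iff [simp]:
  "t > 0 \<Longrightarrow> z / complex_of_real t \<in> upper_half_plane \<longleftrightarrow> z \<in> upper_half_plane"
  by (simp add: upper_half_plane_def zero_less_divide_iff)

lemma holomorphic_dilate:
  assumes "f holomorphic_on upper_half_plane" "t > 0"
  shows "(\<lambda>z. f (z / complex_of_real t)) holomorphic_on upper_half_plane"
proof -
  have "(f \<circ> (\<lambda>z. z / complex_of_real t)) holomorphic_on upper_half_plane"
    by (rule holomorphic_on_compose_gen[OF _ assms(1)]) (use assms(2) in \<open>auto intro!: holomorphic_intros\<close>)
  then show ?thesis by (simp add: o_def)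
qed

text \<open>Elements of the space are arbitrary off the half-plane, so they need not be Borel
  measurable as total functions. Cutting them off restores this, also for compositions with several
  real variables.\<close>

lemma borel_measurable_holomorphic_extension:
  assumes "f holomorphic_on upper_half_plane"
  shows "(\<lambda>z. if z \<in> upper_half_plane then f z else 0) \<in> borel_measurable borel"
  by (intro borel_measurable_continuous_on_if holomorphic_on_imp_continuous_on[OF assms]
      borel_open open_upper_half_plane continuous_on_const)

lemma borel_measurable_Complex [measurable (raw)]:
  assumes [measurable]: "f \<in> borel_measurable M" "g \<in> borel_measurable M"
  shows "(\<lambda>x. Complex (f x) (g x)) \<in> borel_measurable M"
  unfolding Complex_eq by measurable

lemma borel_measurable_on_line:
  assumes "f holomorphic_on upper_half_plane" "y > 0"
  shows "(\<lambda>x. f (Complex x y)) \<in> borel_measurable borel"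
proof -
  note [measurable] = borel_measurable_holomorphic_extension[OF assms(1)]
  have "(\<lambda>x. (if Complex x y \<in> upper_half_plane then f (Complex x y) else 0)) \<in> borel_measurable borel"
    by (rule measurable_compose[where g = "\<lambda>z. if z \<in> upper_half_plane then f z else 0"]) measurable
  then show ?thesis using assms(2) by simp
qed

lemma line_integral_cmult:
  assumes f: "f holomorphic_on upper_half_plane" and y: "y > 0"
  shows "line_integral q \<alpha> (\<lambda>z. c * f z) y = ennreal (cmod c powr q) * line_integral q \<alpha> f y"
proof -
  note [measurable] = borel_measurable_on_line[OF f y]
  have "line_integral q \<alpha> (\<lambda>z. c * f z) y =
     (\<integral>\<^sup>+x. ennreal (cmod c powr q) * ennreal (cmod (f (Complex x y)) powr q * \<bar>x\<bar> powr \<alpha>) \<partial>lborel)"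
    unfolding line_integral_def
    by (intro nn_integral_cong) (simp add: norm_mult powr_mult mult.assoc ennreal_mult)
  also have "\<dots> = ennreal (cmod c powr q) * line_integral q \<alpha> f y"
    unfolding line_integral_def by (rule nn_integral_cmult) measurable
  finally show ?thesis .
qed

lemma hardy_norm_cmult_le:
  assumes p: "1 \<le> p" and N: "0 \<le> N" and f: "hardy_norm p \<alpha> f \<le> ennreal N"
    and hol: "f holomorphic_on upper_half_plane"
  shows "hardy_norm p \<alpha> (\<lambda>z. c * f z) \<le> ennreal (cmod c * N)"
proof (cases p)
  case (real q)
  with p have q: "q \<ge> 1" by simp
  have "line_integral q \<alpha> (\<lambda>z. c * f z) y \<le> ennreal ((cmod c * N) powr q)" if y: "y > 0" for y
  proof -
    have "line_integral q \<alpha> f y \<le> ennreal (N powr q)"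
      using f hardy_norm_le_iff[of q N \<alpha> f] q N y real by auto
    then have "ennreal (cmod c powr q) * line_integral q \<alpha> f y \<le> ennreal (cmod c powr q) * ennreal (N powr q)"
      by (intro mult_left_mono) auto
    then show ?thesis
      by (simp add: line_integral_cmult[OF hol y] powr_mult N ennreal_mult)
  qed
  then show ?thesis using hardy_norm_le_iff[of q "cmod c * N"] q N real by auto
next
  case top
  then show ?thesis
    using f N hardy_norm_infinity_le_iff[of N \<alpha> f] hardy_norm_infinity_le_iff[of "cmod c * N" \<alpha>]
    by (auto simp: norm_mult intro!: mult_left_mono)
qed

text \<open>Substituting \<open>t * x\<close> for \<open>x\<close> yields a factor \<open>t\<close>
  from the Jacobian and \<open>t powr \<alpha>\<close> from the weight. The q-th root of their
  product is \<open>t powr \<beta>\<close>, which is where \<open>hardy_exponent\<close> comes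
  from.\<close>

lemma line_integral_dilate:
  assumes f: "f holomorphic_on upper_half_plane" and y: "y > 0" and t: "t > 0"
  shows "line_integral q \<alpha> (\<lambda>z. f (z / complex_of_real t)) y
    = ennreal (t powr (1 + \<alpha>)) * line_integral q \<alpha> f (y / t)"
proof -
  have yt: "y / t > 0" using y t by simp
  note [measurable] = borel_measurable_on_line[OF f yt]
    borel_measurable_on_line[OF holomorphic_dilate[OF f t] y]
  have Cd: "Complex (t * x) y / complex_of_real t = Complex x (y / t)" for x
    using t by (simp add: complex_eq_iff)
  have "line_integral q \<alpha> (\<lambda>z. f (z / complex_of_real t)) y
    = ennreal t * (\<integral>\<^sup>+x. ennreal (cmod (f (Complex x (y / t))) powr q * \<bar>t * x\<bar> powr \<alpha>) \<partial>lborel)"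
    unfolding line_integral_def
    by (subst nn_integral_real_affine[where c = t and t = 0]) (use t in \<open>simp_all add: Cd\<close>)
  also have "(\<integral>\<^sup>+x. ennreal (cmod (f (Complex x (y / t))) powr q * \<bar>t * x\<bar> powr \<alpha>) \<partial>lborel)
    = (\<integral>\<^sup>+x. ennreal (t powr \<alpha>) * ennreal (cmod (f (Complex x (y / t))) powr q * \<bar>x\<bar> powr \<alpha>) \<partial>lborel)"
    using t by (intro nn_integral_cong) (simp add: abs_mult powr_mult mult_ac ennreal_mult[symmetric])
  also have "\<dots> = ennreal (t powr \<alpha>) * line_integral q \<alpha> f (y / t)"
    unfolding line_integral_def by (rule nn_integral_cmult) measurable
  finally show ?thesis
    using t by (simp add: powr_add ennreal_mult mult_ac)
qed

lemma hardy_norm_dilate_le: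
  assumes p: "1 \<le> p" and N: "0 \<le> N" and f: "hardy_norm p \<alpha> f \<le> ennreal N"
    and hol: "f holomorphic_on upper_half_plane" and t: "t > 0"
  shows "hardy_norm p \<alpha> (\<lambda>z. f (z / complex_of_real t)) \<le> ennreal (t powr hardy_exponent p \<alpha> * N)"
proof (cases p)
  case (real q)
  with p have q: "q \<ge> 1" by simp
  have "line_integral q \<alpha> (\<lambda>z. f (z / complex_of_real t)) y
    \<le> ennreal ((t powr hardy_exponent p \<alpha> * N) powr q)" if y: "y > 0" for y
  proof -
    have "line_integral q \<alpha> f (y / t) \<le> ennreal (N powr q)"
      using f hardy_norm_le_iff[of q N \<alpha> f] q N y real t by auto
    then have "ennreal (t powr (1 + \<alpha>)) * line_integral q \<alpha> f (y / t)
        \<le> ennreal (t powr (1 + \<alpha>)) * ennreal (N powr q)"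
      by (intro mult_left_mono) auto
    moreover have "(t powr hardy_exponent p \<alpha> * N) powr q = t powr (1 + \<alpha>) * N powr q"
      using real q N t by (simp add: powr_mult powr_powr hardy_exponent_def)
    ultimately show ?thesis
      by (simp add: line_integral_dilate[OF hol y t] ennreal_mult)
  qed
  then show ?thesis using hardy_norm_le_iff[of q "t powr hardy_exponent p \<alpha> * N"] q N real by auto
next
  case top
  then show ?thesis
    using f N t hardy_norm_infinity_le_iff[of N \<alpha> f]
      hardy_norm_infinity_le_iff[of "t powr hardy_exponent p \<alpha> * N" \<alpha>]
    by (auto simp: hardy_exponent_def)
qed

subsection \<open>Boundedness of point evaluations\<close>

text \<open>Length times maximum would be useless here, since on the sides of the rectangles below
  only integrals of \<open>f\<close> are under control.\<close>

lemma norm_contour_integral_linepath_le: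
  assumes "continuous_on (closed_segment a b) f"
  shows "ennreal (cmod (contour_integral (linepath a b) f))
    \<le> ennreal (cmod (b - a)) * (\<integral>\<^sup>+x. indicator {0..1} x * ennreal (cmod (f (linepath a b x))) \<partial>lborel)"
proof -
  have cont: "continuous_on {0..1} (\<lambda>x. f (linepath a b x))"
    by (rule continuous_on_compose2[OF assms continuous_on_linepath])
       (auto simp flip: linepath_image_01)
  then have cont': "continuous_on {0..1} (\<lambda>x. f (linepath a b x) * (b - a))"
    by (intro continuous_intros)
  have si: "set_integrable lborel {0..1} (\<lambda>x. f (linepath a b x) * (b - a))"
    by (rule borel_integrable_atLeastAtMost'[OF cont'])
  have m: "(\<lambda>x. indicator {0..1} x *\<^sub>R cmod (f (linepath a b x))) \<in> borel_measurable borel"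
    by (rule borel_measurable_continuous_on_indicator) (auto intro!: continuous_intros cont)
  have "contour_integral (linepath a b) f = integral {0..1} (\<lambda>x. f (linepath a b x) * (b - a))"
    by (simp add: contour_integral_integral)
  also have "\<dots> = (LINT x:{0..1}|lborel. f (linepath a b x) * (b - a))"
    by (rule set_borel_integral_eq_integral(2)[symmetric, OF si])
  finally have "contour_integral (linepath a b) f
      = (LINT x|lborel. indicator {0..1} x *\<^sub>R (f (linepath a b x) * (b - a)))"
    by (simp only: set_lebesgue_integral_def)
  then have "ennreal (cmod (contour_integral (linepath a b) f))
      \<le> (\<integral>\<^sup>+x. ennreal (norm (indicator {0..1} x *\<^sub>R (f (linepath a b x) * (b - a)))) \<partial>lborel)"
    using integral_norm_bound_ennreal[OF si[unfolded set_integrable_def]] by (simp only:)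
  also have "\<dots> = (\<integral>\<^sup>+x. ennreal (cmod (b - a)) * ennreal (indicator {0..1} x *\<^sub>R cmod (f (linepath a b x))) \<partial>lborel)"
    by (intro nn_integral_cong) (auto simp: norm_mult ennreal_mult mult_ac split: split_indicator)
  also have "\<dots> = ennreal (cmod (b - a)) * (\<integral>\<^sup>+x. ennreal (indicator {0..1} x *\<^sub>R cmod (f (linepath a b x))) \<partial>lborel)"
    by (rule nn_integral_cmult) (use m in simp)
  also have "(\<integral>\<^sup>+x. ennreal (indicator {0..1} x *\<^sub>R cmod (f (linepath a b x))) \<partial>lborel)
      = (\<integral>\<^sup>+x. indicator {0..1} x * ennreal (cmod (f (linepath a b x))) \<partial>lborel)"
    by (intro nn_integral_cong) (auto split: split_indicator)
  finally show ?thesis .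
qed

lemma norm_contour_integral_horizontal_le:
  assumes "xl < xr" and f: "continuous_on (closed_segment (Complex xl y) (Complex xr y)) f"
  shows "ennreal (cmod (contour_integral (linepath (Complex xl y) (Complex xr y)) f))
    \<le> (\<integral>\<^sup>+x. indicator {xl..xr} x * ennreal (cmod (f (Complex x y))) \<partial>lborel)"
proof -
  define L where "L = xr - xl"
  have L: "L > 0" using assms by (simp add: L_def)
  have xr: "xr = xl + L" by (simp add: L_def)
  have lp: "linepath (Complex xl y) (Complex xr y) x = Complex (xl + L * x) y" for x
    by (simp add: linepath_def complex_eq_iff L_def algebra_simps)
  have "continuous_on {xl..xr} (\<lambda>x. f (Complex x y))"
  proof (rule continuous_on_compose2[OF f])
    show "continuous_on {xl..xr} (\<lambda>x. Complex x y)" by (simp add: Complex_eq) (intro continuous_intros)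
    show "(\<lambda>x. Complex x y) ` {xl..xr} \<subseteq> closed_segment (Complex xl y) (Complex xr y)"
      using assms by (auto simp: closed_segment_same_Im closed_segment_eq_real_ivl)
  qed
  then have "(\<lambda>x. indicator {xl..xr} x *\<^sub>R cmod (f (Complex x y))) \<in> borel_measurable borel"
    by (intro borel_measurable_continuous_on_indicator continuous_intros) auto
  then have m: "(\<lambda>x. ennreal (indicator {xl..xr} x *\<^sub>R cmod (f (Complex x y)))) \<in> borel_measurable borel"
    by simp
  also have "(\<lambda>x. ennreal (indicator {xl..xr} x *\<^sub>R cmod (f (Complex x y))))
      = (\<lambda>x. indicator {xl..xr} x * ennreal (cmod (f (Complex x y))))"
    by (auto split: split_indicator)
  finally have m: "(\<lambda>x. indicator {xl..xr} x * ennreal (cmod (f (Complex x y)))) \<in> borel_measurable borel" .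
  have ind: "indicator {xl..xr} (xl + L * x) = (indicator {0..1} x :: ennreal)" for x
    using L mult_le_cancel_left_pos[of L x 1] xr by (auto simp: indicator_def zero_le_mult_iff)
  have "(\<integral>\<^sup>+x. indicator {xl..xr} x * ennreal (cmod (f (Complex x y))) \<partial>lborel)
     = ennreal L * (\<integral>\<^sup>+x. indicator {0..1} x * ennreal (cmod (f (Complex (xl + L * x) y))) \<partial>lborel)"
    by (subst nn_integral_real_affine[where c = L and t = xl, OF m]) (use L ind in auto)
  moreover have "cmod (Complex xr y - Complex xl y) = L"
    using L by (simp add: cmod_def L_def)
  ultimately show ?thesis
    using norm_contour_integral_linepath_le[OF f] by (simp add: lp)
qed

lemma norm_contour_integral_vertical_le:
  assumes "yl < yr" and f: "continuous_on (closed_segment (Complex x yl) (Complex x yr)) f"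
  shows "ennreal (cmod (contour_integral (linepath (Complex x yl) (Complex x yr)) f))
    \<le> (\<integral>\<^sup>+y. indicator {yl..yr} y * ennreal (cmod (f (Complex x y))) \<partial>lborel)"
proof -
  define L where "L = yr - yl"
  have L: "L > 0" using assms by (simp add: L_def)
  have yr: "yr = yl + L" by (simp add: L_def)
  have lp: "linepath (Complex x yl) (Complex x yr) y = Complex x (yl + L * y)" for y
    by (simp add: linepath_def complex_eq_iff L_def algebra_simps)
  have "continuous_on {yl..yr} (\<lambda>y. f (Complex x y))"
  proof (rule continuous_on_compose2[OF f])
    show "continuous_on {yl..yr} (\<lambda>y. Complex x y)" by (simp add: Complex_eq) (intro continuous_intros)
    show "(\<lambda>y. Complex x y) ` {yl..yr} \<subseteq> closed_segment (Complex x yl) (Complex x yr)"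
      using assms by (auto simp: closed_segment_same_Re closed_segment_eq_real_ivl)
  qed
  then have "(\<lambda>y. indicator {yl..yr} y *\<^sub>R cmod (f (Complex x y))) \<in> borel_measurable borel"
    by (intro borel_measurable_continuous_on_indicator continuous_intros) auto
  then have m: "(\<lambda>y. ennreal (indicator {yl..yr} y *\<^sub>R cmod (f (Complex x y)))) \<in> borel_measurable borel"
    by simp
  also have "(\<lambda>y. ennreal (indicator {yl..yr} y *\<^sub>R cmod (f (Complex x y))))
      = (\<lambda>y. indicator {yl..yr} y * ennreal (cmod (f (Complex x y))))"
    by (auto split: split_indicator)
  finally have m: "(\<lambda>y. indicator {yl..yr} y * ennreal (cmod (f (Complex x y)))) \<in> borel_measurable borel" .
  have ind: "indicator {yl..yr} (yl + L * y) = (indicator {0..1} y :: ennreal)" for y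
    using L mult_le_cancel_left_pos[of L y 1] yr by (auto simp: indicator_def zero_le_mult_iff)
  have "(\<integral>\<^sup>+y. indicator {yl..yr} y * ennreal (cmod (f (Complex x y))) \<partial>lborel)
     = ennreal L * (\<integral>\<^sup>+y. indicator {0..1} y * ennreal (cmod (f (Complex x (yl + L * y)))) \<partial>lborel)"
    by (subst nn_integral_real_affine[where c = L and t = yl, OF m]) (use L ind in auto)
  moreover have "cmod (Complex x yr - Complex x yl) = L"
    using L by (simp add: cmod_def L_def)
  ultimately show ?thesis
    using norm_contour_integral_linepath_le[OF f] by (simp add: lp)
qed

text \<open>The winding number of the boundary about \<open>w\<close> is 1, so the contour integral
  of \<open>\<Phi>\<close> is \<open>2 * pi * \<i> * f w\<close>. Each side is kept as a separate
  integral because horizontal and vertical sides are estimated by different means.\<close>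

lemma Cauchy_rectangle_norm_le:
  assumes S: "open S" "convex S" "f holomorphic_on S" "cbox (Complex xl yl) (Complex xr yr) \<subseteq> S"
    and w: "w \<in> box (Complex xl yl) (Complex xr yr)"
  defines "\<Phi> \<equiv> \<lambda>z. f z / (z - w)"
  shows "ennreal (2 * pi * cmod (f w)) \<le>
     (\<integral>\<^sup>+x. indicator {xl..xr} x * ennreal (cmod (\<Phi> (Complex x yl))) \<partial>lborel)
   + (\<integral>\<^sup>+y. indicator {yl..yr} y * ennreal (cmod (\<Phi> (Complex xr y))) \<partial>lborel)
   + (\<integral>\<^sup>+x. indicator {xl..xr} x * ennreal (cmod (\<Phi> (Complex x yr))) \<partial>lborel)
   + (\<integral>\<^sup>+y. indicator {yl..yr} y * ennreal (cmod (\<Phi> (Complex xl y))) \<partial>lborel)"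
proof -
  define a1 a2 a3 a4 where "a1 = Complex xl yl" and "a2 = Complex xr yl"
    and "a3 = Complex xr yr" and "a4 = Complex xl yr"
  note a_defs = a1_def a2_def a3_def a4_def
  have lt: "xl < xr" "yl < yr" using w by (auto simp: in_box_complex_iff)
  define \<gamma> where "\<gamma> = rectpath a1 a3"
  have pi\<gamma>: "path_image \<gamma> \<subseteq> S - {w}"
    using path_image_rectpath_subset_cbox[of a1 a3] path_image_rectpath_inter_box[of a1 a3] lt S(4) w
    by (auto simp: a_defs \<gamma>_def)
  have "w \<in> cbox a1 a3" using w by (auto simp: in_box_complex_iff in_cbox_complex_iff a_defs)
  then have wS: "w \<in> interior S" using S by (auto simp: a_defs interior_open)
  have "(\<Phi> has_contour_integral (2 * pi * \<i> * winding_number \<gamma> w * f w)) \<gamma>"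
    unfolding \<Phi>_def
    by (rule Cauchy_integral_formula_convex_simple[OF S(2,3) wS _ pi\<gamma>]) (auto simp: \<gamma>_def)
  moreover have "winding_number \<gamma> w = 1"
    unfolding \<gamma>_def by (rule winding_number_rectpath) (use w in \<open>simp add: a_defs\<close>)
  ultimately have main: "contour_integral \<gamma> \<Phi> = 2 * pi * \<i> * f w"
    by (simp add: contour_integral_unique)
  have cont: "continuous_on (S - {w}) \<Phi>"
    unfolding \<Phi>_def
    by (intro continuous_intros continuous_on_subset[OF holomorphic_on_imp_continuous_on[OF S(3)]]) auto
  have \<gamma>: "\<gamma> = linepath a1 a2 +++ linepath a2 a3 +++ linepath a3 a4 +++ linepath a4 a1"
    by (simp add: \<gamma>_def rectpath_def Let_def a_defs)
  have seg: "closed_segment a1 a2 \<subseteq> S - {w}" "closed_segment a2 a3 \<subseteq> S - {w}"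
    "closed_segment a3 a4 \<subseteq> S - {w}" "closed_segment a4 a1 \<subseteq> S - {w}"
    using pi\<gamma> by (auto simp: \<gamma> path_image_join)
  note c = continuous_on_subset[OF cont seg(1)] continuous_on_subset[OF cont seg(2)]
    continuous_on_subset[OF cont seg(3)] continuous_on_subset[OF cont seg(4)]
  note ci = c[THEN contour_integrable_continuous_linepath]
  have "contour_integral \<gamma> \<Phi> = contour_integral (linepath a1 a2) \<Phi> + contour_integral (linepath a2 a3) \<Phi>
     + contour_integral (linepath a3 a4) \<Phi> + contour_integral (linepath a4 a1) \<Phi>"
    using ci by (simp add: \<gamma> contour_integrable_joinI)
  \<comment> \<open>The boundary runs backwards along the top and the left side; both are reversed,
    since the bounds for segments are stated for increasing coordinates.\<close>
  also have "contour_integral (linepath a3 a4) \<Phi> = - contour_integral (linepath a4 a3) \<Phi>"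
    using c(3) by (rule contour_integral_reverse_linepath)
  also have "contour_integral (linepath a4 a1) \<Phi> = - contour_integral (linepath a1 a4) \<Phi>"
    using c(4) by (rule contour_integral_reverse_linepath)
  finally have eq: "contour_integral \<gamma> \<Phi> = contour_integral (linepath a1 a2) \<Phi> + contour_integral (linepath a2 a3) \<Phi>
     + - contour_integral (linepath a4 a3) \<Phi> + - contour_integral (linepath a1 a4) \<Phi>" .
  have tri: "cmod (a + b + - c + - d) \<le> cmod a + cmod b + cmod c + cmod d" for a b c d :: complex
    using norm_triangle_ineq[of "a + b + - c" "- d"] norm_triangle_ineq[of "a + b" "- c"]
      norm_triangle_ineq[of a b] by simp
  have "cmod (2 * pi * \<i> * f w) \<le> cmod (contour_integral (linepath a1 a2) \<Phi>)
     + cmod (contour_integral (linepath a2 a3) \<Phi>) + cmod (contour_integral (linepath a4 a3) \<Phi>)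
     + cmod (contour_integral (linepath a1 a4) \<Phi>)"
    unfolding main[symmetric] eq by (rule tri)
  then have "ennreal (2 * pi * cmod (f w)) \<le> ennreal (cmod (contour_integral (linepath a1 a2) \<Phi>)
     + cmod (contour_integral (linepath a2 a3) \<Phi>) + cmod (contour_integral (linepath a4 a3) \<Phi>)
     + cmod (contour_integral (linepath a1 a4) \<Phi>))"
    by (intro ennreal_leI) (simp add: norm_mult)
  also have "\<dots> = ennreal (cmod (contour_integral (linepath a1 a2) \<Phi>))
     + ennreal (cmod (contour_integral (linepath a2 a3) \<Phi>)) + ennreal (cmod (contour_integral (linepath a4 a3) \<Phi>))
     + ennreal (cmod (contour_integral (linepath a1 a4) \<Phi>))"
    by (simp add: ennreal_plus)
  also have "\<dots> \<le>
     (\<integral>\<^sup>+x. indicator {xl..xr} x * ennreal (cmod (\<Phi> (Complex x yl))) \<partial>lborel)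
   + (\<integral>\<^sup>+y. indicator {yl..yr} y * ennreal (cmod (\<Phi> (Complex xr y))) \<partial>lborel)
   + (\<integral>\<^sup>+x. indicator {xl..xr} x * ennreal (cmod (\<Phi> (Complex x yr))) \<partial>lborel)
   + (\<integral>\<^sup>+y. indicator {yl..yr} y * ennreal (cmod (\<Phi> (Complex xl y))) \<partial>lborel)"
    using c(1,2) c(3,4)[unfolded closed_segment_commute[of a3] closed_segment_commute[of a4 a1]] lt
    unfolding a_defs
    by (intro add_mono norm_contour_integral_horizontal_le norm_contour_integral_vertical_le)
      (simp_all add: closed_segment_commute)
  finally show ?thesis .
qed

section \<open>From integrals over horizontal lines to pointwise bounds\<close>

text \<open>By Fubini's theorem the weighted area integral over the strip of width 1 is at most
  \<open>d - c\<close>, as each height contributes at most 1. If every vertical line exceeded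
  \<open>d - c + 1\<close>, the area integral would be at least that number; the added 1 makes the
  contradiction strict.\<close>

lemma exists_vertical_line_integral_le:
  assumes f: "f holomorphic_on upper_half_plane" and c: "0 < c" "c \<le> d"
    and I: "\<And>y. y > 0 \<Longrightarrow> line_integral q \<alpha> f y \<le> 1"
  shows "\<exists>x\<in>{s..s+1}.
    (\<integral>\<^sup>+y. indicator {c..d} y * ennreal (cmod (f (Complex x y)) powr q * \<bar>x\<bar> powr \<alpha>) \<partial>lborel)
      \<le> ennreal (d - c + 1)"
proof (rule ccontr)
  assume "\<not> ?thesis"
  then have gt: "ennreal (d - c + 1)
    \<le> (\<integral>\<^sup>+y. indicator {c..d} y * ennreal (cmod (f (Complex x y)) powr q * \<bar>x\<bar> powr \<alpha>) \<partial>lborel)"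
    if "x \<in> {s..s+1}" for x using that by (auto simp: not_le intro: less_imp_le)
  define F where "F = (\<lambda>z. if z \<in> upper_half_plane then f z else 0)"
  have [measurable]: "F \<in> borel_measurable borel"
    unfolding F_def by (rule borel_measurable_holomorphic_extension[OF f])
  have F: "F (Complex x y) = f (Complex x y)" if "y > 0" for x y using that by (simp add: F_def)
  define h where "h = (\<lambda>x y. indicator {c..d} y * ennreal (cmod (F (Complex x y)) powr q * \<bar>x\<bar> powr \<alpha>))"
  have [measurable]: "case_prod h \<in> borel_measurable (lborel \<Otimes>\<^sub>M lborel)"
    unfolding h_def by measurable
  have "ennreal (d - c + 1) = (\<integral>\<^sup>+x. ennreal (d - c + 1) * indicator {s..s+1} x \<partial>lborel)"
    by (subst nn_integral_cmult_indicator) auto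
  also have "\<dots> \<le> (\<integral>\<^sup>+x. (\<integral>\<^sup>+y. h x y \<partial>lborel) \<partial>lborel)"
  proof (rule nn_integral_mono)
    fix x
    have "(\<integral>\<^sup>+y. indicator {c..d} y * ennreal (cmod (f (Complex x y)) powr q * \<bar>x\<bar> powr \<alpha>) \<partial>lborel)
      = (\<integral>\<^sup>+y. h x y \<partial>lborel)"
      unfolding h_def by (intro nn_integral_cong) (use c in \<open>auto simp: F split: split_indicator\<close>)
    then show "ennreal (d - c + 1) * indicator {s..s+1} x \<le> (\<integral>\<^sup>+y. h x y \<partial>lborel)"
      using gt[of x] by (auto split: split_indicator)
  qed
  also have "\<dots> = (\<integral>\<^sup>+y. (\<integral>\<^sup>+x. h x y \<partial>lborel) \<partial>lborel)"
    by (rule lborel_pair.Fubini'[symmetric]) measurable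
  also have "\<dots> \<le> (\<integral>\<^sup>+y. indicator {c..d} y \<partial>lborel)"
  proof (rule nn_integral_mono)
    fix y
    show "(\<integral>\<^sup>+x. h x y \<partial>lborel) \<le> indicator {c..d} y"
      using I[of y] c by (cases "y \<in> {c..d}") (auto simp: h_def F line_integral_def)
  qed
  also have "\<dots> = ennreal (d - c)" using c by simp
  finally show False using c by (simp add: ennreal_le_iff)
qed

text \<open>Used with \<open>h\<close> the weighted q-th power of \<open>f\<close> on a side of the
  rectangle: its integral is known to be at most \<open>S\<close>, and the summand 1 contributes the
  length of the side.\<close>

lemma nn_integral_interval_le:
  fixes u h :: "real \<Rightarrow> real"
  assumes "a \<le> b" "0 \<le> D" "0 \<le> S" and h: "\<And>x. 0 \<le> h x"
    and m: "(\<lambda>x. indicator {a..b} x * ennreal (h x)) \<in> borel_measurable borel"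
    and S: "(\<integral>\<^sup>+x. indicator {a..b} x * ennreal (h x) \<partial>lborel) \<le> ennreal S"
    and u: "\<And>x. x \<in> {a..b} \<Longrightarrow> u x \<le> D * (1 + h x)"
  shows "(\<integral>\<^sup>+x. indicator {a..b} x * ennreal (u x) \<partial>lborel) \<le> ennreal (D * (b - a + S))"
proof -
  have "(\<integral>\<^sup>+x. indicator {a..b} x * ennreal (u x) \<partial>lborel)
      \<le> (\<integral>\<^sup>+x. ennreal D * (indicator {a..b} x + indicator {a..b} x * ennreal (h x)) \<partial>lborel)"
  proof (rule nn_integral_mono)
    fix x
    have "ennreal (u x) \<le> ennreal D * (1 + ennreal (h x))" if "x \<in> {a..b}"
      using ennreal_leI[OF u[OF that]] assms(2) h[of x] by (simp add: ennreal_mult)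
    then show "indicator {a..b} x * ennreal (u x)
      \<le> ennreal D * (indicator {a..b} x + indicator {a..b} x * ennreal (h x))"
      by (auto split: split_indicator)
  qed
  also have "\<dots> = ennreal D * (ennreal (b - a) + (\<integral>\<^sup>+x. indicator {a..b} x * ennreal (h x) \<partial>lborel))"
    using m assms(1) by (simp add: nn_integral_cmult nn_integral_add)
  also have "\<dots> \<le> ennreal D * (ennreal (b - a) + ennreal S)"
    by (intro mult_left_mono add_left_mono S) auto
  also have "\<dots> = ennreal (D * (b - a + S))"
    using assms by (simp add: ennreal_mult ennreal_plus)
  finally show ?thesis .
qed

text \<open>A nonnegative number is at most 1 or at most its q-th power. On a segment of finite
  length this does the work of Hoelder's inequality: Cauchy's formula involves first powers, the
  norm q-th powers.\<close>

lemma mult_powr_le_one_plus: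
  fixes v x q \<alpha> :: real
  assumes "1 \<le> q" "0 \<le> v"
  shows "v * \<bar>x\<bar> powr (\<alpha> / q) \<le> 1 + v powr q * \<bar>x\<bar> powr \<alpha>"
proof -
  define u where "u = v * \<bar>x\<bar> powr (\<alpha> / q)"
  have u: "u \<ge> 0" using assms by (simp add: u_def)
  have "u \<le> 1 + u powr q"
  proof (cases "u \<le> 1")
    case False
    then show ?thesis using powr_mono[of 1 q u] assms by simp
  qed (use powr_ge_zero[of u q] in linarith)
  also have "u powr q = v powr q * \<bar>x\<bar> powr \<alpha>"
    using assms by (simp add: u_def powr_mult powr_powr)
  finally show ?thesis by (simp add: u_def)
qed

text \<open>The weight may degenerate on the imaginary axis, so Cauchy's formula is applied to \<open>f\<close>
  times a polynomial vanishing at the two points where the boundary of a rectangle meets that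
  axis; Fubini's theorem supplies vertical sides on which \<open>f\<close> is small on average.\<close>

lemma line_integral_locally_bounded:
  assumes q: "1 \<le> q" and z0: "z0 \<in> upper_half_plane"
  shows "\<exists>\<delta>>0. \<exists>C\<ge>0. ball z0 \<delta> \<subseteq> upper_half_plane \<and>
    (\<forall>f. f holomorphic_on upper_half_plane \<longrightarrow> (\<forall>y>0. line_integral q \<alpha> f y \<le> 1) \<longrightarrow>
      (\<forall>w\<in>ball z0 \<delta>. cmod (f w) \<le> C))"
proof -
  \<comment> \<open>The rectangles have heights from \<open>R\<close> to \<open>3 * R\<close>,
    centred at the height \<open>y0\<close> of \<open>z0\<close>, and vertical sides with
    \<open>A \<le> \<bar>x\<bar> \<le> X\<close>. The exponent \<open>e\<close> is what the q-th
    root leaves of the weight, and \<open>\<delta>\<close> is small enough that the ball about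
    \<open>z0\<close> has distance at least \<open>\<delta>\<close> from every side.\<close>
  define y0 R A X e m \<delta> where "y0 = Im z0" and "R = y0 / 2" and "A = \<bar>Re z0\<bar> + 1"
    and "X = A + 1" and "e = \<alpha> / q" and "m = Suc (nat \<lceil>e\<rceil>)" and "\<delta> = min R 1 / 2"
  have y0: "y0 > 0" "y0 = 2 * R" using z0 by (auto simp: y0_def upper_half_plane_def R_def)
  then have R: "R > 0" by simp
  have AX: "A \<ge> 1" "X \<ge> 2" "X > 0" by (auto simp: A_def X_def)
  have me: "e \<le> real m" "m \<noteq> 0" by (auto simp: m_def) linarith
  have \<delta>: "\<delta> > 0" "\<delta> \<le> R / 2" "\<delta> \<le> 1 / 2" using R by (auto simp: \<delta>_def)
  \<comment> \<open>The base vanishes exactly at \<open>\<i> * (y0 - R)\<close> and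
    \<open>\<i> * (y0 + R)\<close>, where the horizontal sides cross the imaginary axis. Since
    \<open>m \<ge> e\<close>, the power is \<open>O(\<bar>x\<bar> powr e)\<close> on these
    sides.\<close>
  define P where "P = (\<lambda>z. ((z - \<i> * y0)\<^sup>2 + (complex_of_real R)\<^sup>2) ^ m)"
  \<comment> \<open>The first summand serves the horizontal sides, on which \<open>x\<close> may
    vanish, the second the vertical ones.\<close>
  define B where "B = X powr (m - e) * (X + 2 * R) ^ m + X powr \<bar>e\<bar> * ((X + R)\<^sup>2 + R\<^sup>2) ^ m"
  have B: "B \<ge> 0" using AX R by (simp add: B_def)
  have PC: "cmod (P (Complex x y)) = cmod (Complex (x\<^sup>2 - (y - y0)\<^sup>2 + R\<^sup>2) (2 * x * (y - y0))) ^ m" for x y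
  proof -
    have "(Complex x y - \<i> * y0)\<^sup>2 + (complex_of_real R)\<^sup>2 = Complex (x\<^sup>2 - (y - y0)\<^sup>2 + R\<^sup>2) (2 * x * (y - y0))"
      by (simp add: complex_eq_iff power2_eq_square)
    then show ?thesis by (simp add: P_def norm_power)
  qed
  have Phor: "cmod (P (Complex x y)) \<le> B * \<bar>x\<bar> powr e" if "\<bar>x\<bar> \<le> X" "(y - y0)\<^sup>2 = R\<^sup>2" for x y
  proof -
    have yR: "\<bar>y - y0\<bar> = R" using that R by (metis abs_of_pos power2_abs power2_eq_iff_nonneg abs_ge_zero less_imp_le)
    have "cmod (P (Complex x y)) = cmod (Complex (x\<^sup>2) (2 * x * (y - y0))) ^ m"
      using PC[of x y] that by simp
    also have "\<dots> \<le> (\<bar>x\<bar> * (X + 2 * R)) ^ m"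
    proof (rule power_mono)
      have "cmod (Complex (x\<^sup>2) (2 * x * (y - y0))) \<le> \<bar>x\<^sup>2\<bar> + \<bar>2 * x * (y - y0)\<bar>"
        using cmod_le[of "Complex (x\<^sup>2) (2 * x * (y - y0))"] by simp
      also have "\<dots> = \<bar>x\<bar> * (\<bar>x\<bar> + 2 * R)"
        by (simp only: abs_mult yR) (simp add: power2_eq_square algebra_simps)
      also have "\<dots> \<le> \<bar>x\<bar> * (X + 2 * R)" using that by (intro mult_left_mono) auto
      finally show "cmod (Complex (x\<^sup>2) (2 * x * (y - y0))) \<le> \<bar>x\<bar> * (X + 2 * R)" .
    qed simp
    also have "\<dots> = \<bar>x\<bar> ^ m * (X + 2 * R) ^ m" by (simp add: power_mult_distrib)
    \<comment> \<open>At \<open>x = 0\<close> the right-hand side is 0 because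
      \<open>0 powr e = 0\<close>, also for \<open>e \<le> 0\<close>; so \<open>P\<close> has to
      vanish there in every case, which is why \<open>m\<close> is a successor.\<close>
    also have "\<bar>x\<bar> ^ m \<le> X powr (m - e) * \<bar>x\<bar> powr e"
    proof (cases "x = 0")
      case False
      then have "\<bar>x\<bar> ^ m = \<bar>x\<bar> powr (m - e) * \<bar>x\<bar> powr e"
        by (simp add: powr_realpow flip: powr_add)
      also have "\<dots> \<le> X powr (m - e) * \<bar>x\<bar> powr e"
        using me that by (intro mult_right_mono powr_mono2) auto
      finally show ?thesis .
    qed (use me in \<open>simp add: power_0_left\<close>)
    then have "\<bar>x\<bar> ^ m * (X + 2 * R) ^ m \<le> X powr (m - e) * \<bar>x\<bar> powr e * (X + 2 * R) ^ m"
      using AX R by (intro mult_right_mono) auto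
    also have "\<dots> = X powr (m - e) * (X + 2 * R) ^ m * \<bar>x\<bar> powr e" by simp
    also have "\<dots> \<le> B * \<bar>x\<bar> powr e"
      unfolding B_def by (intro mult_right_mono) auto
    finally show ?thesis .
  qed
  have Pver: "cmod (P (Complex x y)) \<le> B * \<bar>x\<bar> powr e" if "A \<le> \<bar>x\<bar>" "\<bar>x\<bar> \<le> X" "\<bar>y - y0\<bar> \<le> R" for x y
  proof -
    have "cmod (P (Complex x y)) \<le> ((X + R)\<^sup>2 + R\<^sup>2) ^ m"
    proof -
      have "cmod (Complex x y - \<i> * y0) \<le> X + R"
        using cmod_le[of "Complex x y - \<i> * y0"] that by simp
      then have "cmod ((Complex x y - \<i> * y0)\<^sup>2) \<le> (X + R)\<^sup>2"
        by (simp add: norm_power power_mono)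
      moreover have "cmod ((complex_of_real R)\<^sup>2) = R\<^sup>2" by (simp add: norm_power)
      ultimately have "cmod ((Complex x y - \<i> * y0)\<^sup>2 + (complex_of_real R)\<^sup>2) \<le> (X + R)\<^sup>2 + R\<^sup>2"
        by (metis add_mono norm_triangle_le order_refl)
      then show ?thesis by (simp add: P_def norm_power power_mono)
    qed
    \<comment> \<open>As \<open>1 \<le> \<bar>x\<bar> \<le> X\<close>, the power
      \<open>\<bar>x\<bar> powr e\<close> is at least \<open>X powr (- \<bar>e\<bar>)\<close>,
      whatever the sign of \<open>e\<close>.\<close>
    moreover have "1 \<le> X powr \<bar>e\<bar> * \<bar>x\<bar> powr e"
    proof (cases "e \<ge> 0")
      case True
      then show ?thesis
        using AX that ge_one_powr_ge_zero[of X e] ge_one_powr_ge_zero[of "\<bar>x\<bar>" e]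
          mult_mono[of 1 "X powr e" 1 "\<bar>x\<bar> powr e"] by simp
    next
      case False
      then have "X powr e \<le> \<bar>x\<bar> powr e" using AX that by (intro powr_mono2') auto
      then have "X powr (- e) * X powr e \<le> X powr (- e) * \<bar>x\<bar> powr e" by (intro mult_left_mono) auto
      then show ?thesis using False AX by (simp flip: powr_add)
    qed
    ultimately have "cmod (P (Complex x y)) * 1 \<le> ((X + R)\<^sup>2 + R\<^sup>2) ^ m * (X powr \<bar>e\<bar> * \<bar>x\<bar> powr e)"
      by (intro mult_mono) auto
    also have "\<dots> = X powr \<bar>e\<bar> * ((X + R)\<^sup>2 + R\<^sup>2) ^ m * \<bar>x\<bar> powr e" by simp
    also have "\<dots> \<le> B * \<bar>x\<bar> powr e"
      unfolding B_def using AX R by (intro mult_right_mono) auto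
    finally show ?thesis by simp
  qed
  \<comment> \<open>On the ball the height differs from \<open>y0\<close> by less than
    \<open>R / 2\<close>, so the real part of the base of \<open>P\<close> is at least
    \<open>R\<^sup>2 - R\<^sup>2 / 4\<close>. Hence division by \<open>P\<close> is harmless near
    \<open>z0\<close>.\<close>
  define p0 where "p0 = (3 * R\<^sup>2 / 4) ^ m"
  have p0: "p0 > 0" using R by (simp add: p0_def)
  define D where "D = B / \<delta>"
  have D: "D \<ge> 0" using B \<delta> by (simp add: D_def)
  \<comment> \<open>The sum over the four sides: the horizontal ones have length at most
    \<open>2 * X\<close> and integral of \<open>h\<close> at most 1, the vertical ones length
    \<open>2 * R\<close> and integral at most \<open>2 * R + 1\<close>.\<close>
  define T where "T = 2 * (D * (2 * X + 1)) + 2 * (D * (2 * R + (2 * R + 1)))"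
  have T: "T \<ge> 0" using D AX R by (simp add: T_def)
  have near: "\<bar>Re w\<bar> < A - 1 / 2" "\<bar>Im w - y0\<bar> < R / 2" "\<bar>Re w - Re z0\<bar> < \<delta>" "\<bar>Im w - y0\<bar> < \<delta>"
    if "w \<in> ball z0 \<delta>" for w
    using that abs_Re_le_cmod[of "z0 - w"] abs_Im_le_cmod[of "z0 - w"] \<delta>
    unfolding A_def y0_def mem_ball dist_norm minus_complex.simps by linarith+
  have Pw: "p0 \<le> cmod (P w)" if w: "w \<in> ball z0 \<delta>" for w
  proof -
    have "(Im w - y0)\<^sup>2 \<le> (R / 2)\<^sup>2" using near[OF w] by (intro abs_le_square_iff[THEN iffD1]) (use R in auto)
    then have "(Im w - y0)\<^sup>2 \<le> R\<^sup>2 / 4" by (simp add: power_divide)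
    then have "3 * R\<^sup>2 / 4 \<le> (Re w)\<^sup>2 - (Im w - y0)\<^sup>2 + R\<^sup>2"
      using zero_le_power2[of "Re w"] by linarith
    also have "\<dots> \<le> cmod (Complex ((Re w)\<^sup>2 - (Im w - y0)\<^sup>2 + R\<^sup>2) (2 * Re w * (Im w - y0)))"
      using complex_Re_le_cmod[of "Complex ((Re w)\<^sup>2 - (Im w - y0)\<^sup>2 + R\<^sup>2) (2 * Re w * (Im w - y0))"] by simp
    finally show ?thesis
      using PC[of "Re w" "Im w"] R by (auto simp: p0_def intro!: power_mono)
  qed
  have ballH: "ball z0 \<delta> \<subseteq> upper_half_plane"
  proof
    fix w assume "w \<in> ball z0 \<delta>"
    from near(2)[OF this] R y0 show "w \<in> upper_half_plane"
      unfolding upper_half_plane_def mem_Collect_eq by linarith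
  qed
  have "cmod (f w) \<le> T / (2 * pi * p0)"
    if f: "f holomorphic_on upper_half_plane" and I: "\<forall>y>0. line_integral q \<alpha> f y \<le> 1"
      and w: "w \<in> ball z0 \<delta>" for f w
  proof -
    define h where "h = (\<lambda>z. cmod (f z) powr q * \<bar>Re z\<bar> powr \<alpha>)"
    have h: "h z \<ge> 0" for z by (simp add: h_def)
    have side: "cmod (f z * P z / (z - w)) \<le> D * (1 + h z)"
      if "cmod (P z) \<le> B * \<bar>Re z\<bar> powr e" "\<delta> \<le> cmod (z - w)" for z
    proof -
      have "cmod (f z * P z / (z - w)) = cmod (f z) * cmod (P z) / cmod (z - w)"
        by (simp add: norm_mult norm_divide)
      also have "\<dots> \<le> cmod (f z) * (B * \<bar>Re z\<bar> powr e) / \<delta>"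
        using that \<delta> B by (intro frac_le mult_left_mono) auto
      also have "\<dots> = D * (cmod (f z) * \<bar>Re z\<bar> powr e)" by (simp add: D_def)
      also have "\<dots> \<le> D * (1 + h z)"
        unfolding h_def e_def by (intro mult_left_mono D mult_powr_le_one_plus q) auto
      finally show ?thesis .
    qed
    have Iv: "\<exists>x\<in>{s..s+1}. (\<integral>\<^sup>+y. indicator {R..3*R} y * ennreal (h (Complex x y)) \<partial>lborel)
        \<le> ennreal (2 * R + 1)" for s
      using exists_vertical_line_integral_le[OF f, of R "3 * R" q \<alpha> s] R I by (simp add: h_def)
    \<comment> \<open>The vertical sides depend on \<open>f\<close>, but
      \<open>- X \<le> xl \<le> - A\<close> and \<open>A \<le> xr \<le> X\<close> hold in any case,
      so the final constant does not.\<close>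
    obtain xr where xr: "xr \<in> {A..A+1}"
      "(\<integral>\<^sup>+y. indicator {R..3*R} y * ennreal (h (Complex xr y)) \<partial>lborel) \<le> ennreal (2 * R + 1)"
      using Iv[of A] by auto
    obtain xl where xl: "xl \<in> {-X..-X+1}"
      "(\<integral>\<^sup>+y. indicator {R..3*R} y * ennreal (h (Complex xl y)) \<partial>lborel) \<le> ennreal (2 * R + 1)"
      using Iv[of "-X"] by auto
    have mh: "(\<lambda>x. indicator {a..b} x * ennreal (h (Complex x y))) \<in> borel_measurable borel" if "y > 0" for a b y
      using borel_measurable_on_line[OF f that] unfolding h_def by measurable
    have mv: "(\<lambda>y. indicator {R..3*R} y * ennreal (h (Complex x y))) \<in> borel_measurable borel" for x
    proof -
      define F where "F = (\<lambda>z. if z \<in> upper_half_plane then f z else 0)"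
      have [measurable]: "F \<in> borel_measurable borel"
        unfolding F_def by (rule borel_measurable_holomorphic_extension[OF f])
      have "(\<lambda>y. indicator {R..3*R} y * ennreal (cmod (F (Complex x y)) powr q * \<bar>x\<bar> powr \<alpha>)) \<in> borel_measurable borel"
        by measurable
      moreover have "indicator {R..3*R} y * ennreal (cmod (F (Complex x y)) powr q * \<bar>x\<bar> powr \<alpha>)
        = indicator {R..3*R} y * ennreal (h (Complex x y))" for y
        using R by (auto simp: F_def h_def split: split_indicator)
      ultimately show ?thesis by simp
    qed
    have horx: "(\<integral>\<^sup>+x. indicator {xl..xr} x * ennreal (cmod (f (Complex x y) * P (Complex x y) / (Complex x y - w))) \<partial>lborel)
       \<le> ennreal (D * (xr - xl + 1))" if y: "y = R \<or> y = 3 * R" for y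
    proof (rule nn_integral_interval_le)
      show "(\<integral>\<^sup>+x. indicator {xl..xr} x * ennreal (h (Complex x y)) \<partial>lborel) \<le> ennreal 1"
      proof -
        have "(\<integral>\<^sup>+x. indicator {xl..xr} x * ennreal (h (Complex x y)) \<partial>lborel) \<le> line_integral q \<alpha> f y"
          unfolding line_integral_def h_def
          by (intro nn_integral_mono) (auto split: split_indicator)
        also have "\<dots> \<le> 1" using I y R by auto
        finally show ?thesis by simp
      qed
      fix x assume x: "x \<in> {xl..xr}"
      have sq: "(y - y0)\<^sup>2 = R\<^sup>2" using y y0 by auto
      show "cmod (f (Complex x y) * P (Complex x y) / (Complex x y - w)) \<le> D * (1 + h (Complex x y))"
      proof (rule side)
        show "cmod (P (Complex x y)) \<le> B * \<bar>Re (Complex x y)\<bar> powr e"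
          using Phor[of x y] sq x xl xr by (auto simp: X_def)
        show "\<delta> \<le> cmod (Complex x y - w)"
          using abs_Im_le_cmod[of "Complex x y - w"] near[OF w] y y0 \<delta> by (auto simp: abs_le_iff abs_less_iff)
      qed
    qed (use D h mh y R xl xr AX in \<open>auto simp: X_def\<close>)
    have "D * (xr - xl + 1) \<le> D * (2 * X + 1)"
      using D xl xr by (intro mult_left_mono) (auto simp: X_def)
    note hle = ennreal_leI[OF this]
    have hor: "(\<integral>\<^sup>+x. indicator {xl..xr} x * ennreal (cmod (f (Complex x y) * P (Complex x y) / (Complex x y - w))) \<partial>lborel)
       \<le> ennreal (D * (2 * X + 1))" if "y = R \<or> y = 3 * R" for y
      by (rule order_trans[OF horx[OF that] hle])
    have ver: "(\<integral>\<^sup>+y. indicator {R..3*R} y * ennreal (cmod (f (Complex x y) * P (Complex x y) / (Complex x y - w))) \<partial>lborel)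
       \<le> ennreal (D * (2 * R + (2 * R + 1)))" if x: "x = xl \<or> x = xr" for x
    proof -
      have "(\<integral>\<^sup>+y. indicator {R..3*R} y * ennreal (cmod (f (Complex x y) * P (Complex x y) / (Complex x y - w))) \<partial>lborel)
       \<le> ennreal (D * (3 * R - R + (2 * R + 1)))"
      proof (rule nn_integral_interval_le)
        show "(\<integral>\<^sup>+y. indicator {R..3*R} y * ennreal (h (Complex x y)) \<partial>lborel) \<le> ennreal (2 * R + 1)"
          using x xl xr by auto
        fix y assume y: "y \<in> {R..3*R}"
        show "cmod (f (Complex x y) * P (Complex x y) / (Complex x y - w)) \<le> D * (1 + h (Complex x y))"
        proof (rule side)
          show "cmod (P (Complex x y)) \<le> B * \<bar>Re (Complex x y)\<bar> powr e"
            using Pver[of x y] x xl xr y y0 AX by (auto simp: X_def abs_le_iff)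
          show "\<delta> \<le> cmod (Complex x y - w)"
            using abs_Re_le_cmod[of "Complex x y - w"] near(1)[OF w] x xl xr AX \<delta>
            by (auto simp: abs_le_iff abs_less_iff X_def)
        qed
      qed (use D h mv R in auto)
      then show ?thesis by (simp add: algebra_simps)
    qed
    have holP: "(\<lambda>z. f z * P z) holomorphic_on upper_half_plane"
      unfolding P_def by (intro holomorphic_intros f)
    have "ennreal (2 * pi * cmod (f w * P w)) \<le>
       ennreal (D * (2 * X + 1)) + ennreal (D * (2 * R + (2 * R + 1))) + ennreal (D * (2 * X + 1))
         + ennreal (D * (2 * R + (2 * R + 1)))"
    proof (rule order_trans[OF Cauchy_rectangle_norm_le[OF open_upper_half_plane convex_upper_half_plane holP,
          of xl R xr "3 * R" w]])
      show "cbox (Complex xl R) (Complex xr (3 * R)) \<subseteq> upper_half_plane"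
        using R by (auto simp: in_cbox_complex_iff upper_half_plane_def)
      show "w \<in> box (Complex xl R) (Complex xr (3 * R))"
      proof -
        have "xl \<le> - A" "A \<le> xr" using xl(1) xr(1) by (auto simp: X_def)
        then have "R < Im w" "Im w < 3 * R" "xl < Re w" "Re w < xr"
          using near(1,2)[OF w] y0 R by linarith+
        then show ?thesis by (simp add: in_box_complex_iff)
      qed
    qed (intro add_mono hor ver; simp)
    also have "\<dots> = ennreal T"
      using D AX R by (simp add: T_def flip: ennreal_plus)
    finally have "2 * pi * (cmod (f w) * cmod (P w)) \<le> T"
      using T by (simp add: norm_mult)
    moreover have "2 * pi * (cmod (f w) * p0) \<le> 2 * pi * (cmod (f w) * cmod (P w))"
      using Pw[OF w] by (intro mult_left_mono) auto
    ultimately have "2 * pi * (cmod (f w) * p0) \<le> T" by linarith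
    then have "cmod (f w) * (2 * pi * p0) \<le> T" by (simp only: mult_ac)
    then show ?thesis using p0 by (simp add: pos_le_divide_eq)
  qed
  moreover have "T / (2 * pi * p0) \<ge> 0" using T p0 by simp
  ultimately show ?thesis using \<delta> ballH by meson
qed

text \<open>The constant is uniform over a ball and over all \<open>f\<close>: the ball is needed
  for holomorphy of the transform, the independence of \<open>f\<close> for the iterates. The case
  of norm at most 1 is scaled up by homogeneity.\<close>

lemma hardy_locally_bounded:
  assumes p: "1 \<le> p" and z0: "z0 \<in> upper_half_plane"
  obtains \<delta> C where "\<delta> > 0" "C \<ge> 0" "ball z0 \<delta> \<subseteq> upper_half_plane"
    "\<And>f N w. \<lbrakk>f holomorphic_on upper_half_plane; 0 \<le> N; hardy_norm p \<alpha> f \<le> ennreal N; w \<in> ball z0 \<delta>\<rbrakk>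
      \<Longrightarrow> cmod (f w) \<le> C * N"
proof -
  have "\<exists>\<delta>>0. \<exists>C\<ge>0. ball z0 \<delta> \<subseteq> upper_half_plane \<and>
    (\<forall>f. f holomorphic_on upper_half_plane \<longrightarrow> hardy_norm p \<alpha> f \<le> 1 \<longrightarrow>
      (\<forall>w\<in>ball z0 \<delta>. cmod (f w) \<le> C))"
  proof (cases p)
    case (real q)
    with p have q: "q \<ge> 1" by simp
    show ?thesis
      using line_integral_locally_bounded[OF q z0, of \<alpha>] hardy_norm_le_iff[of q 1 \<alpha>] q real by simp
  next
    case top
    from openE[OF open_upper_half_plane z0] obtain \<delta> where "\<delta> > 0" "ball z0 \<delta> \<subseteq> upper_half_plane" .
    then show ?thesis
      using top hardy_norm_infinity_le_iff[of 1 \<alpha>]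
      by (intro exI[of _ \<delta>] conjI exI[of _ "1::real"]) (auto simp: subset_iff)
  qed
  then obtain \<delta> C where \<delta>: "\<delta> > 0" "C \<ge> 0" "ball z0 \<delta> \<subseteq> upper_half_plane"
    and C: "\<And>f w. f holomorphic_on upper_half_plane \<Longrightarrow> hardy_norm p \<alpha> f \<le> 1 \<Longrightarrow>
      w \<in> ball z0 \<delta> \<Longrightarrow> cmod (f w) \<le> C" by blast
  have bound: "cmod (f w) \<le> C * N" if f: "f holomorphic_on upper_half_plane" "0 < N"
    "hardy_norm p \<alpha> f \<le> ennreal N" "w \<in> ball z0 \<delta>" for f N w
  proof -
    have "hardy_norm p \<alpha> (\<lambda>z. complex_of_real (1 / N) * f z) \<le> ennreal (cmod (complex_of_real (1 / N)) * N)"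
      by (rule hardy_norm_cmult_le[OF p _ f(3,1)]) (use f in simp)
    also have "cmod (complex_of_real (1 / N)) * N = 1" using f by (simp add: norm_divide)
    finally have "cmod (complex_of_real (1 / N) * f w) \<le> C"
      using f by (intro C holomorphic_intros) auto
    then show ?thesis using f by (simp add: norm_mult norm_divide field_simps)
  qed
  have "cmod (f w) \<le> C * N" if f: "f holomorphic_on upper_half_plane" "0 \<le> N"
    "hardy_norm p \<alpha> f \<le> ennreal N" "w \<in> ball z0 \<delta>" for f N w
  proof (rule field_le_epsilon)
    fix e :: real assume e: "e > 0"
    \<comment> \<open>Scaling divides by the bound on the norm, so \<open>N = 0\<close> is reached
      by enlarging \<open>N\<close>. The denominator is \<open>C + 1\<close> because
      \<open>C\<close> may be 0.\<close>
    have "cmod (f w) \<le> C * (N + e / (C + 1))"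
      by (rule bound) (use f e \<delta> in \<open>auto intro: order_trans ennreal_leI add_nonneg_pos\<close>)
    also have "\<dots> \<le> C * N + e" using e \<delta> by (simp add: field_simps)
    finally show "cmod (f w) \<le> C * N + e" .
  qed
  then show ?thesis using that \<delta> by blast
qed

subsection \<open>Holomorphy of the transform\<close>

text \<open>Differentiation under the integral by dominated convergence. No bound on derivatives is
  assumed: Cauchy's estimate on circles of radius \<open>\<delta> / 4\<close> about points of the
  ball of radius \<open>\<delta> / 2\<close> bounds them by \<open>4 / \<delta> * B t\<close>, and
  the mean value inequality passes this bound on to the difference quotients.\<close>

lemma holomorphic_on_integral:
  fixes h :: "complex \<Rightarrow> 'a \<Rightarrow> complex"
  assumes S: "open S"
    and hol: "\<And>t. t \<in> space M \<Longrightarrow> (\<lambda>z. h z t) holomorphic_on S"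
    and meas: "\<And>z. z \<in> S \<Longrightarrow> h z \<in> borel_measurable M"
    and dom: "\<And>z0. z0 \<in> S \<Longrightarrow> \<exists>\<delta>>0. \<exists>B. ball z0 \<delta> \<subseteq> S \<and> integrable M B \<and>
      (\<forall>t\<in>space M. \<forall>z\<in>ball z0 \<delta>. cmod (h z t) \<le> B t)"
  shows "(\<lambda>z. LINT t|M. h z t) holomorphic_on S"
proof -
  have "\<exists>F'. ((\<lambda>z. LINT t|M. h z t) has_field_derivative F') (at z0)" if z0: "z0 \<in> S" for z0
  proof -
    from dom[OF z0] obtain \<delta> B where \<delta>: "\<delta> > 0" "ball z0 \<delta> \<subseteq> S" and B: "integrable M B"
      and le: "\<And>t z. t \<in> space M \<Longrightarrow> z \<in> ball z0 \<delta> \<Longrightarrow> cmod (h z t) \<le> B t" by blast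
    have int: "integrable M (h z)" if "z \<in> ball z0 \<delta>" for z
      by (rule Bochner_Integration.integrable_bound[OF B])
        (use that \<delta> meas le in \<open>force intro: order_trans[OF _ abs_ge_self]\<close>)+
    define D where "D = (\<lambda>t. deriv (\<lambda>z. h z t) z0)"
    let ?U = "ball z0 (\<delta> / 2)"
    have der: "((\<lambda>z. h z t) has_field_derivative deriv (\<lambda>z. h z t) \<xi>) (at \<xi>)"
      if "t \<in> space M" "\<xi> \<in> ball z0 \<delta>" for t \<xi>
      using holomorphic_derivI[OF hol[OF that(1)] S] that \<delta> by auto
    have lip: "cmod (h w t - h z0 t) \<le> 4 / \<delta> * B t * cmod (w - z0)"
      if t: "t \<in> space M" and w: "w \<in> ?U" for t w
    proof (rule field_differentiable_bound[of ?U "\<lambda>z. h z t" "deriv (\<lambda>z. h z t)"])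
      fix \<xi> assume \<xi>: "\<xi> \<in> ?U"
      then have \<xi>': "\<xi> \<in> ball z0 \<delta>" using \<delta> by auto
      show "((\<lambda>z. h z t) has_field_derivative deriv (\<lambda>z. h z t) \<xi>) (at \<xi> within ?U)"
        using der[OF t \<xi>'] by (rule has_field_derivative_at_within)
      have sub: "cball \<xi> (\<delta> / 4) \<subseteq> ball z0 \<delta>"
      proof
        fix v assume "v \<in> cball \<xi> (\<delta> / 4)"
        then show "v \<in> ball z0 \<delta>" using \<xi> \<delta> dist_triangle[of z0 v \<xi>] by auto
      qed
      have h\<xi>: "(\<lambda>z. h z t) holomorphic_on cball \<xi> (\<delta> / 4)"
        using holomorphic_on_subset[OF hol[OF t]] sub \<delta> by blast
      have "cmod ((deriv ^^ 1) (\<lambda>z. h z t) \<xi>) \<le> fact 1 * B t / (\<delta> / 4) ^ 1"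
      proof (rule Cauchy_inequality)
        show "(\<lambda>z. h z t) holomorphic_on ball \<xi> (\<delta> / 4)"
          by (rule holomorphic_on_subset[OF h\<xi>]) auto
        show "continuous_on (cball \<xi> (\<delta> / 4)) (\<lambda>z. h z t)"
          by (rule holomorphic_on_imp_continuous_on[OF h\<xi>])
        fix v assume "cmod (\<xi> - v) = \<delta> / 4"
        then have "v \<in> cball \<xi> (\<delta> / 4)" by (simp add: dist_norm)
        then show "cmod (h v t) \<le> B t" using le[OF t] sub by blast
      qed (use \<delta> in auto)
      then show "cmod (deriv (\<lambda>z. h z t) \<xi>) \<le> 4 / \<delta> * B t" by (simp add: mult.commute)
    qed (use w \<delta> in auto)
    \<comment> \<open>Dominated convergence concerns sequences, so the limit is tested along every
      sequence tending to \<open>z0\<close>.\<close>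
    have "((\<lambda>w. ((LINT t|M. h w t) - (LINT t|M. h z0 t)) / (w - z0)) \<longlongrightarrow> (LINT t|M. D t)) (at z0 within ?U)"
      unfolding tendsto_at_iff_sequentially
    proof (intro allI impI)
      fix X assume X: "\<forall>i. X i \<in> ?U - {z0}" and lim: "X \<longlonglongrightarrow> z0"
      have Xb: "X i \<in> ball z0 \<delta>" for i using X[rule_format, of i] \<delta> by auto
      have zb: "z0 \<in> ball z0 \<delta>" using \<delta> by simp
      have eq: "((\<lambda>w. ((LINT t|M. h w t) - (LINT t|M. h z0 t)) / (w - z0)) \<circ> X) i
        = (LINT t|M. (h (X i) t - h z0 t) / (X i - z0))" for i
        using int[OF Xb[of i]] int[OF zb] by simp
      have lims: "(\<lambda>i. (h (X i) t - h z0 t) / (X i - z0)) \<longlonglongrightarrow> D t" if t: "t \<in> space M" for t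
      proof -
        have "((\<lambda>w. (h w t - h z0 t) / (w - z0)) \<longlongrightarrow> D t) (at z0)"
          using der[OF t zb] by (simp add: D_def has_field_derivative_iff)
        moreover have "filterlim X (at z0) sequentially"
          using lim X by (auto simp: filterlim_at)
        ultimately show ?thesis by (rule filterlim_compose)
      qed
      have meas_i: "(\<lambda>t. (h (X i) t - h z0 t) / (X i - z0)) \<in> borel_measurable M" for i
        using meas[of "X i"] meas[OF z0] Xb[of i] \<delta> by auto
      have fe: "(\<lambda>w. ((LINT t|M. h w t) - (LINT t|M. h z0 t)) / (w - z0)) \<circ> X
        = (\<lambda>i. LINT t|M. (h (X i) t - h z0 t) / (X i - z0))"
        using eq by (rule ext)
      show "((\<lambda>w. ((LINT t|M. h w t) - (LINT t|M. h z0 t)) / (w - z0)) \<circ> X) \<longlonglongrightarrow> (LINT t|M. D t)"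
        unfolding fe
        proof (rule integral_dominated_convergence[where w = "\<lambda>t. 4 / \<delta> * B t"])
          \<comment> \<open>Measurability of the derivative in \<open>t\<close> comes for free: it
            is a pointwise limit of measurable difference quotients.\<close>
          show "D \<in> borel_measurable M"
            by (rule borel_measurable_LIMSEQ_metric[OF meas_i lims])
          show "AE t in M. cmod ((h (X i) t - h z0 t) / (X i - z0)) \<le> 4 / \<delta> * B t" for i
          proof (rule AE_I2)
            fix t assume t: "t \<in> space M"
            have "X i \<noteq> z0" "X i \<in> ?U" using X by auto
            with lip[OF t, of "X i"] show "cmod ((h (X i) t - h z0 t) / (X i - z0)) \<le> 4 / \<delta> * B t"
              by (simp add: norm_divide pos_divide_le_eq)
          qed
        qed (use meas_i lims B in \<open>auto intro!: AE_I2\<close>)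
    qed
    moreover have "at z0 within ?U = at z0"
      using \<delta> by (intro at_within_open) auto
    ultimately show ?thesis by (auto simp: has_field_derivative_iff)
  qed
  then show ?thesis using S by (simp add: holomorphic_on_open)
qed

lemma borel_measurable_id_lebesgue_on: "(\<lambda>t. t) \<in> borel_measurable (lebesgue_on S)"
  by (intro measurable_restrict_space1 measurable_completion) simp

lemma space_lebesgue_on_pos [simp]: "space (lebesgue_on {0<..}) = {0::real<..}"
  by (simp add: space_restrict_space)

lemma borel_measurable_dilates:
  assumes "f holomorphic_on upper_half_plane" "z \<in> upper_half_plane"
  shows "(\<lambda>t. f (z / complex_of_real t)) \<in> borel_measurable (lebesgue_on {0<..})"
proof -
  define F where "F = (\<lambda>z. if z \<in> upper_half_plane then f z else 0)"
  have [measurable]: "F \<in> borel_measurable borel"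
    unfolding F_def by (rule borel_measurable_holomorphic_extension[OF assms(1)])
  note [measurable] = borel_measurable_id_lebesgue_on[of "{0<..}"]
  have "(\<lambda>t. F (z / complex_of_real t)) \<in> borel_measurable (lebesgue_on {0<..})"
    by measurable
  then show ?thesis
    by (rule measurable_cong[THEN iffD1, rotated]) (use assms in \<open>simp add: F_def\<close>)
qed

text \<open>The local bound is applied at the fixed point \<open>w\<close> to the dilated function,
  not to \<open>f\<close> at the moving point \<open>w / t\<close>. The growth in \<open>t\<close>
  is then that of the norm of the dilate, which is exactly what the integrability condition on the
  kernel absorbs.\<close>

lemma hardy_dilates_locally_bounded:
  assumes p: "1 \<le> p" and z0: "z0 \<in> upper_half_plane"
  obtains \<delta> C where "\<delta> > 0" "C \<ge> 0" "ball z0 \<delta> \<subseteq> upper_half_plane"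
    "\<And>f N w t. \<lbrakk>f holomorphic_on upper_half_plane; 0 \<le> N; hardy_norm p \<alpha> f \<le> ennreal N; w \<in> ball z0 \<delta>; t > 0\<rbrakk>
      \<Longrightarrow> cmod (f (w / complex_of_real t)) \<le> C * N * t powr hardy_exponent p \<alpha>"
proof -
  from hardy_locally_bounded[OF p z0, of \<alpha>] obtain \<delta> C where \<delta>: "\<delta> > 0" "C \<ge> 0" "ball z0 \<delta> \<subseteq> upper_half_plane"
    and C: "\<And>f N w. \<lbrakk>f holomorphic_on upper_half_plane; 0 \<le> N; hardy_norm p \<alpha> f \<le> ennreal N; w \<in> ball z0 \<delta>\<rbrakk>
      \<Longrightarrow> cmod (f w) \<le> C * N" by metis
  have "cmod (f (w / complex_of_real t)) \<le> C * N * t powr hardy_exponent p \<alpha>"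
    if "f holomorphic_on upper_half_plane" "0 \<le> N" "hardy_norm p \<alpha> f \<le> ennreal N" "w \<in> ball z0 \<delta>" "t > 0"
    for f N w t
    using C[OF holomorphic_dilate[OF that(1,5)] _ hardy_norm_dilate_le[OF p that(2,3,1,5)] that(4)] that
    by (simp add: mult_ac)
  then show ?thesis using that \<delta> by blast
qed

lemma hardy_spaceE:
  assumes "f \<in> hardy_space p \<alpha>"
  obtains N where "f holomorphic_on upper_half_plane" "0 \<le> N" "hardy_norm p \<alpha> f = ennreal N"
  using assms by (cases "hardy_norm p \<alpha> f") (auto simp: hardy_space_def)

text \<open>Locally uniformly in \<open>z\<close> the integrand is at most a constant times
  \<open>t powr \<beta> * (cmod (\<phi> t) / t)\<close>, which is the integrand of the hypothesis.
  This one majorant gives both convergence and holomorphy.\<close>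

lemma
  assumes p: "1 \<le> p" and \<phi>: "\<phi> \<in> borel_measurable (lebesgue_on {0<..})"
    and fin: "(\<integral>\<^sup>+t. ennreal (t powr (hardy_exponent p \<alpha> - 1) * cmod (\<phi> t)) \<partial>lebesgue_on {0<..}) < \<infinity>"
    and f: "f \<in> hardy_space p \<alpha>"
  shows hausdorff_well_definedI: "hausdorff_well_defined \<phi> f"
    and holomorphic_hausdorff_op: "hausdorff_op \<phi> f holomorphic_on upper_half_plane"
proof -
  define \<beta> where "\<beta> = hardy_exponent p \<alpha>"
  define c where "c = (\<lambda>t. t powr (\<beta> - 1) * cmod (\<phi> t))"
  note [measurable] = \<phi> borel_measurable_id_lebesgue_on[of "{0<..}"]
  have ci: "integrable (lebesgue_on {0<..}) c"
    unfolding integrable_iff_bounded using fin by (auto simp: c_def \<beta>_def)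
  from hardy_spaceE[OF f] obtain N where hol: "f holomorphic_on upper_half_plane"
    and N: "0 \<le> N" "hardy_norm p \<alpha> f = ennreal N" .
  have meas: "(\<lambda>t. f (z / complex_of_real t) * (\<phi> t / complex_of_real t)) \<in> borel_measurable (lebesgue_on {0<..})"
    if "z \<in> upper_half_plane" for z
    using borel_measurable_dilates[OF hol that] by measurable
  have dom: "\<exists>\<delta>>0. \<exists>B. ball z0 \<delta> \<subseteq> upper_half_plane \<and> integrable (lebesgue_on {0<..}) B \<and>
      (\<forall>t\<in>space (lebesgue_on {0<..}). \<forall>z\<in>ball z0 \<delta>.
        cmod (f (z / complex_of_real t) * (\<phi> t / complex_of_real t)) \<le> B t)"
    if z0: "z0 \<in> upper_half_plane" for z0
  proof -
    from hardy_dilates_locally_bounded[OF p z0, of \<alpha>] obtain \<delta> C where \<delta>: "\<delta> > 0" "C \<ge> 0" "ball z0 \<delta> \<subseteq> upper_half_plane"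
      and C: "\<And>w t. w \<in> ball z0 \<delta> \<Longrightarrow> t > 0 \<Longrightarrow> cmod (f (w / complex_of_real t)) \<le> C * N * t powr \<beta>"
      using hol N unfolding \<beta>_def by (metis order_refl)
    have "cmod (f (z / complex_of_real t) * (\<phi> t / complex_of_real t)) \<le> C * N * c t"
      if "t > 0" "z \<in> ball z0 \<delta>" for t z
    proof -
      have "cmod (f (z / complex_of_real t) * (\<phi> t / complex_of_real t))
        \<le> C * N * t powr \<beta> * (cmod (\<phi> t) / t)"
        using mult_right_mono[OF C[OF that(2,1)], of "cmod (\<phi> t) / t"] that(1)
        by (simp add: norm_mult norm_divide)
      also have "\<dots> = C * N * c t" using that(1) by (simp add: c_def powr_diff)
      finally show ?thesis .
    qed
    then show ?thesis using \<delta> ci by (intro exI[of _ \<delta>] conjI exI[of _ "\<lambda>t. C * N * c t"]) auto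
  qed
  show "hausdorff_well_defined \<phi> f"
    unfolding hausdorff_well_defined_def
  proof
    fix z assume z: "z \<in> upper_half_plane"
    from dom[OF z] obtain \<delta> B where "\<delta> > 0" and B: "integrable (lebesgue_on {0<..}) B"
      "\<And>t z'. t > 0 \<Longrightarrow> z' \<in> ball z \<delta> \<Longrightarrow> cmod (f (z' / complex_of_real t) * (\<phi> t / complex_of_real t)) \<le> B t"
      by auto
    then have "cmod (f (z / complex_of_real t) * (\<phi> t / complex_of_real t)) \<le> B t" if "t > 0" for t
      using that by auto
    then show "integrable (lebesgue_on {0<..}) (\<lambda>t. f (z / complex_of_real t) * (\<phi> t / complex_of_real t))"
      by (intro Bochner_Integration.integrable_bound[OF B(1) meas[OF z]])
        (auto intro!: AE_I2 intro: order_trans[OF _ abs_ge_self])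
  qed
  have "(\<lambda>z. LINT t|lebesgue_on {0<..}. f (z / complex_of_real t) * (\<phi> t / complex_of_real t))
      holomorphic_on upper_half_plane"
  proof (rule holomorphic_on_integral[OF open_upper_half_plane _ meas dom])
    fix t :: real assume "t \<in> space (lebesgue_on {0<..})"
    then show "(\<lambda>z. f (z / complex_of_real t) * (\<phi> t / complex_of_real t)) holomorphic_on upper_half_plane"
      by (intro holomorphic_intros holomorphic_dilate hol) simp
  qed
  then show "hausdorff_op \<phi> f holomorphic_on upper_half_plane"
    by (simp add: hausdorff_op_def[abs_def])
qed

subsection \<open>The upper bound\<close>

lemma measurable_dilates_pair:
  assumes "f holomorphic_on upper_half_plane" "y > 0"
  shows "(\<lambda>(x, t). f (Complex x y / complex_of_real t)) \<in> borel_measurable (lborel \<Otimes>\<^sub>M lebesgue_on {0<..})"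
proof -
  define F where "F = (\<lambda>z. if z \<in> upper_half_plane then f z else 0)"
  have [measurable]: "F \<in> borel_measurable borel"
    unfolding F_def by (rule borel_measurable_holomorphic_extension[OF assms(1)])
  note [measurable] = borel_measurable_id_lebesgue_on[of "{0<..}"]
  have "(\<lambda>(x, t). F (Complex x y / complex_of_real t)) \<in> borel_measurable (lborel \<Otimes>\<^sub>M lebesgue_on {0<..})"
    by measurable
  then show ?thesis
    by (rule measurable_cong[THEN iffD1, rotated]) (use assms in \<open>auto simp: F_def space_pair_measure\<close>)
qed

text \<open>Minkowski's integral inequality with \<open>c\<close> as weight, in the form given by Jensen's
  inequality for the measure with density \<open>c\<close> followed by Fubini's theorem.\<close>

lemma nn_integral_minkowski:
  fixes F c :: "real \<Rightarrow> real" and G :: "real \<Rightarrow> real \<Rightarrow> real"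
  assumes q: "1 \<le> q" and K: "0 < K" "(\<integral>\<^sup>+t. ennreal (c t) \<partial>lebesgue_on {0<..}) \<le> ennreal K"
    and c: "c \<in> borel_measurable (lebesgue_on {0<..})" "\<And>t. 0 \<le> c t"
    and G: "(\<lambda>(x, t). G x t) \<in> borel_measurable (lborel \<Otimes>\<^sub>M lebesgue_on {0<..})" "\<And>x t. 0 \<le> G x t"
    and F: "\<And>x. 0 \<le> F x" "\<And>x. ennreal (F x) \<le> (\<integral>\<^sup>+t. ennreal (G x t * c t) \<partial>lebesgue_on {0<..})"
  shows "(\<integral>\<^sup>+x. ennreal (F x powr q * \<bar>x\<bar> powr \<alpha>) \<partial>lborel)
    \<le> ennreal (K powr (q - 1)) * (\<integral>\<^sup>+t. (\<integral>\<^sup>+x. ennreal (G x t powr q * \<bar>x\<bar> powr \<alpha>) \<partial>lborel) * ennreal (c t) \<partial>lebesgue_on {0<..})"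
proof -
  define M where "M = lebesgue_on {0::real<..}"
  define N where "N = density M (\<lambda>t. ennreal (c t))"
  have [measurable]: "c \<in> borel_measurable M" using c by (simp add: M_def)
  have G1: "(\<lambda>(x, t). G x t) \<in> borel_measurable (lborel \<Otimes>\<^sub>M M)" using G by (simp add: M_def)
  have Gx [measurable]: "(\<lambda>t. G x t) \<in> borel_measurable M" for x
    using measurable_Pair2[OF G1, of x] by simp
  have sN [measurable_cong]: "sets N = sets M" and spN: "space N = space M" by (simp_all add: N_def)
  have GN [measurable]: "(\<lambda>(x, t). G x t) \<in> borel_measurable (lborel \<Otimes>\<^sub>M N)"
    using G1 by (simp add: measurable_cong_sets[OF sets_pair_measure_cong[OF refl sN] refl])
  have nnN: "(\<integral>\<^sup>+t. u t \<partial>N) = (\<integral>\<^sup>+t. ennreal (c t) * u t \<partial>M)" if "u \<in> borel_measurable M" for u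
    unfolding N_def by (rule nn_integral_density) (use that in auto)
  have emN: "emeasure N (space N) \<le> ennreal K"
    using nnN[of "\<lambda>_. 1"] K(2) by (simp add: M_def)
  interpret N: finite_measure N
    \<comment> \<open>Finiteness of the mass also gives the sigma-finiteness that Fubini's theorem
      requires.\<close>
    by (rule finite_measureI) (use emN in \<open>auto simp: top_unique\<close>)
  interpret pair_sigma_finite lborel N ..
  have "(\<integral>\<^sup>+x. ennreal (F x powr q * \<bar>x\<bar> powr \<alpha>) \<partial>lborel)
    \<le> (\<integral>\<^sup>+x. ennreal (K powr (q - 1)) * (\<integral>\<^sup>+t. ennreal (G x t powr q * \<bar>x\<bar> powr \<alpha>) \<partial>N) \<partial>lborel)"
  proof (rule nn_integral_mono)
    fix x
    have GxN: "(\<lambda>t. G x t) \<in> borel_measurable N"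
      using Gx[of x] by (simp add: measurable_cong_sets[OF sN refl])
    have "ennreal (F x) \<le> (\<integral>\<^sup>+t. ennreal (G x t) \<partial>N)"
      using F(2)[of x] c G by (subst nnN) (auto simp: M_def ennreal_mult mult.commute)
    from nn_integral_powr_jensen[OF q K(1) emN GxN _ F(1) this] G
    have "ennreal (F x powr q) \<le> ennreal (K powr (q - 1)) * (\<integral>\<^sup>+t. ennreal (G x t powr q) \<partial>N)" by simp
    then have "ennreal (F x powr q) * ennreal (\<bar>x\<bar> powr \<alpha>)
      \<le> ennreal (K powr (q - 1)) * (\<integral>\<^sup>+t. ennreal (G x t powr q) \<partial>N) * ennreal (\<bar>x\<bar> powr \<alpha>)"
      by (rule mult_right_mono) simp
    also have "\<dots> = ennreal (K powr (q - 1)) * (\<integral>\<^sup>+t. ennreal (G x t powr q) * ennreal (\<bar>x\<bar> powr \<alpha>) \<partial>N)"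
      using GxN by (subst nn_integral_multc) (auto simp: mult.assoc)
    finally show "ennreal (F x powr q * \<bar>x\<bar> powr \<alpha>)
      \<le> ennreal (K powr (q - 1)) * (\<integral>\<^sup>+t. ennreal (G x t powr q * \<bar>x\<bar> powr \<alpha>) \<partial>N)"
      by (simp add: ennreal_mult)
  qed
  also have "\<dots> = ennreal (K powr (q - 1)) * (\<integral>\<^sup>+x. (\<integral>\<^sup>+t. ennreal (G x t powr q * \<bar>x\<bar> powr \<alpha>) \<partial>N) \<partial>lborel)"
    by (rule nn_integral_cmult) measurable
  also have "(\<integral>\<^sup>+x. (\<integral>\<^sup>+t. ennreal (G x t powr q * \<bar>x\<bar> powr \<alpha>) \<partial>N) \<partial>lborel)
    = (\<integral>\<^sup>+t. (\<integral>\<^sup>+x. ennreal (G x t powr q * \<bar>x\<bar> powr \<alpha>) \<partial>lborel) \<partial>N)"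
    by (rule Fubini'[symmetric]) measurable
  also have "\<dots> = (\<integral>\<^sup>+t. ennreal (c t) * (\<integral>\<^sup>+x. ennreal (G x t powr q * \<bar>x\<bar> powr \<alpha>) \<partial>lborel) \<partial>M)"
  proof (rule nnN)
    have "(\<lambda>t. \<integral>\<^sup>+x. ennreal (G x t powr q * \<bar>x\<bar> powr \<alpha>) \<partial>lborel) \<in> borel_measurable N"
      by measurable
    then show "(\<lambda>t. \<integral>\<^sup>+x. ennreal (G x t powr q * \<bar>x\<bar> powr \<alpha>) \<partial>lborel) \<in> borel_measurable M"
      by (simp add: measurable_cong_sets[OF sN refl])
  qed
  finally show ?thesis by (simp add: M_def mult.commute)
qed

text \<open>The transform is an average, with weight \<open>c\<close> of mass at most
  \<open>K\<close>, of dilates normalised to have norm at most \<open>N\<close>. For finite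
  exponents Jensen and Fubini give \<open>K powr (q - 1) * N powr q * K\<close>, which is
  \<open>(K * N) powr q\<close>.\<close>

lemma hardy_norm_hausdorff_le:
  assumes p: "1 \<le> p" and \<phi>: "\<phi> \<in> borel_measurable (lebesgue_on {0<..})"
    and K: "0 < K" "(\<integral>\<^sup>+t. ennreal (t powr (hardy_exponent p \<alpha> - 1) * cmod (\<phi> t)) \<partial>lebesgue_on {0<..}) \<le> ennreal K"
    and f: "f holomorphic_on upper_half_plane" and N: "0 \<le> N" "hardy_norm p \<alpha> f \<le> ennreal N"
  shows "hardy_norm p \<alpha> (hausdorff_op \<phi> f) \<le> ennreal (K * N)"
proof -
  define \<beta> where "\<beta> = hardy_exponent p \<alpha>"
  define c where "c = (\<lambda>t. t powr (\<beta> - 1) * cmod (\<phi> t))"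
  note [measurable] = \<phi> borel_measurable_id_lebesgue_on[of "{0<..}"]
  have c: "c \<in> borel_measurable (lebesgue_on {0<..})" "\<And>t. 0 \<le> c t" by (auto simp: c_def)
  have Kc: "(\<integral>\<^sup>+t. ennreal (c t) \<partial>lebesgue_on {0<..}) \<le> ennreal K" using K by (simp add: c_def \<beta>_def)
  have le: "ennreal (cmod (hausdorff_op \<phi> f z))
      \<le> (\<integral>\<^sup>+t. ennreal (cmod (f (z / complex_of_real t)) * t powr (- \<beta>) * c t) \<partial>lebesgue_on {0<..})" for z
  proof -
    \<comment> \<open>A divergent Bochner integral has the default value 0 and satisfies the bound
      trivially, so every \<open>z\<close> is covered.\<close>
    have "ennreal (cmod (hausdorff_op \<phi> f z))
      \<le> (\<integral>\<^sup>+t. ennreal (cmod (f (z / complex_of_real t) * (\<phi> t / complex_of_real t))) \<partial>lebesgue_on {0<..})"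
      unfolding hausdorff_op_def
      by (cases "integrable (lebesgue_on {0<..}) (\<lambda>t. f (z / complex_of_real t) * (\<phi> t / complex_of_real t))")
        (auto intro: integral_norm_bound_ennreal simp: not_integrable_integral_eq)
    also have "\<dots> = (\<integral>\<^sup>+t. ennreal (cmod (f (z / complex_of_real t)) * t powr (- \<beta>) * c t) \<partial>lebesgue_on {0<..})"
    proof (rule nn_integral_cong)
      fix t :: real assume "t \<in> space (lebesgue_on {0<..})"
      then have t: "t > 0" by simp
      then have "t powr (- \<beta>) * t powr (\<beta> - 1) = 1 / t"
        by (simp add: powr_minus_divide powr_diff)
      then have "cmod (f (z / complex_of_real t)) * t powr (- \<beta>) * c t
        = cmod (f (z / complex_of_real t)) * (1 / t) * cmod (\<phi> t)"
        by (simp only: c_def mult.assoc flip: mult.assoc[of "t powr (- \<beta>)"])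
      then show "ennreal (cmod (f (z / complex_of_real t) * (\<phi> t / complex_of_real t)))
        = ennreal (cmod (f (z / complex_of_real t)) * t powr (- \<beta>) * c t)"
        using t by (simp add: norm_mult norm_divide)
    qed
    finally show ?thesis .
  qed
  show ?thesis
  proof (cases p)
    case (real q)
    with p have q: "q \<ge> 1" by simp
    have \<beta>q: "\<beta> * q = 1 + \<alpha>" using real q by (simp add: \<beta>_def hardy_exponent_def)
    have Nq: "line_integral q \<alpha> f y \<le> ennreal (N powr q)" if "y > 0" for y
      using N hardy_norm_le_iff[of q N \<alpha> f] q real that by auto
    have "line_integral q \<alpha> (hausdorff_op \<phi> f) y \<le> ennreal ((K * N) powr q)" if y: "y > 0" for y
    proof -
      \<comment> \<open>The factor \<open>t powr (- \<beta>)\<close> normalises the dilates: all of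
        them obey the same bound \<open>N powr q\<close>, and the remaining dependence on
        \<open>t\<close> sits in \<open>c\<close>.\<close>
      define G where "G = (\<lambda>x t. cmod (f (Complex x y / complex_of_real t)) * t powr (- \<beta>))"
      note [measurable] = measurable_dilates_pair[OF f y]
      have Gm: "(\<lambda>(x, t). G x t) \<in> borel_measurable (lborel \<Otimes>\<^sub>M lebesgue_on {0<..})"
        unfolding G_def by measurable
      have GI: "(\<integral>\<^sup>+x. ennreal (G x t powr q * \<bar>x\<bar> powr \<alpha>) \<partial>lborel) \<le> ennreal (N powr q)" if t: "t > 0" for t
      proof -
        have "(\<integral>\<^sup>+x. ennreal (G x t powr q * \<bar>x\<bar> powr \<alpha>) \<partial>lborel)
          = line_integral q \<alpha> (\<lambda>z. complex_of_real (t powr (- \<beta>)) * f (z / complex_of_real t)) y"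
          by (simp add: line_integral_def G_def norm_mult mult.commute)
        also have "\<dots> = ennreal (t powr (- (1 + \<alpha>))) * (ennreal (t powr (1 + \<alpha>)) * line_integral q \<alpha> f (y / t))"
          by (simp add: line_integral_cmult[OF holomorphic_dilate[OF f t] y] line_integral_dilate[OF f y t] powr_powr \<beta>q)
        also have "\<dots> = line_integral q \<alpha> f (y / t)"
          using t by (simp add: mult.assoc[symmetric] ennreal_mult[symmetric] powr_add[symmetric])
        also have "\<dots> \<le> ennreal (N powr q)" using Nq y t by simp
        finally show ?thesis .
      qed
      have "line_integral q \<alpha> (hausdorff_op \<phi> f) y
        \<le> ennreal (K powr (q - 1)) * (\<integral>\<^sup>+t. (\<integral>\<^sup>+x. ennreal (G x t powr q * \<bar>x\<bar> powr \<alpha>) \<partial>lborel) * ennreal (c t) \<partial>lebesgue_on {0<..})"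
        unfolding line_integral_def
        by (rule nn_integral_minkowski[OF q K(1) Kc c Gm]) (use le in \<open>auto simp: G_def\<close>)
      also have "\<dots> \<le> ennreal (K powr (q - 1)) * (\<integral>\<^sup>+t. ennreal (N powr q) * ennreal (c t) \<partial>lebesgue_on {0<..})"
        by (intro mult_left_mono nn_integral_mono mult_right_mono GI) auto
      also have "\<dots> = ennreal (K powr (q - 1)) * (ennreal (N powr q) * (\<integral>\<^sup>+t. ennreal (c t) \<partial>lebesgue_on {0<..}))"
        using c by (subst nn_integral_cmult) auto
      also have "\<dots> \<le> ennreal (K powr (q - 1)) * (ennreal (N powr q) * ennreal K)"
        by (intro mult_left_mono Kc) auto
      also have "\<dots> = ennreal ((K * N) powr q)"
        using K N by (simp add: ennreal_mult[symmetric] powr_mult powr_diff)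
      finally show ?thesis .
    qed
    then show ?thesis using hardy_norm_le_iff[of q "K * N" \<alpha>] K N q real by auto
  next
    case top
    then have \<beta>0: "\<beta> = 0" by (simp add: \<beta>_def hardy_exponent_def)
    have "cmod (hausdorff_op \<phi> f z) \<le> K * N" if z: "z \<in> upper_half_plane" for z
    proof -
      have fN: "cmod (f w) \<le> N" if "w \<in> upper_half_plane" for w
        using N hardy_norm_infinity_le_iff[of N \<alpha> f] top that by auto
      have "ennreal (cmod (hausdorff_op \<phi> f z))
        \<le> (\<integral>\<^sup>+t. ennreal (cmod (f (z / complex_of_real t)) * t powr (- \<beta>) * c t) \<partial>lebesgue_on {0<..})"
        by (rule le)
      also have "\<dots> \<le> (\<integral>\<^sup>+t. ennreal N * ennreal (c t) \<partial>lebesgue_on {0<..})"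
        using z fN N c by (intro nn_integral_mono)
          (auto simp: \<beta>0 ennreal_mult[symmetric] intro!: ennreal_leI mult_right_mono)
      also have "\<dots> = ennreal N * (\<integral>\<^sup>+t. ennreal (c t) \<partial>lebesgue_on {0<..})"
        using c by (subst nn_integral_cmult) auto
      also have "\<dots> \<le> ennreal N * ennreal K" by (intro mult_left_mono Kc) auto
      also have "\<dots> = ennreal (K * N)" using N K by (simp add: ennreal_mult[symmetric] mult.commute)
      finally show ?thesis using K N by (simp add: ennreal_le_iff)
    qed
    then show ?thesis using hardy_norm_infinity_le_iff[of "K * N" \<alpha>] K N top by auto
  qed
qed

lemma
  assumes p: "1 \<le> p" and \<phi>: "\<phi> \<in> borel_measurable (lebesgue_on {0<..})"
    and fin: "(\<integral>\<^sup>+t. ennreal (t powr (hardy_exponent p \<alpha> - 1) * cmod (\<phi> t)) \<partial>lebesgue_on {0<..}) < \<infinity>"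
  shows hausdorff_boundedI: "hausdorff_bounded \<phi> p \<alpha>"
    and hardy_op_norm_hausdorff_le: "hardy_op_norm p \<alpha> (hausdorff_op \<phi>)
      \<le> (\<integral>\<^sup>+t. ennreal (t powr (hardy_exponent p \<alpha> - 1) * cmod (\<phi> t)) \<partial>lebesgue_on {0<..})"
proof -
  obtain k where k: "k \<ge> 0"
    "(\<integral>\<^sup>+t. ennreal (t powr (hardy_exponent p \<alpha> - 1) * cmod (\<phi> t)) \<partial>lebesgue_on {0<..}) = ennreal k"
    using fin by (cases "\<integral>\<^sup>+t. ennreal (t powr (hardy_exponent p \<alpha> - 1) * cmod (\<phi> t)) \<partial>lebesgue_on {0<..}") auto
  have bound: "hardy_norm p \<alpha> (hausdorff_op \<phi> f) \<le> ennreal ((k + e) * N)"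
    if "e > 0" "f holomorphic_on upper_half_plane" "0 \<le> N" "hardy_norm p \<alpha> f \<le> ennreal N" for e f N
    by (rule hardy_norm_hausdorff_le[OF p \<phi>]) (use that k in \<open>auto simp: ennreal_leI\<close>)
  show le: "hardy_op_norm p \<alpha> (hausdorff_op \<phi>)
      \<le> (\<integral>\<^sup>+t. ennreal (t powr (hardy_exponent p \<alpha> - 1) * cmod (\<phi> t)) \<partial>lebesgue_on {0<..})"
  \<comment> \<open>The preceding bound is for positive constants, while \<open>k\<close> may be 0;
    hence the passage through \<open>k + e\<close>.\<close>
  proof (rule ennreal_le_epsilon)
    fix e :: real assume e: "e > 0"
    show "hardy_op_norm p \<alpha> (hausdorff_op \<phi>)
      \<le> (\<integral>\<^sup>+t. ennreal (t powr (hardy_exponent p \<alpha> - 1) * cmod (\<phi> t)) \<partial>lebesgue_on {0<..}) + ennreal e"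
      unfolding hardy_op_norm_def k(2)
      using bound[OF e, of _ 1] e k(1) by (auto simp: hardy_space_def intro!: SUP_least simp flip: ennreal_plus)
  qed
  show "hausdorff_bounded \<phi> p \<alpha>"
    unfolding hausdorff_bounded_def
  proof (intro conjI ballI)
    fix f assume f: "f \<in> hardy_space p \<alpha>"
    show "hausdorff_well_defined \<phi> f" by (rule hausdorff_well_definedI[OF p \<phi> fin f])
    from hardy_spaceE[OF f] obtain N where N: "f holomorphic_on upper_half_plane"
      "0 \<le> N" "hardy_norm p \<alpha> f = ennreal N" .
    from bound[of 1 f N] N have "hardy_norm p \<alpha> (hausdorff_op \<phi> f) < \<infinity>"
      by (auto intro: le_less_trans)
    then show "hausdorff_op \<phi> f \<in> hardy_space p \<alpha>"
      using holomorphic_hausdorff_op[OF p \<phi> fin f] by (simp add: hardy_space_def)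
  next
    show "hardy_op_norm p \<alpha> (hausdorff_op \<phi>) < \<infinity>" using le fin by (rule le_less_trans)
  qed
qed

subsection \<open>Test functions\<close>

lemma nn_integral_powr_0_1:
  assumes "a > -1"
  shows "(\<integral>\<^sup>+x. indicator {0..1} x * ennreal (x powr a) \<partial>lborel) = ennreal (1 / (a + 1))"
proof -
  have "((\<lambda>x. if x \<in> {0..1} then x powr a else 0) has_integral (1 / (a + 1))) UNIV"
    using has_integral_powr_from_0[OF assms, of 1] by (simp only: has_integral_restrict_UNIV) simp
  from nn_integral_has_integral_lborel[OF _ _ this]
  have "(\<integral>\<^sup>+x. ennreal (if x \<in> {0..1} then x powr a else 0) \<partial>lborel) = ennreal (1 / (a + 1))"
    by simp
  moreover have "ennreal (if x \<in> {0..1} then x powr a else 0) = indicator {0..1} x * ennreal (x powr a)" for x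
    by simp
  ultimately show ?thesis by (simp only:)
qed

lemma nn_integral_powr_to_inf:
  assumes "e < -1" "c > 0"
  shows "(\<integral>\<^sup>+x. indicator {c..} x * ennreal (x powr e) \<partial>lborel) = ennreal (- (c powr (e + 1)) / (e + 1))"
proof -
  have "((\<lambda>x. if x \<in> {c..} then x powr e else 0) has_integral (- (c powr (e + 1)) / (e + 1))) UNIV"
    using has_integral_powr_to_inf[OF assms] by (simp only: has_integral_restrict_UNIV)
  from nn_integral_has_integral_lborel[OF _ _ this]
  have "(\<integral>\<^sup>+x. ennreal (if x \<in> {c..} then x powr e else 0) \<partial>lborel) = ennreal (- (c powr (e + 1)) / (e + 1))"
    by simp
  moreover have "ennreal (if x \<in> {c..} then x powr e else 0) = indicator {c..} x * ennreal (x powr e)" for x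
    by simp
  ultimately show ?thesis by (simp only:)
qed

text \<open>Near 0 the weight is integrable because \<open>\<alpha> > -1\<close>; beyond 1 the
  assumed decay leaves \<open>\<bar>x\<bar> powr (- 1 - r)\<close>. The term \<open>D / r\<close> is
  the source of the blow-up for small \<open>r\<close>. The majorant \<open>w\<close> lives on the
  positive half-line, and \<open>w (- x)\<close> covers the other half.\<close>

lemma nn_integral_power_weight_le:
  fixes v :: "real \<Rightarrow> real"
  assumes \<alpha>: "\<alpha> > -1" and r: "r > 0" and BD: "0 \<le> B" "0 \<le> D"
    and v: "\<And>x. v x \<le> B" "\<And>x. 1 \<le> \<bar>x\<bar> \<Longrightarrow> v x \<le> D * \<bar>x\<bar> powr (- (1 + \<alpha> + r))"
  shows "(\<integral>\<^sup>+x. ennreal (v x * \<bar>x\<bar> powr \<alpha>) \<partial>lborel) \<le> ennreal (2 * (B / (1 + \<alpha>) + D / r))"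
proof -
  define w where "w = (\<lambda>x::real. ennreal B * (indicator {0..1} x * ennreal (x powr \<alpha>))
    + ennreal D * (indicator {1..} x * ennreal (x powr (- 1 - r))))"
  have [measurable]: "w \<in> borel_measurable borel" unfolding w_def by measurable
  have "(\<integral>\<^sup>+x. ennreal (v x * \<bar>x\<bar> powr \<alpha>) \<partial>lborel) \<le> (\<integral>\<^sup>+x. w x + w (- x) \<partial>lborel)"
  proof (rule nn_integral_mono)
    fix x :: real
    have small: "ennreal (v x * \<bar>x\<bar> powr \<alpha>) \<le> ennreal B * ennreal (\<bar>x\<bar> powr \<alpha>)"
      using v(1)[of x] BD by (auto simp: ennreal_mult[symmetric] intro!: ennreal_leI mult_right_mono)
    have large: "ennreal (v x * \<bar>x\<bar> powr \<alpha>) \<le> ennreal D * ennreal (\<bar>x\<bar> powr (- 1 - r))" if "1 \<le> \<bar>x\<bar>"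
    proof -
      have "v x * \<bar>x\<bar> powr \<alpha> \<le> D * \<bar>x\<bar> powr (- (1 + \<alpha> + r)) * \<bar>x\<bar> powr \<alpha>"
        by (intro mult_right_mono v that) auto
      also have "\<dots> = D * \<bar>x\<bar> powr (- 1 - r)" by (simp add: mult.assoc flip: powr_add)
      finally show ?thesis using BD by (simp add: ennreal_mult[symmetric] ennreal_leI)
    qed
    have pos: "ennreal (v x * \<bar>x\<bar> powr \<alpha>) \<le> w \<bar>x\<bar>"
      using small large by (cases "\<bar>x\<bar> \<le> 1") (auto simp: w_def intro: order_trans)
    then show "ennreal (v x * \<bar>x\<bar> powr \<alpha>) \<le> w x + w (- x)"
      by (cases "x \<ge> 0") (auto intro: order_trans)
  qed
  also have "\<dots> = (\<integral>\<^sup>+x. w x \<partial>lborel) + (\<integral>\<^sup>+x. w (- x) \<partial>lborel)"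
    by (rule nn_integral_add) measurable
  also have "(\<integral>\<^sup>+x. w (- x) \<partial>lborel) = (\<integral>\<^sup>+x. w x \<partial>lborel)"
    using nn_integral_real_affine[of w "-1" 0] by simp
  also have "(\<integral>\<^sup>+x. w x \<partial>lborel) = ennreal B * ennreal (1 / (\<alpha> + 1)) + ennreal D * ennreal (1 / r)"
    unfolding w_def using \<alpha> r
    by (simp add: nn_integral_add nn_integral_cmult nn_integral_powr_0_1 nn_integral_powr_to_inf)
  also have "\<dots> = ennreal (B / (1 + \<alpha>) + D / r)"
    using \<alpha> r BD by (simp add: ennreal_mult[symmetric] ennreal_plus[symmetric] add.commute del: ennreal_plus)
  finally show ?thesis using \<alpha> r BD by (simp add: ennreal_plus[symmetric] del: ennreal_plus)
qed

text \<open>A substitute for the triangle inequality that stays with q-th powers: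
  \<open>l = 1 / 2\<close> serves where constants do not matter, \<open>l\<close> near 0 where the
  factor of the leading term must tend to 1.\<close>

lemma line_integral_add_le:
  assumes q: "1 \<le> q" and l: "0 < l" "l < 1"
    and f: "f holomorphic_on upper_half_plane" and g: "g holomorphic_on upper_half_plane" and y: "y > 0"
  shows "line_integral q \<alpha> (\<lambda>z. f z + g z) y
    \<le> ennreal ((1 - l) powr (1 - q)) * line_integral q \<alpha> f y + ennreal (l powr (1 - q)) * line_integral q \<alpha> g y"
proof -
  note [measurable] = borel_measurable_on_line[OF f y] borel_measurable_on_line[OF g y]
  have "line_integral q \<alpha> (\<lambda>z. f z + g z) y
    \<le> (\<integral>\<^sup>+x. ennreal ((1 - l) powr (1 - q)) * ennreal (cmod (f (Complex x y)) powr q * \<bar>x\<bar> powr \<alpha>)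
      + ennreal (l powr (1 - q)) * ennreal (cmod (g (Complex x y)) powr q * \<bar>x\<bar> powr \<alpha>) \<partial>lborel)"
    unfolding line_integral_def
  proof (rule nn_integral_mono)
    fix x
    let ?u = "cmod (f (Complex x y))" and ?v = "cmod (g (Complex x y))"
    have "cmod (f (Complex x y) + g (Complex x y)) powr q \<le> (?u + ?v) powr q"
      using q by (intro powr_mono2 norm_triangle_ineq) auto
    also have "\<dots> \<le> (1 - l) powr (1 - q) * ?u powr q + l powr (1 - q) * ?v powr q"
      by (rule powr_weighted_add_le) (use q l in auto)
    finally have "cmod (f (Complex x y) + g (Complex x y)) powr q * \<bar>x\<bar> powr \<alpha>
      \<le> ((1 - l) powr (1 - q) * ?u powr q + l powr (1 - q) * ?v powr q) * \<bar>x\<bar> powr \<alpha>"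
      by (rule mult_right_mono) simp
    then show "ennreal (cmod (f (Complex x y) + g (Complex x y)) powr q * \<bar>x\<bar> powr \<alpha>)
      \<le> ennreal ((1 - l) powr (1 - q)) * ennreal (?u powr q * \<bar>x\<bar> powr \<alpha>)
        + ennreal (l powr (1 - q)) * ennreal (?v powr q * \<bar>x\<bar> powr \<alpha>)"
      by (simp add: ennreal_mult[symmetric] ennreal_plus[symmetric] algebra_simps ennreal_leI del: ennreal_plus)
  qed
  also have "\<dots> = ennreal ((1 - l) powr (1 - q)) * line_integral q \<alpha> f y + ennreal (l powr (1 - q)) * line_integral q \<alpha> g y"
    unfolding line_integral_def by (simp add: nn_integral_add nn_integral_cmult)
  finally show ?thesis .
qed

section \<open>Powers of \<open>1 - \<i> * z\<close>: size and behaviour under dilation\<close>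

text \<open>For \<open>z\<close> in the half-plane the base has real part
  \<open>1 + Im z > 1\<close>, so it stays away from the cut of the principal branch.\<close>

definition test_function :: "real \<Rightarrow> complex \<Rightarrow> complex" where
  "test_function b z = (1 - \<i> * z) powr (- complex_of_real b)"

lemma shifted_rotation_notin_nonpos:
  assumes "z \<in> upper_half_plane" "s > 0"
  shows "complex_of_real s - \<i> * z \<notin> \<real>\<^sub>\<le>\<^sub>0"
  using assms by (auto simp: complex_nonpos_Reals_iff upper_half_plane_def)

lemma holomorphic_test_function: "test_function b holomorphic_on upper_half_plane"
proof -
  have "1 - \<i> * z \<notin> \<real>\<^sub>\<le>\<^sub>0" if "z \<in> upper_half_plane" for z
    using shifted_rotation_notin_nonpos[OF that, of 1] by simp
  then have "(\<lambda>z. (1 - \<i> * z) powr (- complex_of_real b)) holomorphic_on upper_half_plane"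
    by (intro holomorphic_on_powr holomorphic_intros)
  then show ?thesis by (simp add: test_function_def[abs_def])
qed

text \<open>The base has real part \<open>s + y\<close> and imaginary part \<open>- x\<close>, so
  its modulus is at least \<open>s\<close> and at least \<open>\<bar>x\<bar>\<close>. The first
  bound serves for small \<open>x\<close>, the second at infinity.\<close>

lemma norm_powr_shifted_rotation_le:
  assumes "b \<ge> 0" "s > 0" "y > 0"
  shows "cmod ((complex_of_real s - \<i> * Complex x y) powr (- complex_of_real b)) \<le> s powr (- b)"
    and "x \<noteq> 0 \<Longrightarrow> cmod ((complex_of_real s - \<i> * Complex x y) powr (- complex_of_real b)) \<le> \<bar>x\<bar> powr (- b)"
proof -
  have n: "cmod ((complex_of_real s - \<i> * Complex x y) powr (- complex_of_real b))
      = cmod (complex_of_real s - \<i> * Complex x y) powr (- b)"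
    using norm_powr_real_powr'[of "- complex_of_real b"] by simp
  have "s \<le> cmod (complex_of_real s - \<i> * Complex x y)" "\<bar>x\<bar> \<le> cmod (complex_of_real s - \<i> * Complex x y)"
    using complex_Re_le_cmod[of "complex_of_real s - \<i> * Complex x y"]
      abs_Im_le_cmod[of "complex_of_real s - \<i> * Complex x y"] assms by auto
  then show "cmod ((complex_of_real s - \<i> * Complex x y) powr (- complex_of_real b)) \<le> s powr (- b)"
    "x \<noteq> 0 \<Longrightarrow> cmod ((complex_of_real s - \<i> * Complex x y) powr (- complex_of_real b)) \<le> \<bar>x\<bar> powr (- b)"
    using assms unfolding n by (auto intro!: powr_mono2')
qed

lemma line_integral_test_function_le:
  assumes q: "1 \<le> q" and \<alpha>: "\<alpha> > -1" and r: "r > 0" "b * q = 1 + \<alpha> + r" and y: "y > 0"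
  shows "line_integral q \<alpha> (test_function b) y \<le> ennreal (2 * (1 / (1 + \<alpha>) + 1 / r))"
  unfolding line_integral_def
proof (rule nn_integral_power_weight_le)
  have "b * q > 0" using r \<alpha> by simp
  then have b: "b > 0" using q by (simp add: zero_less_mult_iff)
  fix x
  have "cmod (test_function b (Complex x y)) powr q \<le> (1 powr (- b)) powr q"
    using norm_powr_shifted_rotation_le(1)[of b 1 y x] b q y
    by (intro powr_mono2) (auto simp: test_function_def)
  then show "cmod (test_function b (Complex x y)) powr q \<le> 1" by simp
  assume x: "1 \<le> \<bar>x\<bar>"
  have "cmod (test_function b (Complex x y)) powr q \<le> (\<bar>x\<bar> powr (- b)) powr q"
    using norm_powr_shifted_rotation_le(2)[of b 1 y x] b q y x
    by (intro powr_mono2) (auto simp: test_function_def)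
  then show "cmod (test_function b (Complex x y)) powr q \<le> 1 * \<bar>x\<bar> powr (- (1 + \<alpha> + r))"
    by (simp add: powr_powr r)
qed (use \<alpha> r in auto)

text \<open>At height 1 and for \<open>x \<ge> 2\<close> the base has modulus at most
  \<open>2 + x \<le> 2 * x\<close>, and the integral of \<open>x powr (- 1 - r)\<close> from 2 on is
  \<open>2 powr (- r) / r\<close>. This shows that the norm really blows up as \<open>r\<close>
  tends to 0.\<close>

lemma line_integral_test_function_ge:
  assumes q: "1 \<le> q" and \<alpha>: "\<alpha> > -1" and r: "r > 0" "b * q = 1 + \<alpha> + r"
  shows "ennreal (2 powr (- (1 + \<alpha> + 2 * r)) / r) \<le> line_integral q \<alpha> (test_function b) 1"
proof -
  have "b * q > 0" using r \<alpha> by simp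
  then have b: "b > 0" using q by (simp add: zero_less_mult_iff)
  have "ennreal (2 powr (- (1 + \<alpha> + 2 * r)) / r)
    = ennreal (2 powr (- (1 + \<alpha> + r))) * ennreal (2 powr (- r) / r)"
    using r by (simp add: ennreal_mult[symmetric] flip: powr_add)
  also have "ennreal (2 powr (- r) / r) = (\<integral>\<^sup>+x. indicator {2..} x * ennreal (x powr (- 1 - r)) \<partial>lborel)"
    using r by (subst nn_integral_powr_to_inf) auto
  also have "ennreal (2 powr (- (1 + \<alpha> + r))) * \<dots>
      = (\<integral>\<^sup>+x. ennreal (2 powr (- (1 + \<alpha> + r))) * (indicator {2..} x * ennreal (x powr (- 1 - r))) \<partial>lborel)"
    by (rule nn_integral_cmult[symmetric]) measurable
  also have "\<dots> \<le> line_integral q \<alpha> (test_function b) 1"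
    unfolding line_integral_def
  proof (rule nn_integral_mono)
    fix x :: real
    show "ennreal (2 powr (- (1 + \<alpha> + r))) * (indicator {2..} x * ennreal (x powr (- 1 - r)))
      \<le> ennreal (cmod (test_function b (Complex x 1)) powr q * \<bar>x\<bar> powr \<alpha>)"
    proof (cases "x \<ge> 2")
      case x: True
      have "cmod (1 - \<i> * Complex x 1) \<le> 2 * x"
      proof -
        have "cmod (1 - \<i> * Complex x 1) = cmod (Complex 2 (- x))" by (rule arg_cong[of _ _ cmod]) (simp add: complex_eq_iff)
        also have "\<dots> \<le> \<bar>2\<bar> + \<bar>- x\<bar>" using cmod_le[of "Complex 2 (- x)"] by simp
        finally show ?thesis using x by simp
      qed
      moreover have "cmod (1 - \<i> * Complex x 1) > 0" using x by (auto simp: complex_eq_iff)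
      ultimately have "(2 * x) powr (- b) \<le> cmod (1 - \<i> * Complex x 1) powr (- b)"
        using b by (intro powr_mono2') auto
      also have "\<dots> = cmod (test_function b (Complex x 1))"
        using norm_powr_real_powr'[of "- complex_of_real b" "1 - \<i> * Complex x 1"] by (simp add: test_function_def)
      finally have "((2 * x) powr (- b)) powr q \<le> cmod (test_function b (Complex x 1)) powr q"
        using q by (intro powr_mono2) auto
      then have "(2 * x) powr (- (1 + \<alpha> + r)) * \<bar>x\<bar> powr \<alpha> \<le> cmod (test_function b (Complex x 1)) powr q * \<bar>x\<bar> powr \<alpha>"
        by (intro mult_right_mono) (simp_all add: powr_powr r)
      also have "(2 * x) powr (- (1 + \<alpha> + r)) * \<bar>x\<bar> powr \<alpha> = 2 powr (- (1 + \<alpha> + r)) * x powr (- 1 - r)"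
        using x by (simp add: powr_mult mult.assoc flip: powr_add)
      finally show ?thesis using x by (simp add: ennreal_mult[symmetric] ennreal_leI)
    qed simp
  qed
  finally show ?thesis .
qed

text \<open>Up to a scalar, dilation only moves the shift from 1 to \<open>t\<close>. Positive
  factors pass through the principal branch, because \<open>Ln\<close> of a product with a positive
  real is the sum.\<close>

lemma test_function_dilate:
  assumes z: "z \<in> upper_half_plane" and t: "t > 0"
  shows "complex_of_real (t powr (- b)) * test_function b (z / complex_of_real t)
    = (complex_of_real t - \<i> * z) powr (- complex_of_real b)"
proof -
  define w where "w = 1 - \<i> * (z / complex_of_real t)"
  have w: "w \<noteq> 0" using shifted_rotation_notin_nonpos[of "z / complex_of_real t" 1] z t
    by (auto simp: w_def)
  have "complex_of_real t - \<i> * z = complex_of_real t * w" using t by (simp add: w_def field_simps)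
  moreover have "complex_of_real t \<noteq> 0" using t by simp
  ultimately have "(complex_of_real t - \<i> * z) powr (- complex_of_real b)
      = exp (- complex_of_real b * (complex_of_real (ln t) + Ln w))"
    using w Ln_times_of_real[OF t w] by (simp add: powr_def Ln_of_real t)
  also have "\<dots> = complex_of_real (t powr (- b)) * w powr (- complex_of_real b)"
  proof -
    have "- complex_of_real b * (complex_of_real (ln t) + Ln w)
        = complex_of_real (- b * ln t) + - complex_of_real b * Ln w" by (simp add: algebra_simps)
    then show ?thesis using w t by (simp only: exp_add exp_of_real powr_def) simp
  qed
  finally show ?thesis by (simp add: test_function_def w_def)
qed

text \<open>Mean value inequality in the shift, along the segment from 1 to \<open>t\<close>. The
  derivative has exponent \<open>- b - 1\<close>, so the difference decays one power faster than
  either term.\<close>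

lemma norm_powr_shifted_rotation_diff_le:
  assumes b: "b \<ge> 0" and t: "t > 0" and y: "y > 0"
  shows "cmod ((complex_of_real t - \<i> * Complex x y) powr (- complex_of_real b) - test_function b (Complex x y))
      \<le> b * min 1 t powr (- (b + 1)) * \<bar>t - 1\<bar>"
    and "x \<noteq> 0 \<Longrightarrow> cmod ((complex_of_real t - \<i> * Complex x y) powr (- complex_of_real b) - test_function b (Complex x y))
      \<le> b * \<bar>x\<bar> powr (- (b + 1)) * \<bar>t - 1\<bar>"
proof -
  let ?S = "closed_segment 1 (complex_of_real t)"
  have lip: "cmod ((complex_of_real t - \<i> * Complex x y) powr (- complex_of_real b) - (1 - \<i> * Complex x y) powr (- complex_of_real b))
      \<le> B * cmod (complex_of_real t - 1)"
    if B: "\<And>s. min 1 t \<le> s \<Longrightarrow> b * cmod ((complex_of_real s - \<i> * Complex x y) powr (- complex_of_real (b + 1))) \<le> B" for B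
  proof (rule field_differentiable_bound[of ?S "\<lambda>s. (s - \<i> * Complex x y) powr (- complex_of_real b)"
        "\<lambda>s. - complex_of_real b * (s - \<i> * Complex x y) powr (- complex_of_real b - 1)"])
    fix s assume "s \<in> ?S"
    then have "s \<in> closed_segment (complex_of_real 1) (complex_of_real t)" by simp
    then obtain s' where s': "s = complex_of_real s'" "s' \<in> closed_segment 1 t"
      unfolding closed_segment_of_real by auto
    then have min: "min 1 t \<le> s'" by (auto simp: closed_segment_eq_real_ivl split: if_splits)
    then have pos: "s' > 0" using t by auto
    have ns: "s - \<i> * Complex x y \<notin> \<real>\<^sub>\<le>\<^sub>0"
      using shifted_rotation_notin_nonpos[of "Complex x y" s'] y pos s' by simp
    show "((\<lambda>s. (s - \<i> * Complex x y) powr (- complex_of_real b)) has_field_derivative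
      - complex_of_real b * (s - \<i> * Complex x y) powr (- complex_of_real b - 1)) (at s within ?S)"
      by (rule has_field_derivative_at_within) (use ns in \<open>auto intro!: derivative_eq_intros\<close>)
    show "cmod (- complex_of_real b * (s - \<i> * Complex x y) powr (- complex_of_real b - 1)) \<le> B"
      using B[OF min] b s' by (simp add: norm_mult)
  qed auto
  have tm: "cmod (complex_of_real t - 1) = \<bar>t - 1\<bar>"
    by (metis norm_of_real of_real_1 of_real_diff)
  show "cmod ((complex_of_real t - \<i> * Complex x y) powr (- complex_of_real b) - test_function b (Complex x y))
      \<le> b * min 1 t powr (- (b + 1)) * \<bar>t - 1\<bar>"
    unfolding test_function_def tm[symmetric]
  proof (rule lip)
    fix s assume s: "min 1 t \<le> s"
    then have "cmod ((complex_of_real s - \<i> * Complex x y) powr (- complex_of_real (b + 1))) \<le> s powr (- (b + 1))"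
      using norm_powr_shifted_rotation_le(1)[of "b + 1" s y x] b t y by simp
    also have "\<dots> \<le> min 1 t powr (- (b + 1))" using s t b by (intro powr_mono2') auto
    finally show "b * cmod ((complex_of_real s - \<i> * Complex x y) powr (- complex_of_real (b + 1)))
      \<le> b * min 1 t powr (- (b + 1))" by (intro mult_left_mono b)
  qed
  show "cmod ((complex_of_real t - \<i> * Complex x y) powr (- complex_of_real b) - test_function b (Complex x y))
      \<le> b * \<bar>x\<bar> powr (- (b + 1)) * \<bar>t - 1\<bar>" if "x \<noteq> 0"
    unfolding test_function_def tm[symmetric]
  proof (rule lip)
    fix s assume s: "min 1 t \<le> s"
    then have "cmod ((complex_of_real s - \<i> * Complex x y) powr (- complex_of_real (b + 1))) \<le> \<bar>x\<bar> powr (- (b + 1))"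
      using norm_powr_shifted_rotation_le(2)[of "b + 1" s y x] b t y that by simp
    then show "b * cmod ((complex_of_real s - \<i> * Complex x y) powr (- complex_of_real (b + 1)))
      \<le> b * \<bar>x\<bar> powr (- (b + 1))" by (intro mult_left_mono b)
  qed
qed

text \<open>With \<open>g\<close> the dilate normalised by \<open>t powr (- \<beta>)\<close> and
  \<open>h\<close> the difference formed with \<open>t powr (- b)\<close> instead,
  \<open>g - f\<close> equals \<open>(1 - t powr (- \<epsilon>)) * g + h\<close>. The scalar is
  small with \<open>\<epsilon>\<close>, and \<open>C\<close> bounds \<open>h\<close> independently
  of \<open>\<epsilon>\<close>. The other entry of the minimum is a crude bound uniform in
  \<open>t\<close>, meant as a majorant.\<close>

lemma line_integral_test_function_dilate_diff_le:
  assumes q: "1 \<le> q" and \<alpha>: "\<alpha> > -1" and \<beta>: "\<beta> * q = 1 + \<alpha>" and \<epsilon>: "0 < \<epsilon>" "\<epsilon> \<le> 1"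
    and y: "y > 0" and t: "t > 0"
    and N: "\<And>y. y > 0 \<Longrightarrow> line_integral q \<alpha> (test_function (\<beta> + \<epsilon>)) y \<le> ennreal M" "0 \<le> M"
  defines "f \<equiv> test_function (\<beta> + \<epsilon>)"
  defines "C \<equiv> ((\<beta> + 1) * \<bar>t - 1\<bar>) powr q * (2 * (min 1 t powr (- ((\<beta> + 2) * q)) / (1 + \<alpha>) + 1 / q))"
  shows "line_integral q \<alpha> (\<lambda>z. complex_of_real (t powr (- \<beta>)) * f (z / complex_of_real t) - f z) y
    \<le> ennreal ((1 / 2) powr (1 - q) * min (2 * M) (\<bar>1 - t powr (- \<epsilon>)\<bar> powr q * M + C))"
proof -
  define b where "b = \<beta> + \<epsilon>"
  have "\<beta> * q > 0" using \<beta> \<alpha> by simp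
  then have \<beta>0: "\<beta> > 0" using q by (simp add: zero_less_mult_iff)
  have b: "b > 0" "b \<le> \<beta> + 1" using \<beta>0 \<epsilon> by (auto simp: b_def)
  have hf: "f holomorphic_on upper_half_plane" unfolding f_def by (rule holomorphic_test_function)
  define g where "g = (\<lambda>z. complex_of_real (t powr (- \<beta>)) * f (z / complex_of_real t))"
  have hg: "g holomorphic_on upper_half_plane"
    unfolding g_def by (intro holomorphic_intros holomorphic_dilate hf t)
  define h where "h = (\<lambda>z. complex_of_real (t powr (- b)) * f (z / complex_of_real t) - f z)"
  have hh: "h holomorphic_on upper_half_plane"
    unfolding h_def by (intro holomorphic_intros holomorphic_dilate hf t)
  let ?\<kappa> = "(1 / 2 :: real) powr (1 - q)"
  have gM: "line_integral q \<alpha> g y \<le> ennreal M"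
  proof -
    have "line_integral q \<alpha> g y = ennreal (t powr (- (1 + \<alpha>))) * (ennreal (t powr (1 + \<alpha>)) * line_integral q \<alpha> f (y / t))"
      unfolding g_def
      by (simp add: line_integral_cmult[OF holomorphic_dilate[OF hf t] y] line_integral_dilate[OF hf y t] powr_powr \<beta>)
    also have "\<dots> = line_integral q \<alpha> f (y / t)"
      using t by (simp add: mult.assoc[symmetric] ennreal_mult[symmetric] powr_add[symmetric])
    also have "\<dots> \<le> ennreal M" using N(1)[of "y / t"] y t by (simp add: f_def)
    finally show ?thesis .
  qed
  have fM: "line_integral q \<alpha> (\<lambda>z. - 1 * f z) y \<le> ennreal M"
    using N(1)[OF y] by (subst line_integral_cmult[OF hf y]) (simp add: f_def)
  have A: "line_integral q \<alpha> (\<lambda>z. g z - f z) y \<le> ennreal (?\<kappa> * (2 * M))"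
  proof -
    have "line_integral q \<alpha> (\<lambda>z. g z + - 1 * f z) y
      \<le> ennreal ((1 - 1 / 2) powr (1 - q)) * line_integral q \<alpha> g y + ennreal ((1 / 2) powr (1 - q)) * line_integral q \<alpha> (\<lambda>z. - 1 * f z) y"
      by (rule line_integral_add_le[OF q _ _ hg _ y]) (auto intro!: holomorphic_intros hf)
    also have "\<dots> \<le> ennreal ((1 - 1 / 2) powr (1 - q)) * ennreal M + ennreal ((1 / 2) powr (1 - q)) * ennreal M"
      by (intro add_mono mult_left_mono gM fM) auto
    also have "\<dots> = ennreal (?\<kappa> * (2 * M))"
      using N(2) by (simp add: ennreal_mult[symmetric] ennreal_plus[symmetric] del: ennreal_plus)
    finally show ?thesis by simp
  qed
  have hC: "line_integral q \<alpha> h y \<le> ennreal C"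
  proof -
    let ?D = "(b * \<bar>t - 1\<bar>) powr q"
    \<comment> \<open>The additional power of decay makes the excess exponent of \<open>h\<close> at
      least \<open>q\<close>, compared with \<open>\<epsilon> * q\<close> for \<open>f\<close>; so
      its integral stays bounded as \<open>\<epsilon>\<close> tends to 0.\<close>
    have rr: "q + \<epsilon> * q > 0" using q \<epsilon> by (simp add: add_pos_nonneg)
    have hx: "h (Complex x y) = (complex_of_real t - \<i> * Complex x y) powr (- complex_of_real b) - test_function b (Complex x y)" for x
      using test_function_dilate[of "Complex x y" t b] y t by (simp add: h_def f_def b_def)
    have "line_integral q \<alpha> h y \<le> ennreal (2 * (?D * (min 1 t powr (- (b + 1))) powr q / (1 + \<alpha>) + ?D / (q + \<epsilon> * q)))"
      unfolding line_integral_def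
    proof (rule nn_integral_power_weight_le[OF \<alpha> rr])
      fix x
      have "cmod (h (Complex x y)) powr q \<le> (b * min 1 t powr (- (b + 1)) * \<bar>t - 1\<bar>) powr q"
        using norm_powr_shifted_rotation_diff_le(1)[of b t y x] b t y q
        by (intro powr_mono2) (auto simp: hx)
      then show "cmod (h (Complex x y)) powr q \<le> ?D * (min 1 t powr (- (b + 1))) powr q"
        by (simp add: powr_mult mult_ac)
      assume x: "1 \<le> \<bar>x\<bar>"
      have "cmod (h (Complex x y)) powr q \<le> (b * \<bar>x\<bar> powr (- (b + 1)) * \<bar>t - 1\<bar>) powr q"
        using norm_powr_shifted_rotation_diff_le(2)[of b t y x] b t y q x
        by (intro powr_mono2) (auto simp: hx)
      also have "\<dots> = ?D * \<bar>x\<bar> powr (- (b + 1) * q)"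
        by (simp add: powr_mult powr_powr mult_ac)
      also have "- (b + 1) * q = - (1 + \<alpha> + (q + \<epsilon> * q))"
        using \<beta> by (simp add: b_def algebra_simps)
      finally show "cmod (h (Complex x y)) powr q \<le> ?D * \<bar>x\<bar> powr (- (1 + \<alpha> + (q + \<epsilon> * q)))" .
    qed auto
    also have "\<dots> \<le> ennreal C"
    proof (rule ennreal_leI)
      let ?E = "((\<beta> + 1) * \<bar>t - 1\<bar>) powr q"
      have DE: "?D \<le> ?E" using b q by (intro powr_mono2 mult_right_mono) auto
      \<comment> \<open>The base is at most 1, so lowering the exponent enlarges the power; this
        frees the constant from \<open>\<epsilon>\<close>.\<close>
      have m: "(min 1 t powr (- (b + 1))) powr q \<le> min 1 t powr (- ((\<beta> + 2) * q))"
      proof -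
        have "(b + 1) * q \<le> (\<beta> + 2) * q" using b q by (intro mult_right_mono) auto
        then have "- ((\<beta> + 2) * q) \<le> - (b + 1) * q" unfolding mult_minus_left by (rule le_imp_neg_le)
        then show ?thesis unfolding powr_powr using t by (intro powr_mono') auto
      qed
      have "?D * (min 1 t powr (- (b + 1))) powr q / (1 + \<alpha>) \<le> ?E * min 1 t powr (- ((\<beta> + 2) * q)) / (1 + \<alpha>)"
        using \<alpha> by (intro divide_right_mono mult_mono DE m) auto
      moreover have "?D / (q + \<epsilon> * q) \<le> ?E / q"
        using DE q \<epsilon> by (intro frac_le) auto
      ultimately show "2 * (?D * (min 1 t powr (- (b + 1))) powr q / (1 + \<alpha>) + ?D / (q + \<epsilon> * q)) \<le> C"
        unfolding C_def by (simp add: algebra_simps)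
    qed
    finally show ?thesis .
  qed
  have C0: "C \<ge> 0" using \<alpha> q by (simp add: C_def)
  have B: "line_integral q \<alpha> (\<lambda>z. g z - f z) y \<le> ennreal (?\<kappa> * (\<bar>1 - t powr (- \<epsilon>)\<bar> powr q * M + C))"
  proof -
    have "g z - f z = complex_of_real (1 - t powr (- \<epsilon>)) * g z + h z" for z
      using t by (simp add: g_def h_def b_def powr_diff powr_minus algebra_simps powr_add divide_inverse)
    then have "line_integral q \<alpha> (\<lambda>z. g z - f z) y
      = line_integral q \<alpha> (\<lambda>z. complex_of_real (1 - t powr (- \<epsilon>)) * g z + h z) y" by simp
    also have "\<dots> \<le> ennreal ((1 - 1 / 2) powr (1 - q)) * line_integral q \<alpha> (\<lambda>z. complex_of_real (1 - t powr (- \<epsilon>)) * g z) y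
        + ennreal ((1 / 2) powr (1 - q)) * line_integral q \<alpha> h y"
      by (rule line_integral_add_le[OF q _ _ _ hh y]) (auto intro!: holomorphic_intros hg)
    also have "line_integral q \<alpha> (\<lambda>z. complex_of_real (1 - t powr (- \<epsilon>)) * g z) y
      = ennreal (\<bar>1 - t powr (- \<epsilon>)\<bar> powr q) * line_integral q \<alpha> g y"
      by (subst line_integral_cmult[OF hg y]) (simp only: norm_of_real)
    also have "ennreal ((1 - 1 / 2) powr (1 - q)) * (ennreal (\<bar>1 - t powr (- \<epsilon>)\<bar> powr q) * line_integral q \<alpha> g y)
        + ennreal ((1 / 2) powr (1 - q)) * line_integral q \<alpha> h y
      \<le> ennreal ((1 - 1 / 2) powr (1 - q)) * (ennreal (\<bar>1 - t powr (- \<epsilon>)\<bar> powr q) * ennreal M)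
        + ennreal ((1 / 2) powr (1 - q)) * ennreal C"
      by (intro add_mono mult_left_mono gM hC) auto
    also have "\<dots> = ennreal (?\<kappa> * (\<bar>1 - t powr (- \<epsilon>)\<bar> powr q * M + C))"
      using N(2) C0 by (simp add: ennreal_mult[symmetric] ennreal_plus[symmetric] distrib_left del: ennreal_plus)
    finally show ?thesis .
  qed
  show ?thesis using A B by (auto simp: g_def min_def)
qed

lemma hausdorff_op_cmult: "hausdorff_op \<phi> (\<lambda>z. c * f z) z = c * hausdorff_op \<phi> f z"
  unfolding hausdorff_op_def by (simp only: mult.assoc integral_mult_right_zero)

lemma hardy_norm_le_hardy_op_norm:
  assumes p: "1 \<le> p" and bdd: "hausdorff_bounded \<phi> p \<alpha>"
    and A: "0 \<le> A" "hardy_op_norm p \<alpha> (hausdorff_op \<phi>) \<le> ennreal A"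
    and f: "f \<in> hardy_space p \<alpha>" and N: "0 < N" "hardy_norm p \<alpha> f \<le> ennreal N"
  shows "hardy_norm p \<alpha> (hausdorff_op \<phi> f) \<le> ennreal (A * N)"
proof -
  have hf: "f holomorphic_on upper_half_plane" using f by (simp add: hardy_space_def)
  define g where "g = (\<lambda>z. complex_of_real (1 / N) * f z)"
  have "hardy_norm p \<alpha> g \<le> ennreal (cmod (complex_of_real (1 / N)) * N)"
    unfolding g_def by (rule hardy_norm_cmult_le[OF p _ N(2) hf]) (use N in simp)
  then have g1: "hardy_norm p \<alpha> g \<le> 1" using N by (simp add: norm_divide)
  have hg: "g holomorphic_on upper_half_plane" unfolding g_def by (intro holomorphic_intros hf)
  have gs: "g \<in> hardy_space p \<alpha>"
    using g1 hg by (auto simp: hardy_space_def intro: le_less_trans)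
  have "hardy_norm p \<alpha> (hausdorff_op \<phi> g) \<le> hardy_op_norm p \<alpha> (hausdorff_op \<phi>)"
    unfolding hardy_op_norm_def using gs g1 by (intro SUP_upper) auto
  also note A(2)
  finally have Hg: "hardy_norm p \<alpha> (hausdorff_op \<phi> g) \<le> ennreal A" .
  have "hausdorff_op \<phi> g \<in> hardy_space p \<alpha>" using bdd gs by (auto simp: hausdorff_bounded_def)
  then have hHg: "hausdorff_op \<phi> g holomorphic_on upper_half_plane" by (simp add: hardy_space_def)
  have "f = (\<lambda>z. complex_of_real N * g z)" using N by (simp add: g_def)
  then have "hausdorff_op \<phi> f = hausdorff_op \<phi> (\<lambda>z. complex_of_real N * g z)" by (rule arg_cong)
  also have "\<dots> = (\<lambda>z. complex_of_real N * hausdorff_op \<phi> g z)" by (rule ext) (rule hausdorff_op_cmult)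
  finally have "hausdorff_op \<phi> f = (\<lambda>z. complex_of_real N * hausdorff_op \<phi> g z)" .
  then have "hardy_norm p \<alpha> (hausdorff_op \<phi> f) = hardy_norm p \<alpha> (\<lambda>z. complex_of_real N * hausdorff_op \<phi> g z)"
    by simp
  also have "\<dots> \<le> ennreal (cmod (complex_of_real N) * A)"
    by (rule hardy_norm_cmult_le[OF p A(1) Hg hHg])
  finally show ?thesis using N by (simp add: mult.commute)
qed

text \<open>Only the order \<open>1 / r\<close> of the q-th power of the norm matters. The lower
  bound makes fixed errors relatively small; the upper bound limits the growth of the norm when
  \<open>r\<close> is taken of order \<open>1 / k\<close> in the iteration.\<close>

lemma test_function_in_hardy_space:
  assumes q: "1 \<le> q" and \<alpha>: "\<alpha> > -1" and r: "r > 0" "b * q = 1 + \<alpha> + r"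
  obtains N where "test_function b \<in> hardy_space (ennreal q) \<alpha>"
    "hardy_norm (ennreal q) \<alpha> (test_function b) = ennreal N" "N > 0"
    "N powr q \<le> 2 * (1 / (1 + \<alpha>) + 1 / r)" "2 powr (- (1 + \<alpha> + 2 * r)) / r \<le> N powr q"
proof -
  define T where "T = 2 * (1 / (1 + \<alpha>) + 1 / r)"
  have T: "T \<ge> 0" using \<alpha> r by (simp add: T_def)
  have "line_integral q \<alpha> (test_function b) y \<le> ennreal ((T powr (1 / q)) powr q)" if "y > 0" for y
    using line_integral_test_function_le[OF q \<alpha> r that] q T by (simp add: powr_powr T_def)
  then have le: "hardy_norm (ennreal q) \<alpha> (test_function b) \<le> ennreal (T powr (1 / q))"
    using hardy_norm_le_iff[of q "T powr (1 / q)"] q by simp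
  then have sp: "test_function b \<in> hardy_space (ennreal q) \<alpha>"
    using holomorphic_test_function by (auto simp: hardy_space_def intro: le_less_trans)
  from hardy_spaceE[OF sp] obtain N where N: "0 \<le> N"
    "hardy_norm (ennreal q) \<alpha> (test_function b) = ennreal N" by metis
  have "N \<le> T powr (1 / q)" using le N by (simp add: ennreal_le_iff)
  then have "N powr q \<le> (T powr (1 / q)) powr q" using N q by (intro powr_mono2) auto
  then have up: "N powr q \<le> T" using q T by (simp add: powr_powr)
  have "line_integral q \<alpha> (test_function b) 1 \<le> ennreal (N powr q)"
    using hardy_norm_le_iff[of q N \<alpha> "test_function b"] N q by simp
  then have "ennreal (2 powr (- (1 + \<alpha> + 2 * r)) / r) \<le> ennreal (N powr q)"
    using line_integral_test_function_ge[OF q \<alpha> r] by (rule order_trans[rotated])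
  then have lo: "2 powr (- (1 + \<alpha> + 2 * r)) / r \<le> N powr q" by (simp add: ennreal_le_iff)
  have "2 powr (- (1 + \<alpha> + 2 * r)) / r > 0" using r by simp
  with lo have "N powr q > 0" by linarith
  then have "N > 0" using N(1) by (cases "N = 0") auto
  then show ?thesis using that sp N up lo by (auto simp: T_def)
qed

subsection \<open>The lower bound\<close>

text \<open>Since \<open>t powr (\<beta> - 1) * t powr (- \<beta>) = 1 / t\<close>, the difference
  is an average of the functions \<open>f z - t powr (- \<beta>) * f (z / t)\<close> against the
  same weight as in the upper bound, and Minkowski's inequality applies again.\<close>

lemma line_integral_hausdorff_diff_le:
  fixes f :: "complex \<Rightarrow> complex"
  assumes q: "1 \<le> q" and \<phi>: "\<phi> \<in> borel_measurable (lebesgue_on {0<..})"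
    and K: "0 < K" "(\<integral>\<^sup>+t. ennreal (t powr (\<beta> - 1) * cmod (\<phi> t)) \<partial>lebesgue_on {0<..}) \<le> ennreal K"
    and f: "f holomorphic_on upper_half_plane" "hausdorff_well_defined \<phi> f" and y: "y > 0"
  defines "I \<equiv> LINT t|lebesgue_on {0<..}. complex_of_real (t powr (\<beta> - 1)) * \<phi> t"
  shows "line_integral q \<alpha> (\<lambda>z. I * f z - hausdorff_op \<phi> f z) y
    \<le> ennreal (K powr (q - 1)) * (\<integral>\<^sup>+t. line_integral q \<alpha>
        (\<lambda>z. complex_of_real (t powr (- \<beta>)) * f (z / complex_of_real t) - f z) y
        * ennreal (t powr (\<beta> - 1) * cmod (\<phi> t)) \<partial>lebesgue_on {0<..})"
  unfolding line_integral_def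
proof (rule nn_integral_minkowski[OF q K])
  note [measurable] = \<phi> borel_measurable_id_lebesgue_on[of "{0<..}"]
    measurable_dilates_pair[OF f(1) y] borel_measurable_on_line[OF f(1) y]
  show "(\<lambda>t. t powr (\<beta> - 1) * cmod (\<phi> t)) \<in> borel_measurable (lebesgue_on {0<..})" by measurable
  show "(\<lambda>(x, t). cmod (complex_of_real (t powr (- \<beta>)) * f (Complex x y / complex_of_real t) - f (Complex x y)))
    \<in> borel_measurable (lborel \<Otimes>\<^sub>M lebesgue_on {0<..})" by measurable
  fix x
  let ?z = "Complex x y" and ?M = "lebesgue_on {0::real<..}"
  have int1: "integrable ?M (\<lambda>t. complex_of_real (t powr (\<beta> - 1)) * \<phi> t)"
    unfolding integrable_iff_bounded
    using K(2) by (auto simp: norm_mult intro: le_less_trans)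
  have int2: "integrable ?M (\<lambda>t. f (?z / complex_of_real t) * (\<phi> t / complex_of_real t))"
    using f(2) y by (simp add: hausdorff_well_defined_def)
  have int: "integrable ?M (\<lambda>t. complex_of_real (t powr (\<beta> - 1)) * \<phi> t * f ?z - f (?z / complex_of_real t) * (\<phi> t / complex_of_real t))"
    by (intro Bochner_Integration.integrable_diff integrable_mult_left int1 int2)
  have "I * f ?z - hausdorff_op \<phi> f ?z
    = (LINT t|?M. complex_of_real (t powr (\<beta> - 1)) * \<phi> t * f ?z - f (?z / complex_of_real t) * (\<phi> t / complex_of_real t))"
    unfolding I_def hausdorff_op_def
    by (subst Bochner_Integration.integral_diff[OF integrable_mult_left[OF int1] int2]) simp
  also have "ennreal (cmod \<dots>) \<le> (\<integral>\<^sup>+t. ennreal (cmod (complex_of_real (t powr (\<beta> - 1)) * \<phi> t * f ?z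
      - f (?z / complex_of_real t) * (\<phi> t / complex_of_real t))) \<partial>?M)"
    by (rule integral_norm_bound_ennreal[OF int])
  also have "\<dots> = (\<integral>\<^sup>+t. ennreal (cmod (complex_of_real (t powr (- \<beta>)) * f (?z / complex_of_real t) - f ?z)
        * (t powr (\<beta> - 1) * cmod (\<phi> t))) \<partial>?M)"
  proof (rule nn_integral_cong)
    fix t :: real assume "t \<in> space ?M"
    then have t: "t > 0" by simp
    have "t powr (\<beta> - 1) * t powr (- \<beta>) = 1 / t"
      using t by (simp add: powr_minus_divide powr_diff)
    then have "complex_of_real (t powr (\<beta> - 1)) * complex_of_real (t powr (- \<beta>)) = 1 / complex_of_real t"
      by (simp flip: of_real_mult)
    moreover have "(d * u - v) * (e * w) = (e * d) * (u * w) - e * w * v" for d e u v w :: complex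
      by (simp add: algebra_simps)
    ultimately have "(complex_of_real (t powr (- \<beta>)) * f (?z / complex_of_real t) - f ?z) * (complex_of_real (t powr (\<beta> - 1)) * \<phi> t)
      = - (complex_of_real (t powr (\<beta> - 1)) * \<phi> t * f ?z - f (?z / complex_of_real t) * (\<phi> t / complex_of_real t))"
      by simp
    then have "cmod (complex_of_real (t powr (\<beta> - 1)) * \<phi> t * f ?z - f (?z / complex_of_real t) * (\<phi> t / complex_of_real t))
      = cmod ((complex_of_real (t powr (- \<beta>)) * f (?z / complex_of_real t) - f ?z) * (complex_of_real (t powr (\<beta> - 1)) * \<phi> t))"
      by (metis norm_minus_cancel)
    then show "ennreal (cmod (complex_of_real (t powr (\<beta> - 1)) * \<phi> t * f ?z - f (?z / complex_of_real t) * (\<phi> t / complex_of_real t)))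
      = ennreal (cmod (complex_of_real (t powr (- \<beta>)) * f (?z / complex_of_real t) - f ?z) * (t powr (\<beta> - 1) * cmod (\<phi> t)))"
      by (simp add: norm_mult)
  qed
  finally show "ennreal (cmod (I * f ?z - hausdorff_op \<phi> f ?z))
    \<le> (\<integral>\<^sup>+t. ennreal (cmod (complex_of_real (t powr (- \<beta>)) * f (?z / complex_of_real t) - f ?z)
        * (t powr (\<beta> - 1) * cmod (\<phi> t))) \<partial>?M)" .
qed auto

text \<open>The functions \<open>test_function (\<beta> + \<epsilon>)\<close> are approximate eigenfunctions of the Hausdorff
  operator as \<open>\<epsilon>\<close> tends to 0: their norms blow up, while their dilates differ from multiples of
  them by a bounded amount.\<close>

lemma hardy_op_norm_hausdorff_ge_finite:
  assumes q: "1 \<le> q" and \<alpha>: "\<alpha> > -1" and \<phi>: "\<phi> \<in> borel_measurable (lebesgue_on {0<..})"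
    and fin: "(\<integral>\<^sup>+t. ennreal (t powr (hardy_exponent (ennreal q) \<alpha> - 1) * cmod (\<phi> t)) \<partial>lebesgue_on {0<..}) < \<infinity>"
  shows "ennreal (cmod (LINT t|lebesgue_on {0<..}. complex_of_real (t powr (hardy_exponent (ennreal q) \<alpha> - 1)) * \<phi> t))
    \<le> hardy_op_norm (ennreal q) \<alpha> (hausdorff_op \<phi>)"
proof -
  define p where "p = ennreal q"
  have p: "1 \<le> p" using q by (simp add: p_def)
  define \<beta> where "\<beta> = hardy_exponent p \<alpha>"
  have \<beta>q: "\<beta> * q = 1 + \<alpha>" using q by (simp add: \<beta>_def p_def hardy_exponent_def)
  define c where "c = (\<lambda>t. t powr (\<beta> - 1) * cmod (\<phi> t))"
  define I where "I = (LINT t|lebesgue_on {0<..}. complex_of_real (t powr (\<beta> - 1)) * \<phi> t)"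
  note [measurable] = \<phi> borel_measurable_id_lebesgue_on[of "{0<..}"]
  have [measurable]: "c \<in> borel_measurable (lebesgue_on {0<..})" by (simp add: c_def)
  have c0: "c t \<ge> 0" for t by (simp add: c_def)
  have cfin: "(\<integral>\<^sup>+t. ennreal (c t) \<partial>lebesgue_on {0<..}) < \<infinity>" using fin by (simp add: c_def \<beta>_def p_def)
  then obtain k where k: "k \<ge> 0" "(\<integral>\<^sup>+t. ennreal (c t) \<partial>lebesgue_on {0<..}) = ennreal k"
    by (cases "\<integral>\<^sup>+t. ennreal (c t) \<partial>lebesgue_on {0<..}") auto
  define K where "K = k + 1"
  have K: "0 < K" "(\<integral>\<^sup>+t. ennreal (c t) \<partial>lebesgue_on {0<..}) \<le> ennreal K"
    using k by (auto simp: K_def simp del: ennreal_plus intro!: ennreal_leI)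
  have fin': "(\<integral>\<^sup>+t. ennreal (t powr (hardy_exponent p \<alpha> - 1) * cmod (\<phi> t)) \<partial>lebesgue_on {0<..}) < \<infinity>"
    using fin by (simp add: p_def)
  have bdd: "hausdorff_bounded \<phi> p \<alpha>" by (rule hausdorff_boundedI[OF p \<phi> fin'])
  then obtain A where A: "A \<ge> 0" "hardy_op_norm p \<alpha> (hausdorff_op \<phi>) = ennreal A"
    unfolding hausdorff_bounded_def by (cases "hardy_op_norm p \<alpha> (hausdorff_op \<phi>)") auto
  define \<epsilon> where "\<epsilon> = (\<lambda>n::nat. 1 / real (Suc n))"
  have \<epsilon>: "0 < \<epsilon> n" "\<epsilon> n \<le> 1" for n by (auto simp: \<epsilon>_def)
  have \<epsilon>lim: "\<epsilon> \<longlonglongrightarrow> 0" unfolding \<epsilon>_def using LIMSEQ_inverse_real_of_nat by (simp add: inverse_eq_divide)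
  define f where "f = (\<lambda>n. test_function (\<beta> + \<epsilon> n))"
  have "\<exists>N. f n \<in> hardy_space p \<alpha> \<and> hardy_norm p \<alpha> (f n) = ennreal N \<and> N > 0
      \<and> 2 powr (- (1 + \<alpha> + 2 * (\<epsilon> n * q))) / (\<epsilon> n * q) \<le> N powr q" for n
  proof -
    have r: "\<epsilon> n * q > 0" "(\<beta> + \<epsilon> n) * q = 1 + \<alpha> + \<epsilon> n * q"
      using \<epsilon>[of n] q \<beta>q by (auto simp: algebra_simps)
    from test_function_in_hardy_space[OF q \<alpha> r] show ?thesis unfolding f_def p_def by metis
  qed
  then obtain N where fs: "\<And>n. f n \<in> hardy_space p \<alpha>" and fN: "\<And>n. hardy_norm p \<alpha> (f n) = ennreal (N n)"
    and N0: "\<And>n. N n > 0" and Nge: "\<And>n. 2 powr (- (1 + \<alpha> + 2 * (\<epsilon> n * q))) / (\<epsilon> n * q) \<le> N n powr q"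
    by metis
  define M where "M = (\<lambda>n. N n powr q)"
  have M0: "M n > 0" for n using N0[of n] by (simp add: M_def)
  have hf: "f n holomorphic_on upper_half_plane" for n using fs[of n] by (simp add: hardy_space_def)
  have fM: "line_integral q \<alpha> (f n) y \<le> ennreal (M n)" if "y > 0" for n y
    using hardy_norm_le_iff[of q "N n" \<alpha> "f n"] fN[of n] N0[of n] q that by (simp add: M_def p_def)
  \<comment> \<open>The q-th powers of the norms are at least of order
    \<open>1 / \<epsilon> n\<close>, so an error independent of \<open>n\<close> is negligible
    relative to them.\<close>
  have iM: "(\<lambda>n. 1 / M n) \<longlonglongrightarrow> 0"
  proof (rule tendsto_sandwich[OF _ _ tendsto_const])
    define L where "L = 2 powr (1 + \<alpha> + 2 * q) * q"
    show "(\<lambda>n. \<epsilon> n * L) \<longlonglongrightarrow> 0" using tendsto_mult_left_zero[OF \<epsilon>lim] .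
    show "\<forall>\<^sub>F n in sequentially. 0 \<le> 1 / M n" using M0 by (auto intro!: always_eventually less_imp_le)
    show "\<forall>\<^sub>F n in sequentially. 1 / M n \<le> \<epsilon> n * L"
    proof (intro always_eventually allI)
      fix n
      have "\<epsilon> n * q \<le> 1 * q" using \<epsilon>[of n] q by (intro mult_right_mono) auto
      then have "2 powr (- (1 + \<alpha> + 2 * q)) \<le> (2::real) powr (- (1 + \<alpha> + 2 * (\<epsilon> n * q)))"
        by (intro powr_mono) auto
      then have "2 powr (- (1 + \<alpha> + 2 * q)) / (\<epsilon> n * q) \<le> 2 powr (- (1 + \<alpha> + 2 * (\<epsilon> n * q))) / (\<epsilon> n * q)"
        using \<epsilon>[of n] q by (intro divide_right_mono) auto
      then have "2 powr (- (1 + \<alpha> + 2 * q)) / (\<epsilon> n * q) \<le> M n" using Nge[of n] unfolding M_def by linarith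
      moreover have "2 powr (- (1 + \<alpha> + 2 * q)) / (\<epsilon> n * q) = 1 / (\<epsilon> n * L)"
        unfolding L_def by (subst powr_minus_divide) simp
      ultimately have "1 / (\<epsilon> n * L) \<le> M n" by simp
      moreover have "\<epsilon> n * L > 0" using \<epsilon>[of n] q by (simp add: L_def)
      ultimately show "1 / M n \<le> \<epsilon> n * L" using M0[of n] by (simp add: field_simps)
    qed
  qed
  define \<kappa> where "\<kappa> = (1 / 2 :: real) powr (1 - q)"
  define C where "C = (\<lambda>t::real. ((\<beta> + 1) * \<bar>t - 1\<bar>) powr q
    * (2 * (min 1 t powr (- ((\<beta> + 2) * q)) / (1 + \<alpha>) + 1 / q)))"
  have C0: "C t \<ge> 0" for t using \<alpha> q by (simp add: C_def)
  \<comment> \<open>The bound for the dilate difference, divided by \<open>M n\<close>: it is at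
    most \<open>2 * \<kappa>\<close> for all \<open>t\<close>, which provides a majorant, and tends
    to 0 for each fixed \<open>t\<close>.\<close>
  define b where "b = (\<lambda>n t. \<kappa> * min 2 (\<bar>1 - t powr (- \<epsilon> n)\<bar> powr q + C t * (1 / M n)))"
  have b0: "b n t \<ge> 0" for n t using C0[of t] M0[of n] by (simp add: b_def \<kappa>_def)
  have [measurable]: "b n \<in> borel_measurable (lebesgue_on {0<..})" for n
    unfolding b_def C_def by measurable
  define B where "B = (\<lambda>n. \<integral>\<^sup>+t. ennreal (b n t) * ennreal (c t) \<partial>lebesgue_on {0<..})"
  have Blim: "B \<longlonglongrightarrow> 0"
  proof -
    have "(\<lambda>n. \<integral>\<^sup>+t. ennreal (b n t) * ennreal (c t) \<partial>lebesgue_on {0<..}) \<longlonglongrightarrow> (\<integral>\<^sup>+t. 0 \<partial>lebesgue_on {0::real<..})"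
    proof (rule nn_integral_dominated_convergence[where w = "\<lambda>t. ennreal (\<kappa> * 2) * ennreal (c t)"])
      show "AE t in lebesgue_on {0<..}. ennreal (b n t) * ennreal (c t) \<le> ennreal (\<kappa> * 2) * ennreal (c t)" for n
        by (intro AE_I2 mult_right_mono ennreal_leI) (auto simp: b_def \<kappa>_def)
      show "(\<integral>\<^sup>+t. ennreal (\<kappa> * 2) * ennreal (c t) \<partial>lebesgue_on {0<..}) < \<infinity>"
        using cfin by (subst nn_integral_cmult) (auto simp: ennreal_mult_less_top)
      show "AE t in lebesgue_on {0<..}. (\<lambda>n. ennreal (b n t) * ennreal (c t)) \<longlonglongrightarrow> 0"
      proof (rule AE_I2)
        fix t :: real assume "t \<in> space (lebesgue_on {0<..})"
        then have t: "t > 0" by simp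
        have "(\<lambda>n. t powr (- \<epsilon> n)) \<longlonglongrightarrow> t powr (- 0)"
          using t by (intro tendsto_intros \<epsilon>lim) auto
        then have "(\<lambda>n. \<bar>1 - t powr (- \<epsilon> n)\<bar>) \<longlonglongrightarrow> \<bar>1 - 1\<bar>"
          using t by (intro tendsto_intros) auto
        then have l1: "(\<lambda>n. \<bar>1 - t powr (- \<epsilon> n)\<bar> powr q) \<longlonglongrightarrow> 0"
          using q tendsto_zero_powrI[of "\<lambda>n. \<bar>1 - t powr (- \<epsilon> n)\<bar>" sequentially "\<lambda>_. q" q] by simp
        have l2: "(\<lambda>n. \<bar>1 - t powr (- \<epsilon> n)\<bar> powr q + C t * (1 / M n)) \<longlonglongrightarrow> 0 + C t * 0"
          by (intro tendsto_intros l1 iM)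
        have "(\<lambda>n. b n t) \<longlonglongrightarrow> \<kappa> * min 2 (0 + C t * 0)"
          unfolding b_def by (intro tendsto_mult tendsto_min tendsto_const l2)
        then have "(\<lambda>n. b n t * c t) \<longlonglongrightarrow> 0" by (intro tendsto_mult_left_zero) simp
        then have "(\<lambda>n. ennreal (b n t * c t)) \<longlonglongrightarrow> ennreal 0" by (intro tendsto_ennrealI)
        then show "(\<lambda>n. ennreal (b n t) * ennreal (c t)) \<longlonglongrightarrow> 0"
          using b0 c0 by (simp add: ennreal_mult)
      qed
    qed measurable
    then show ?thesis by (simp add: B_def[abs_def])
  qed
  have Bfin: "B n < \<infinity>" for n
  proof -
    have "B n \<le> (\<integral>\<^sup>+t. ennreal (\<kappa> * 2) * ennreal (c t) \<partial>lebesgue_on {0<..})"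
      unfolding B_def by (intro nn_integral_mono mult_right_mono ennreal_leI) (auto simp: b_def \<kappa>_def)
    also have "\<dots> < \<infinity>" using cfin by (subst nn_integral_cmult) (auto simp: ennreal_mult_less_top)
    finally show ?thesis .
  qed
  define B' where "B' = (\<lambda>n. enn2real (B n))"
  have B': "B n = ennreal (B' n)" "B' n \<ge> 0" for n using Bfin[of n] by (auto simp: B'_def)
  have B'lim: "B' \<longlonglongrightarrow> 0"
    using Blim B'(2) unfolding B'(1)[abs_def] by (simp add: tendsto_ennreal_iff flip: ennreal_0)
  have D: "line_integral q \<alpha> (\<lambda>z. I * f n z - hausdorff_op \<phi> (f n) z) y \<le> ennreal (K powr (q - 1) * M n * B' n)"
    if y: "y > 0" for n y
  proof -
    have wd: "hausdorff_well_defined \<phi> (f n)" using bdd fs by (auto simp: hausdorff_bounded_def)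
    have "line_integral q \<alpha> (\<lambda>z. I * f n z - hausdorff_op \<phi> (f n) z) y
      \<le> ennreal (K powr (q - 1)) * (\<integral>\<^sup>+t. line_integral q \<alpha>
        (\<lambda>z. complex_of_real (t powr (- \<beta>)) * f n (z / complex_of_real t) - f n z) y * ennreal (c t) \<partial>lebesgue_on {0<..})"
      unfolding I_def c_def
      by (rule line_integral_hausdorff_diff_le[OF q \<phi> K(1) K(2)[unfolded c_def] hf wd y])
    also have "\<dots> \<le> ennreal (K powr (q - 1)) * (\<integral>\<^sup>+t. ennreal (M n) * (ennreal (b n t) * ennreal (c t)) \<partial>lebesgue_on {0<..})"
    proof (intro mult_left_mono nn_integral_mono)
      fix t :: real assume "t \<in> space (lebesgue_on {0<..})"
      then have t: "t > 0" by simp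
      have "line_integral q \<alpha> (\<lambda>z. complex_of_real (t powr (- \<beta>)) * f n (z / complex_of_real t) - f n z) y
        \<le> ennreal (\<kappa> * min (2 * M n) (\<bar>1 - t powr (- \<epsilon> n)\<bar> powr q * M n + C t))"
        unfolding f_def \<kappa>_def C_def
        by (rule line_integral_test_function_dilate_diff_le[OF q \<alpha> \<beta>q \<epsilon> y t])
          (use fM M0[of n] in \<open>auto simp: f_def\<close>)
      also have "\<kappa> * min (2 * M n) (\<bar>1 - t powr (- \<epsilon> n)\<bar> powr q * M n + C t) = M n * b n t"
      proof -
        have "M n * min 2 (\<bar>1 - t powr (- \<epsilon> n)\<bar> powr q + C t * (1 / M n))
          = min (M n * 2) (M n * (\<bar>1 - t powr (- \<epsilon> n)\<bar> powr q + C t * (1 / M n)))"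
          using M0[of n] by (simp add: min_mult_distrib_left)
        also have "\<dots> = min (2 * M n) (\<bar>1 - t powr (- \<epsilon> n)\<bar> powr q * M n + C t)"
        proof -
          have e: "M n * (\<bar>1 - t powr (- \<epsilon> n)\<bar> powr q + C t * (1 / M n)) = \<bar>1 - t powr (- \<epsilon> n)\<bar> powr q * M n + C t"
            using M0[of n] by (simp add: distrib_left)
          show ?thesis by (simp only: e mult.commute[of "M n" 2])
        qed
        finally show ?thesis by (simp add: b_def)
      qed
      finally have "line_integral q \<alpha> (\<lambda>z. complex_of_real (t powr (- \<beta>)) * f n (z / complex_of_real t) - f n z) y * ennreal (c t)
        \<le> ennreal (M n * b n t) * ennreal (c t)" by (rule mult_right_mono) simp
      then show "line_integral q \<alpha> (\<lambda>z. complex_of_real (t powr (- \<beta>)) * f n (z / complex_of_real t) - f n z) y * ennreal (c t)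
        \<le> ennreal (M n) * (ennreal (b n t) * ennreal (c t))"
        using M0[of n] b0 by (simp add: ennreal_mult mult.assoc)
    qed auto
    also have "(\<integral>\<^sup>+t. ennreal (M n) * (ennreal (b n t) * ennreal (c t)) \<partial>lebesgue_on {0<..}) = ennreal (M n) * B n"
      unfolding B_def by (rule nn_integral_cmult) measurable
    also have "ennreal (K powr (q - 1)) * (ennreal (M n) * B n) = ennreal (K powr (q - 1) * M n * B' n)"
      using M0[of n] B'(2)[of n] by (simp add: B'(1) ennreal_mult[symmetric] mult.assoc)
    finally show ?thesis .
  qed
  \<comment> \<open>\<open>I * f n\<close> is split into the transform of \<open>f n\<close> and the
    error term. Both are bounded by multiples of \<open>M n\<close>, and so is the left-hand side,
    so \<open>M n\<close> cancels.\<close>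
  have key: "cmod I powr q \<le> (1 - l) powr (1 - q) * A powr q + l powr (1 - q) * (K powr (q - 1) * B' n)"
    if l: "0 < l" "l < 1" for l n
  proof -
    define X where "X = (1 - l) powr (1 - q) * A powr q + l powr (1 - q) * (K powr (q - 1) * B' n)"
    have X0: "X \<ge> 0" using B'(2)[of n] by (simp add: X_def)
    have Hf: "hausdorff_op \<phi> (f n) \<in> hardy_space p \<alpha>" using bdd fs by (auto simp: hausdorff_bounded_def)
    then have hH: "hausdorff_op \<phi> (f n) holomorphic_on upper_half_plane" by (simp add: hardy_space_def)
    have HA: "hardy_norm p \<alpha> (hausdorff_op \<phi> (f n)) \<le> ennreal (A * N n)"
      by (rule hardy_norm_le_hardy_op_norm[OF p bdd A(1) _ fs N0]) (use A fN in auto)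
    have "line_integral q \<alpha> (\<lambda>z. I * f n z) y \<le> ennreal (((X * M n) powr (1 / q)) powr q)" if y: "y > 0" for y
    proof -
      have HAy: "line_integral q \<alpha> (hausdorff_op \<phi> (f n)) y \<le> ennreal (A powr q * M n)"
        using hardy_norm_le_iff[of q "A * N n" \<alpha> "hausdorff_op \<phi> (f n)"] HA A(1) N0[of n] q y
        by (simp add: M_def p_def powr_mult)
      have "line_integral q \<alpha> (\<lambda>z. I * f n z) y
        = line_integral q \<alpha> (\<lambda>z. hausdorff_op \<phi> (f n) z + (I * f n z - hausdorff_op \<phi> (f n) z)) y"
        by simp
      also have "\<dots> \<le> ennreal ((1 - l) powr (1 - q)) * line_integral q \<alpha> (hausdorff_op \<phi> (f n)) y
        + ennreal (l powr (1 - q)) * line_integral q \<alpha> (\<lambda>z. I * f n z - hausdorff_op \<phi> (f n) z) y"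
        by (rule line_integral_add_le[OF q l hH _ y]) (intro holomorphic_intros hf hH)
      also have "\<dots> \<le> ennreal ((1 - l) powr (1 - q)) * ennreal (A powr q * M n)
        + ennreal (l powr (1 - q)) * ennreal (K powr (q - 1) * M n * B' n)"
        by (intro add_mono mult_left_mono HAy D y) auto
      also have "\<dots> = ennreal (X * M n)"
        using M0[of n] B'(2)[of n]
        by (simp add: X_def ennreal_mult[symmetric] ennreal_plus[symmetric] algebra_simps del: ennreal_plus)
      also have "X * M n = ((X * M n) powr (1 / q)) powr q"
        using X0 M0[of n] q by (simp add: powr_powr)
      finally show ?thesis .
    qed
    then have If: "hardy_norm p \<alpha> (\<lambda>z. I * f n z) \<le> ennreal ((X * M n) powr (1 / q))"
      using hardy_norm_le_iff[of q "(X * M n) powr (1 / q)" \<alpha> "\<lambda>z. I * f n z"] q by (simp add: p_def)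
    show ?thesis
    proof (cases "I = 0")
      case False
      \<comment> \<open>Homogeneity is at hand as an upper bound; used with the factor
        \<open>1 / I\<close> it yields the lower bound for the norm of
        \<open>I * f n\<close>.\<close>
      have "hardy_norm p \<alpha> (\<lambda>z. (1 / I) * (I * f n z)) \<le> ennreal (cmod (1 / I) * (X * M n) powr (1 / q))"
        by (rule hardy_norm_cmult_le[OF p _ If]) (auto intro!: holomorphic_intros hf)
      then have "N n \<le> cmod (1 / I) * (X * M n) powr (1 / q)"
        using False fN[of n] N0[of n] by (simp add: ennreal_le_iff)
      then have "cmod I * N n \<le> (X * M n) powr (1 / q)"
        using False by (simp add: norm_divide field_simps)
      then have "(cmod I * N n) powr q \<le> ((X * M n) powr (1 / q)) powr q"
        using N0[of n] q by (intro powr_mono2) auto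
      then have "cmod I powr q * M n \<le> X * M n"
        using X0 M0[of n] N0[of n] q by (simp add: powr_powr powr_mult M_def)
      then show ?thesis using M0[of n] by (simp add: X_def)
    qed (use X0 in \<open>simp add: X_def\<close>)
  qed
  \<comment> \<open>The limit in \<open>n\<close> is taken with \<open>l\<close> fixed, because the
    factor of the error may be unbounded as \<open>l\<close> tends to 0.\<close>
  have key2: "cmod I powr q \<le> (1 - l) powr (1 - q) * A powr q" if l: "0 < l" "l < 1" for l
  proof -
    have "(\<lambda>n. (1 - l) powr (1 - q) * A powr q + l powr (1 - q) * (K powr (q - 1) * B' n))
      \<longlonglongrightarrow> (1 - l) powr (1 - q) * A powr q + l powr (1 - q) * (K powr (q - 1) * 0)"
      by (intro tendsto_intros B'lim)
    from tendsto_lowerbound[OF this always_eventually, of "cmod I powr q"] key[OF l] show ?thesis by simp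
  qed
  \<comment> \<open>Now \<open>l\<close> tends to 0 along \<open>\<epsilon> (Suc n)\<close>; the
    index is shifted because \<open>\<epsilon> 0 = 1\<close> violates \<open>l < 1\<close>.\<close>
  have "cmod I powr q \<le> (1 - 0) powr (1 - q) * A powr q"
  proof (rule tendsto_lowerbound[of "\<lambda>n. (1 - \<epsilon> (Suc n)) powr (1 - q) * A powr q" _ sequentially])
    show "(\<lambda>n. (1 - \<epsilon> (Suc n)) powr (1 - q) * A powr q) \<longlonglongrightarrow> (1 - 0) powr (1 - q) * A powr q"
      by (intro tendsto_intros LIMSEQ_Suc[OF \<epsilon>lim]) auto
    show "\<forall>\<^sub>F n in sequentially. cmod I powr q \<le> (1 - \<epsilon> (Suc n)) powr (1 - q) * A powr q"
      by (intro always_eventually allI key2) (auto simp: \<epsilon>_def)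
  qed simp
  then have "cmod I powr q \<le> A powr q" by simp
  then have "cmod I \<le> A" using powr_less_mono2[of q A "cmod I"] q A(1) by force
  then show ?thesis using A by (simp add: I_def \<beta>_def p_def ennreal_leI)
qed

text \<open>For infinite exponent the constant 1 has norm 1 and its transform is the constant in
  question, so evaluation at \<open>\<i>\<close> suffices.\<close>

lemma hardy_op_norm_hausdorff_ge:
  assumes p: "1 \<le> p" and \<alpha>: "\<alpha> > -1" and \<phi>: "\<phi> \<in> borel_measurable (lebesgue_on {0<..})"
    and fin: "(\<integral>\<^sup>+t. ennreal (t powr (hardy_exponent p \<alpha> - 1) * cmod (\<phi> t)) \<partial>lebesgue_on {0<..}) < \<infinity>"
  shows "ennreal (cmod (LINT t|lebesgue_on {0<..}. complex_of_real (t powr (hardy_exponent p \<alpha> - 1)) * \<phi> t))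
    \<le> hardy_op_norm p \<alpha> (hausdorff_op \<phi>)"
proof (cases p)
  case (real q)
  then show ?thesis using hardy_op_norm_hausdorff_ge_finite[of q \<alpha> \<phi>] assms by simp
next
  case top
  define one where "one = (\<lambda>z::complex. 1::complex)"
  have n1: "hardy_norm p \<alpha> one \<le> 1"
    using hardy_norm_infinity_le_iff[of 1 \<alpha> one] top by (simp add: one_def)
  then have "one \<in> hardy_space p \<alpha>" by (auto simp: hardy_space_def one_def intro: le_less_trans)
  then have "hardy_norm p \<alpha> (hausdorff_op \<phi> one) \<le> hardy_op_norm p \<alpha> (hausdorff_op \<phi>)"
    using n1 unfolding hardy_op_norm_def by (intro SUP_upper) auto
  moreover have "ennreal (cmod (hausdorff_op \<phi> one \<i>)) \<le> hardy_norm p \<alpha> (hausdorff_op \<phi> one)"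
    using top by (auto simp: hardy_norm_def upper_half_plane_def intro!: SUP_upper)
  moreover have "hausdorff_op \<phi> one \<i> = (LINT t|lebesgue_on {0<..}. complex_of_real (t powr (hardy_exponent p \<alpha> - 1)) * \<phi> t)"
    unfolding hausdorff_op_def
    by (rule Bochner_Integration.integral_cong)
      (auto simp: one_def top hardy_exponent_def powr_minus divide_inverse mult.commute)
  ultimately show ?thesis by simp
qed

subsection \<open>Necessity for nonnegative kernels\<close>

text \<open>Dilations preserve the imaginary axis, so the integrand there is real and nonnegative.
  Rewriting the value as a nonnegative integral allows it to be bounded below by restricting the
  range of \<open>t\<close>.\<close>

lemma hausdorff_op_imaginary_axis:
  assumes \<phi>: "\<And>t. t > 0 \<Longrightarrow> \<phi> t \<in> \<real>\<^sub>\<ge>\<^sub>0" and wd: "hausdorff_well_defined \<phi> f"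
    and f: "\<And>y. y > 0 \<Longrightarrow> f (Complex 0 y) \<in> \<real>\<^sub>\<ge>\<^sub>0" and y: "y > 0"
  shows "hausdorff_op \<phi> f (Complex 0 y) \<in> \<real>\<^sub>\<ge>\<^sub>0"
    and "ennreal (Re (hausdorff_op \<phi> f (Complex 0 y)))
      = (\<integral>\<^sup>+t. ennreal (Re (f (Complex 0 (y / t))) * (cmod (\<phi> t) / t)) \<partial>lebesgue_on {0<..})"
proof -
  let ?M = "lebesgue_on {0::real<..}"
  define r where "r = (\<lambda>t. Re (f (Complex 0 (y / t))) * (cmod (\<phi> t) / t))"
  have r: "f (Complex 0 y / complex_of_real t) * (\<phi> t / complex_of_real t) = complex_of_real (r t)" "r t \<ge> 0"
    if t: "t > 0" for t
  proof -
    have z: "Complex 0 y / complex_of_real t = Complex 0 (y / t)" using t by (simp add: complex_eq_iff)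
    from \<phi>[OF t] obtain a where a: "\<phi> t = complex_of_real a" "a \<ge> 0" by (auto elim: nonneg_Reals_cases)
    from f[of "y / t"] t y obtain b where b: "f (Complex 0 (y / t)) = complex_of_real b" "b \<ge> 0"
      by (auto elim: nonneg_Reals_cases)
    show "f (Complex 0 y / complex_of_real t) * (\<phi> t / complex_of_real t) = complex_of_real (r t)" "r t \<ge> 0"
      using a b t by (simp_all add: r_def z)
  qed
  have "integrable ?M (\<lambda>t. f (Complex 0 y / complex_of_real t) * (\<phi> t / complex_of_real t))"
    using wd y by (simp add: hausdorff_well_defined_def)
  then have "integrable ?M (\<lambda>t. complex_of_real (r t))"
    by (rule Bochner_Integration.integrable_cong[THEN iffD1, rotated 2]) (simp_all add: r del: times_divide_eq_right)
  then have ri: "integrable ?M r" using integrable_Re by fastforce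
  have "hausdorff_op \<phi> f (Complex 0 y) = (LINT t|?M. complex_of_real (r t))"
    unfolding hausdorff_op_def
    by (rule Bochner_Integration.integral_cong) (simp_all add: r del: times_divide_eq_right)
  then have H: "hausdorff_op \<phi> f (Complex 0 y) = complex_of_real (LINT t|?M. r t)" by simp
  have r0: "AE t in ?M. 0 \<le> r t" by (rule AE_I2) (simp add: r)
  then have "(LINT t|?M. r t) \<ge> 0" by (rule integral_nonneg_AE)
  then show "hausdorff_op \<phi> f (Complex 0 y) \<in> \<real>\<^sub>\<ge>\<^sub>0" by (simp add: H)
  show "ennreal (Re (hausdorff_op \<phi> f (Complex 0 y)))
      = (\<integral>\<^sup>+t. ennreal (Re (f (Complex 0 (y / t))) * (cmod (\<phi> t) / t)) \<partial>?M)"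
    using nn_integral_eq_integral[OF ri r0] by (simp add: H r_def)
qed

text \<open>A base above 1 would outgrow every linear function of \<open>k\<close>. This is what
  discards the constants lost in passing between values and norms.\<close>

lemma le_one_if_powers_linearly_bounded:
  fixes x a d :: real
  assumes "\<And>k::nat. k \<ge> 1 \<Longrightarrow> x ^ k \<le> a + d * real k"
  shows "x \<le> 1"
proof (rule ccontr)
  assume "\<not> x \<le> 1"
  then have x: "x > 1" by simp
  then have n: "norm (1 / x) < 1" by simp
  have "(\<lambda>k. a * (1 / x) ^ k + d * (real k * (1 / x) ^ k)) \<longlonglongrightarrow> a * 0 + d * 0"
    by (intro tendsto_intros LIMSEQ_power_zero powser_times_n_limit_0 n)
  moreover have "\<forall>\<^sub>F k in sequentially. 1 \<le> a * (1 / x) ^ k + d * (real k * (1 / x) ^ k)"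
    using eventually_ge_at_top[of "1::nat"]
  proof eventually_elim
    case (elim k)
    have "x ^ k * (1 / x) ^ k \<le> (a + d * real k) * (1 / x) ^ k"
      using assms[OF elim] x by (intro mult_right_mono) auto
    then show ?case using x by (simp add: power_divide algebra_simps)
  qed
  ultimately have "1 \<le> a * 0 + d * 0" by (rule tendsto_lowerbound) simp
  then show False by simp
qed

lemma test_function_imaginary_axis:
  assumes "y > 0"
  shows "test_function b (Complex 0 y) = complex_of_real ((1 + y) powr (- b))"
proof -
  have e: "1 - \<i> * Complex 0 y = complex_of_real (1 + y)" by (simp add: complex_eq_iff)
  show ?thesis unfolding test_function_def e using assms powr_of_real[of "1 + y" "- b"] by simp
qed

text \<open>On the imaginary axis \<open>k\<close> iterations multiply \<open>y powr (- \<beta>)\<close> by at least \<open>I ^ k\<close> near \<open>L ^ k\<close>,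
  while the pointwise bound there is \<open>A ^ k\<close> times the norm of the test function, which for
  \<open>\<epsilon> = 1 / (2 k ln L)\<close> grows only polynomially in \<open>k\<close>.\<close>

lemma truncated_integral_le_op_norm:
  assumes q: "1 \<le> q" and \<alpha>: "\<alpha> > -1"
    and \<phi>: "\<phi> \<in> borel_measurable (lebesgue_on {0<..})" "\<And>t. t > 0 \<Longrightarrow> \<phi> t \<in> \<real>\<^sub>\<ge>\<^sub>0"
    and bdd: "hausdorff_bounded \<phi> (ennreal q) \<alpha>"
    and A: "0 < A" "hardy_op_norm (ennreal q) \<alpha> (hausdorff_op \<phi>) \<le> ennreal A"
    and L: "1 < L" and \<beta>: "\<beta> * q = 1 + \<alpha>" and I0: "0 \<le> I"
    and I: "ennreal I \<le> (\<integral>\<^sup>+t. indicator {1 / L..L} t * ennreal (t powr (\<beta> - 1) * cmod (\<phi> t)) \<partial>lebesgue_on {0<..})"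
  shows "I \<le> A"
proof -
  define p where "p = ennreal q"
  have p: "1 \<le> p" using q by (simp add: p_def)
  have he: "hardy_exponent p \<alpha> = \<beta>" using q \<beta> by (simp add: p_def hardy_exponent_def field_simps)
  note [measurable] = \<phi>(1) borel_measurable_id_lebesgue_on[of "{0<..}"]
  have "\<beta> * q > 0" using \<beta> \<alpha> by simp
  then have \<beta>0: "\<beta> > 0" using q by (simp add: zero_less_mult_iff)
  have lnL: "ln L > 0" using L by simp
  \<comment> \<open>A lower bound, uniform in \<open>k\<close>, for
    \<open>2 powr (- (\<beta> + \<epsilon>)) * y powr (- \<epsilon>)\<close> on
    \<open>1 \<le> y \<le> L ^ (2 * k)\<close>; with it the test function is at least
    \<open>\<kappa> * y powr (- \<beta>)\<close> there.\<close>
  define \<kappa> where "\<kappa> = 2 powr (- (\<beta> + 1 / (2 * ln L))) * exp (- 1)"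
  have \<kappa>: "\<kappa> > 0" by (simp add: \<kappa>_def)
  have "\<i> \<in> upper_half_plane" by (simp add: upper_half_plane_def)
  from hardy_dilates_locally_bounded[OF p this, of \<alpha>] obtain \<delta> C where \<delta>: "\<delta> > 0" "C \<ge> 0"
    and C: "\<And>f N w t. \<lbrakk>f holomorphic_on upper_half_plane; 0 \<le> N; hardy_norm p \<alpha> f \<le> ennreal N; w \<in> ball \<i> \<delta>; t > 0\<rbrakk>
      \<Longrightarrow> cmod (f (w / complex_of_real t)) \<le> C * N * t powr \<beta>" unfolding he by metis
  have main: "(I / A) ^ k \<le> C / \<kappa> * (1 + 2 / (1 + \<alpha>)) + C / \<kappa> * (4 * ln L / q) * real k" if k: "k \<ge> 1" for k
  proof -
    \<comment> \<open>Chosen so that \<open>(L ^ (2 * k)) powr \<epsilon>\<close> is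
      \<open>exp 1\<close>: over the whole range of heights \<open>y powr (- \<epsilon>)\<close> is
      at least \<open>exp (- 1)\<close>.\<close>
    define \<epsilon> where "\<epsilon> = 1 / (2 * real k * ln L)"
    have \<epsilon>: "\<epsilon> > 0" using k lnL by (simp add: \<epsilon>_def)
    have r: "\<epsilon> * q > 0" "(\<beta> + \<epsilon>) * q = 1 + \<alpha> + \<epsilon> * q" using \<epsilon> q \<beta> by (auto simp: algebra_simps)
    define f where "f = test_function (\<beta> + \<epsilon>)"
    from test_function_in_hardy_space[OF q \<alpha> r] obtain N where fs: "f \<in> hardy_space p \<alpha>"
      and N: "hardy_norm p \<alpha> f = ennreal N" "N > 0" "N powr q \<le> 2 * (1 / (1 + \<alpha>) + 1 / (\<epsilon> * q))"
      unfolding f_def p_def by metis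
    define F where "F = (\<lambda>j. (hausdorff_op \<phi> ^^ j) f)"
    have space: "F j \<in> hardy_space p \<alpha> \<and> hardy_norm p \<alpha> (F j) \<le> ennreal (A ^ j * N)
      \<and> (\<forall>y>0. F j (Complex 0 y) \<in> \<real>\<^sub>\<ge>\<^sub>0)" for j
    proof (induction j)
      case 0
      then show ?case
        using fs N by (auto simp: F_def f_def test_function_imaginary_axis)
    next
      case (Suc j)
      have FS: "F (Suc j) = hausdorff_op \<phi> (F j)" by (simp add: F_def)
      have wd: "hausdorff_well_defined \<phi> (F j)" and sp: "hausdorff_op \<phi> (F j) \<in> hardy_space p \<alpha>"
        using bdd Suc.IH by (auto simp: hausdorff_bounded_def p_def)
      have "hardy_norm p \<alpha> (hausdorff_op \<phi> (F j)) \<le> ennreal (A * (A ^ j * N))"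
        by (rule hardy_norm_le_hardy_op_norm[OF p bdd[folded p_def] _ A(2)[folded p_def]])
          (use Suc.IH A(1) N in auto)
      then show ?case
        using sp hausdorff_op_imaginary_axis(1)[OF \<phi>(2) wd] Suc.IH by (auto simp: FS mult.assoc)
    qed
    \<comment> \<open>For \<open>t\<close> in \<open>{1 / L..L}\<close>, passing from
      \<open>y\<close> to \<open>y / t\<close> moves the height by at most a factor \<open>L\<close>
      either way. So the interval of admissible heights shrinks by \<open>L\<close> at both ends in
      each step, and for \<open>j = k\<close> only \<open>L ^ k\<close> is left.\<close>
    have lower: "\<kappa> * I ^ j * y powr (- \<beta>) \<le> Re (F j (Complex 0 y))"
      if "j \<le> k" "L ^ j \<le> y" "y \<le> L ^ (2 * k - j)" for j y
      using that
    proof (induction j arbitrary: y)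
      case 0
      then have y: "1 \<le> y" "y \<le> L ^ (2 * k)" by auto
      have "(2 * y) powr (- (\<beta> + \<epsilon>)) \<le> (1 + y) powr (- (\<beta> + \<epsilon>))"
        using y \<beta>0 \<epsilon> by (intro powr_mono2') auto
      moreover have "\<kappa> * y powr (- \<beta>) \<le> (2 * y) powr (- (\<beta> + \<epsilon>))"
      proof -
        have "\<epsilon> \<le> 1 / (2 * ln L)" unfolding \<epsilon>_def using k lnL by (intro divide_left_mono) auto
        then have "2 powr (- (\<beta> + 1 / (2 * ln L))) \<le> (2::real) powr (- (\<beta> + \<epsilon>))" by (intro powr_mono) auto
        moreover have "exp (- 1) \<le> y powr (- \<epsilon>)"
        proof -
          have "ln y \<le> real (2 * k) * ln L" using y L by (subst ln_realpow[symmetric]) (auto intro: ln_mono)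
          then have "\<epsilon> * ln y \<le> \<epsilon> * (real (2 * k) * ln L)" using \<epsilon> by (intro mult_left_mono) auto
          also have "\<dots> = 1" using k lnL by (simp add: \<epsilon>_def)
          finally show ?thesis using y by (simp add: powr_def)
        qed
        ultimately have "\<kappa> \<le> 2 powr (- (\<beta> + \<epsilon>)) * y powr (- \<epsilon>)"
          unfolding \<kappa>_def by (intro mult_mono) auto
        then have "\<kappa> * y powr (- \<beta>) \<le> 2 powr (- (\<beta> + \<epsilon>)) * y powr (- \<epsilon>) * y powr (- \<beta>)"
          by (intro mult_right_mono) auto
        also have "\<dots> = (2 * y) powr (- (\<beta> + \<epsilon>))"
        proof -
          have "y powr (- \<epsilon>) * y powr (- \<beta>) = y powr (- (\<beta> + \<epsilon>))"
            by (subst powr_add[symmetric]) (simp add: algebra_simps)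
          then show ?thesis using y by (simp only: powr_mult mult.assoc)
        qed
        finally show ?thesis .
      qed
      ultimately show ?case using y by (simp add: F_def f_def test_function_imaginary_axis)
    next
      case (Suc j)
      have FS: "F (Suc j) = hausdorff_op \<phi> (F j)" by (simp add: F_def)
      have wd: "hausdorff_well_defined \<phi> (F j)"
        using bdd space[of j] by (auto simp: hausdorff_bounded_def p_def)
      have pos: "F j (Complex 0 y) \<in> \<real>\<^sub>\<ge>\<^sub>0" if "y > 0" for y using space[of j] that by blast
      have y0: "y > 0" using Suc.prems(2) L by (smt (verit) zero_less_power)
      have "ennreal (\<kappa> * I ^ Suc j * y powr (- \<beta>)) = ennreal (\<kappa> * I ^ j * y powr (- \<beta>)) * ennreal I"
        using \<kappa> I0 by (simp add: ennreal_mult[symmetric] mult_ac)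
      also have "\<dots> \<le> ennreal (\<kappa> * I ^ j * y powr (- \<beta>))
        * (\<integral>\<^sup>+t. indicator {1 / L..L} t * ennreal (t powr (\<beta> - 1) * cmod (\<phi> t)) \<partial>lebesgue_on {0<..})"
        by (intro mult_left_mono I) auto
      also have "\<dots> = (\<integral>\<^sup>+t. ennreal (\<kappa> * I ^ j * y powr (- \<beta>))
        * (indicator {1 / L..L} t * ennreal (t powr (\<beta> - 1) * cmod (\<phi> t))) \<partial>lebesgue_on {0<..})"
        by (rule nn_integral_cmult[symmetric]) measurable
      also have "\<dots> \<le> (\<integral>\<^sup>+t. ennreal (Re (F j (Complex 0 (y / t))) * (cmod (\<phi> t) / t)) \<partial>lebesgue_on {0<..})"
      proof (rule nn_integral_mono)
        fix t :: real assume "t \<in> space (lebesgue_on {0<..})"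
        then have t: "t > 0" by simp
        show "ennreal (\<kappa> * I ^ j * y powr (- \<beta>)) * (indicator {1 / L..L} t * ennreal (t powr (\<beta> - 1) * cmod (\<phi> t)))
          \<le> ennreal (Re (F j (Complex 0 (y / t))) * (cmod (\<phi> t) / t))"
        proof (cases "t \<in> {1 / L..L}")
          case True
          then have tL: "1 / L \<le> t" "t \<le> L" by auto
          have "L ^ j \<le> y / t"
          proof -
            have "L ^ j * t \<le> L ^ j * L" using tL L by (intro mult_left_mono) auto
            also have "\<dots> \<le> y" using Suc.prems(2) by (simp add: mult.commute)
            finally show ?thesis using t by (simp add: pos_le_divide_eq)
          qed
          moreover have "y / t \<le> L ^ (2 * k - j)"
          proof -
            \<comment> \<open>The subtraction of naturals is genuine here because
              \<open>Suc j \<le> k\<close>.\<close>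
            have e: "2 * k - j = Suc (2 * k - Suc j)" using Suc.prems(1) by simp
            have "1 \<le> t * L" using tL L by (simp add: pos_divide_le_eq)
            then have "y * 1 \<le> y * (t * L)" using y0 by (intro mult_left_mono) auto
            also have "\<dots> \<le> L ^ (2 * k - Suc j) * (t * L)" using Suc.prems(3) t L by (intro mult_right_mono) auto
            also have "\<dots> = L ^ (2 * k - j) * t" by (simp add: e)
            finally show ?thesis using t by (simp add: pos_divide_le_eq)
          qed
          ultimately have "\<kappa> * I ^ j * (y / t) powr (- \<beta>) \<le> Re (F j (Complex 0 (y / t)))"
            using Suc.IH[of "y / t"] Suc.prems(1) by simp
          then have "\<kappa> * I ^ j * (y / t) powr (- \<beta>) * (cmod (\<phi> t) / t) \<le> Re (F j (Complex 0 (y / t))) * (cmod (\<phi> t) / t)"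
            using t by (intro mult_right_mono) auto
          moreover have "\<kappa> * I ^ j * (y / t) powr (- \<beta>) * (cmod (\<phi> t) / t)
            = \<kappa> * I ^ j * y powr (- \<beta>) * (t powr (\<beta> - 1) * cmod (\<phi> t))"
            using t y0 by (simp add: powr_divide powr_minus powr_diff field_simps)
          ultimately show ?thesis
            using True \<kappa> I0 by (simp add: ennreal_mult[symmetric] ennreal_leI)
        qed simp
      qed
      also have "\<dots> = ennreal (Re (F (Suc j) (Complex 0 y)))"
        unfolding FS by (rule hausdorff_op_imaginary_axis(2)[symmetric, OF \<phi>(2) wd pos y0])
      finally show ?case
        using space[of "Suc j"] y0 by (subst (asm) ennreal_le_iff) (auto simp: complex_nonneg_Reals_iff)
    qed
    define T where "T = L ^ k"
    have T: "T > 0" "T \<ge> 1" using L by (auto simp: T_def)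
    have "L ^ k \<le> L ^ (2 * k - k)" by simp
    then have "\<kappa> * I ^ k * T powr (- \<beta>) \<le> Re (F k (Complex 0 T))"
      using lower[of k T] by (simp add: T_def)
    also have "\<dots> \<le> cmod (F k (Complex 0 T))" by (rule complex_Re_le_cmod)
    \<comment> \<open>Seen as a dilate of \<open>\<i>\<close>, this point has an evaluation bound
      with the factor \<open>T powr (- \<beta>)\<close>. The lower bound carries the same factor, so
      it cancels and no further exponential growth in \<open>k\<close> interferes.\<close>
    also have "Complex 0 T = \<i> / complex_of_real (1 / T)" using T by (simp add: complex_eq_iff)
    also have "cmod (F k (\<i> / complex_of_real (1 / T))) \<le> C * (A ^ k * N) * (1 / T) powr \<beta>"
      using space[of k] A N \<delta> T by (intro C) (auto simp: hardy_space_def)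
    also have "(1 / T) powr \<beta> = T powr (- \<beta>)" using T by (simp add: powr_divide powr_minus_divide)
    finally have "\<kappa> * I ^ k \<le> C * (A ^ k * N)" using T by simp
    then have IA: "(I / A) ^ k \<le> C / \<kappa> * N" using \<kappa> A by (simp add: power_divide field_simps)
    \<comment> \<open>Avoiding the q-th root in this way makes the growth in \<open>k\<close>
      linear, because \<open>1 / \<epsilon>\<close> is linear in \<open>k\<close>.\<close>
    have "N \<le> 1 + N powr q"
      using mult_powr_le_one_plus[OF q, of N 1 0] N by simp
    also have "\<dots> \<le> 1 + 2 * (1 / (1 + \<alpha>) + 1 / (\<epsilon> * q))" using N by simp
    also have "\<dots> = 1 + 2 / (1 + \<alpha>) + 4 * ln L / q * real k" by (simp add: \<epsilon>_def)
    finally have "C / \<kappa> * N \<le> C / \<kappa> * (1 + 2 / (1 + \<alpha>) + 4 * ln L / q * real k)"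
      using \<kappa> \<delta> by (intro mult_left_mono) auto
    also have "\<dots> = C / \<kappa> * (1 + 2 / (1 + \<alpha>)) + C / \<kappa> * (4 * ln L / q) * real k"
      by (simp only: distrib_left mult.assoc)
    finally show ?thesis using IA by linarith
  qed
  have "I / A \<le> 1" by (rule le_one_if_powers_linearly_bounded[OF main])
  then show ?thesis using A by simp
qed

text \<open>The truncated integrals share one bound, and monotone convergence removes the
  truncation. For infinite exponent, well-definedness on the constant 1 is already the convergence
  sought.\<close>

lemma integral_finite_if_hausdorff_bounded:
  assumes p: "1 \<le> p" and \<alpha>: "\<alpha> > -1"
    and \<phi>: "\<phi> \<in> borel_measurable (lebesgue_on {0<..})" "\<And>t. t > 0 \<Longrightarrow> \<phi> t \<in> \<real>\<^sub>\<ge>\<^sub>0"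
    and bdd: "hausdorff_bounded \<phi> p \<alpha>"
  shows "(\<integral>\<^sup>+t. ennreal (t powr (hardy_exponent p \<alpha> - 1) * cmod (\<phi> t)) \<partial>lebesgue_on {0<..}) < \<infinity>"
proof (cases p)
  case (real q)
  then have q: "q \<ge> 1" using p by simp
  define \<beta> where "\<beta> = hardy_exponent p \<alpha>"
  have \<beta>: "\<beta> * q = 1 + \<alpha>" using q real by (simp add: \<beta>_def hardy_exponent_def)
  define u where "u = (\<lambda>t. ennreal (t powr (\<beta> - 1) * cmod (\<phi> t)))"
  note [measurable] = \<phi>(1) borel_measurable_id_lebesgue_on[of "{0<..}"]
  have [measurable]: "u \<in> borel_measurable (lebesgue_on {0<..})" by (simp add: u_def)
  obtain a where a: "a \<ge> 0" "hardy_op_norm p \<alpha> (hausdorff_op \<phi>) = ennreal a"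
    using bdd unfolding hausdorff_bounded_def by (cases "hardy_op_norm p \<alpha> (hausdorff_op \<phi>)") auto
  \<comment> \<open>The operator norm may be 0, whereas the iteration divides by
    \<open>A\<close>.\<close>
  define A where "A = a + 1"
  have A: "A > 0" "hardy_op_norm (ennreal q) \<alpha> (hausdorff_op \<phi>) \<le> ennreal A"
    using a real by (auto simp: A_def simp del: ennreal_plus intro!: ennreal_leI)
  have trunc: "(\<integral>\<^sup>+t. indicator {1 / L..L} t * u t \<partial>lebesgue_on {0<..}) \<le> ennreal A" if L: "L > 1" for L
  proof -
    have le: "x \<le> A" if "0 \<le> x" "ennreal x \<le> (\<integral>\<^sup>+t. indicator {1 / L..L} t * u t \<partial>lebesgue_on {0<..})" for x
      using truncated_integral_le_op_norm[OF q \<alpha> \<phi> _ A L \<beta> that(1)] bdd that(2) real by (simp add: u_def)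
    show ?thesis
    proof (cases "\<integral>\<^sup>+t. indicator {1 / L..L} t * u t \<partial>lebesgue_on {0<..}")
      case (real j)
      then show ?thesis using le[of j] by (simp add: ennreal_leI)
    next
      case top
      \<comment> \<open>An infinite truncated integral would dominate \<open>A + 1\<close>, contrary
        to \<open>le\<close>. Integrability of the kernel over compact subintervals is thus derived,
        not presupposed.\<close>
      then show ?thesis using le[of "A + 1"] A by simp
    qed
  qed
  \<comment> \<open>The offset 2 makes the truncation parameter exceed 1 for every
    \<open>n\<close>.\<close>
  define v where "v = (\<lambda>n::nat. \<lambda>t. indicator {1 / real (n + 2)..real (n + 2)} t * u t)"
  have inc: "incseq v"
  proof (rule incseq_SucI, rule le_funI)
    fix n t
    have "1 / real (Suc n + 2) \<le> 1 / real (n + 2)" by (intro divide_left_mono) auto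
    then show "v n t \<le> v (Suc n) t"
      unfolding v_def by (intro mult_right_mono) (auto split: split_indicator)
  qed
  have "(\<integral>\<^sup>+t. u t \<partial>lebesgue_on {0<..}) \<le> (\<integral>\<^sup>+t. (SUP n. v n t) \<partial>lebesgue_on {0<..})"
  proof (rule nn_integral_mono)
    fix t :: real assume "t \<in> space (lebesgue_on {0<..})"
    then have t: "t > 0" by simp
    obtain n where n: "max t (1 / t) \<le> real n" using real_arch_simple by blast
    have "1 / real (n + 2) \<le> t"
    proof -
      have "1 / t \<le> real (n + 2)" using n by simp
      then show ?thesis using t by (simp add: field_simps)
    qed
    then have "v n t = u t" using n by (simp add: v_def)
    then show "u t \<le> (SUP n. v n t)" by (metis SUP_upper UNIV_I)
  qed
  also have "\<dots> = (SUP n. \<integral>\<^sup>+t. v n t \<partial>lebesgue_on {0<..})"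
    by (rule nn_integral_monotone_convergence_SUP[OF inc]) (simp add: v_def)
  also have "\<dots> \<le> ennreal A"
    unfolding v_def by (intro SUP_least trunc) simp
  finally show ?thesis by (auto simp: u_def \<beta>_def intro: le_less_trans)
next
  case top
  define one where "one = (\<lambda>z::complex. 1::complex)"
  have "hardy_norm p \<alpha> one \<le> 1"
    using hardy_norm_infinity_le_iff[of 1 \<alpha> one] top by (simp add: one_def)
  then have "one \<in> hardy_space p \<alpha>" by (auto simp: hardy_space_def one_def intro: le_less_trans)
  then have "hausdorff_well_defined \<phi> one" using bdd by (simp add: hausdorff_bounded_def)
  moreover have "\<i> \<in> upper_half_plane" by (simp add: upper_half_plane_def)
  ultimately have "integrable (lebesgue_on {0<..}) (\<lambda>t. one (\<i> / complex_of_real t) * (\<phi> t / complex_of_real t))"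
    unfolding hausdorff_well_defined_def by (rule bspec)
  then have "integrable (lebesgue_on {0<..}) (\<lambda>t. \<phi> t / complex_of_real t)" by (simp add: one_def)
  then have "(\<integral>\<^sup>+t. ennreal (cmod (\<phi> t / complex_of_real t)) \<partial>lebesgue_on {0<..}) < \<infinity>"
    by (simp add: integrable_iff_bounded)
  also have "(\<integral>\<^sup>+t. ennreal (cmod (\<phi> t / complex_of_real t)) \<partial>lebesgue_on {0<..})
      = (\<integral>\<^sup>+t. ennreal (t powr (hardy_exponent p \<alpha> - 1) * cmod (\<phi> t)) \<partial>lebesgue_on {0<..})"
    by (intro nn_integral_cong) (auto simp: top hardy_exponent_def norm_mult norm_inverse powr_minus divide_inverse mult.commute)
  finally show ?thesis .
qed

theorem theorem1p3:
  fixes p :: ennreal and \<alpha> :: real and \<phi> :: "real \<Rightarrow> complex"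
  assumes "1 \<le> p"
    and "\<alpha> > -1"
    and "\<phi> \<in> borel_measurable (lebesgue_on {0<..})"
  shows "((\<integral>\<^sup>+t. ennreal (t powr (hardy_exponent p \<alpha> - 1) * cmod (\<phi> t)) \<partial>lebesgue_on {0<..}) < \<infinity> \<longrightarrow>
           hausdorff_bounded \<phi> p \<alpha> \<and>
           ennreal (cmod (LINT t|lebesgue_on {0<..}.
                            complex_of_real (t powr (hardy_exponent p \<alpha> - 1)) * \<phi> t))
             \<le> hardy_op_norm p \<alpha> (hausdorff_op \<phi>) \<and>
           hardy_op_norm p \<alpha> (hausdorff_op \<phi>)
             \<le> (\<integral>\<^sup>+t. ennreal (t powr (hardy_exponent p \<alpha> - 1) * cmod (\<phi> t)) \<partial>lebesgue_on {0<..}))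
       \<and> ((\<forall>t>0. \<phi> t \<in> \<real>\<^sub>\<ge>\<^sub>0) \<and> hausdorff_bounded \<phi> p \<alpha> \<longrightarrow>
           (\<integral>\<^sup>+t. ennreal (t powr (hardy_exponent p \<alpha> - 1) * cmod (\<phi> t)) \<partial>lebesgue_on {0<..}) < \<infinity>)"
  using hausdorff_boundedI[OF assms(1,3)] hardy_op_norm_hausdorff_ge[OF assms]
    hardy_op_norm_hausdorff_le[OF assms(1,3)] integral_finite_if_hausdorff_bounded[OF assms]
  by blast

end
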